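(* In the setting described in the context, let $w_j(u,a,z)$ ($j=1,2,3,4$) be the solutions of $d^2w/dz^2=\{u^2f(a,z)+g(z)\}w$ recessive at $z=x_j$, normalized so that $$w_2(u,a,z)=w_1(u,a,z)+w_3(u,a,z),$$ and let $\lambda$ (not necessarily real) be the connection coefficient defined via $$w_4(u,a,z)=e^{\lambda\pi i}w_1(u,a,z)+e^{-\lambda\pi i}w_3(u,a,z).$$ Then, as $u\to\infty$, $$\lambda+\frac12\sim\frac12u\alpha^2+\frac{1}{2\pi i}\sum_{s=0}^{\infty}\frac{\hat E_{2s+1}(a,x_4-i0)-\hat E_{2s+1}(a,x_4+i0)}{u^{2s+1}},$$ where $$\alpha=\left\{\frac2\pi\int_{z_1}^{z_2}\{-f(a,t)\}^{1/2}dt\right\}^{1/2}.$$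
   Context: **Equation.** $u>0$ is a large real parameter, $a_0\le a\le a_1<\infty$, and $f(a,z)$, $g(z)$ are analytic in a complex domain $Z$ (bounded or unbounded), except possibly at boundary points of $Z$; both may depend on $u$. $f$ is real for real $z\in Z$. For $a_0<a\le a_1$, $f(a,\cdot)$ has in $Z$ exactly two zeros, both real and simple, $z_1<z_2$ (turning points), continuous in $a$, with $f<0$ on $(z_1,z_2)$ and $f>0$ for real $z\in Z$ with $z<z_1$ or $z>z_2$; they coalesce into a double zero as $a\to a_0$. **Variables.** $\xi=\int_{z_2}^z\{f(a,t)\}^{1/2}dt$, with $\xi\ge0$ for $z\ge z_2$ and by continuity elsewhere in $Z$ cut along $(-\infty,z_2]$ (same conventions for the branches of $f^{1/2}$, $f^{1/4}$). $\zeta=\zeta(z)$ is defined by $\xi=\int_\alpha^\zeta(t^2-\alpha^2)^{1/2}dt$ with $\alpha\ge 0$ as in the claim; then $\zeta$ is analytic at $z_1,z_2$, with $\zeta(z_1)=-\alpha$, $\zeta(z_2)=\alpha$. **Singularities.** The points $x_1,x_2,x_3,x_4$, assumed to be boundary points of $Z$, correspond respectively to $\zeta=i\infty$ ($\Re\xi=-\infty$), $\zeta=+\infty$ ($\Re\xi=+\infty$), $\zeta=-i\infty$ ($\Re\xi=-\infty$), $\zeta=-\infty$ ($\Re\xi=+\infty$). $x_2,x_4$ are on the (extended) real axis with $-\infty\le x_4<z_1\le z_2<x_2\le\infty$; $x_1,x_3$ are in the upper and lower half-planes. At a finite $x_j$ either (i) $f$ has a pole of order $m>2$ and $g$ is analytic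 or has a pole of order less than $\frac12m+1$, or (ii) $f$ and $g$ have a double pole and $(z-x_j)^2g(z)\to-\frac14$ as $z\to x_j$. If $x_j$ is at infinity, then near it $f=z^p\sum_{s\ge0}f_s(a)z^{-s}$, $g=z^q\sum_{s\ge0}g_sz^{-s}$ (convergent), $f_0(a)\ne0$, $g_0\ne0$, $p,q$ integers with $p>-2$ and $q<\frac12p-1$, or $p=q=-2$ and $g_0=-\frac14$. **Coefficients.** With $'=\partial/\partial z$, $\psi(a,z)=\frac{4ff''-5f'^2}{16f^3}+\frac gf$, $\hat F_1=\frac12\psi$, $\hat F_2=-\frac1{4f^{1/2}}\frac{d\psi}{dz}$, $\hat F_{s+1}=-\frac1{2f^{1/2}}\frac{d\hat F_s}{dz}-\frac12\sum_{j=1}^{s-1}\hat F_j\hat F_{s-j}$ ($s\ge2$), and $\hat E_s(a,z)=\int\hat F_s(a,z)f^{1/2}(a,z)\,dz$, with integration constants independent of $u$. $x_4\pm i0$ denotes the limit at $x_4$ from above/below the cut. **Liouville–Green (LG) solutions.** $Z_j\subset Z$ ($j=1,2,3$) is the set of $z$ that can be joined to $x_j$ by a progressive path in $Z$: a finite chain of $R_2$ arcs (twice continuously differentiable arcs with nonvanishing tangent; e.g. a polygonal path), bounded away from the turning points, along which $\Re(u\xi)$ is monotonic. $Z_4^\pm$ are defined likewise with paths from $x_4\pm i0$. It is assumed that $x_1,x_2\in Z_1\cap Z_2$, and similarly for $Z_1\cap Z_4^+$ ($x_1,x_4+i0$), $Z_3\cap Z_2$ ($x_3,x_2$), $Z_3\cap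 Z_4^-$ ($x_3,x_4-i0$). For each positive integer $n$ the solutions are $w_j=k_{n,j}(u,a)f^{-1/4}W_{n,j}$ ($j=1,2,3$), $w_4=k_{n,4}^\pm(u,a)f^{-1/4}W_{n,4}^\pm$, where $$W_{n,j}=\exp\Big\{u\xi+\sum_{s=1}^{n-1}\frac{\hat E_s(a,z)}{u^s}\Big\}\{1+\eta_{n,j}\}\ (j=1,3),\qquad W_{n,2}=\exp\Big\{-u\xi+\sum_{s=1}^{n-1}(-1)^s\frac{\hat E_s(a,z)}{u^s}\Big\}\{1+\eta_{n,2}\},$$ and $W_{n,4}^\pm$ has the same form as $W_{n,2}$ with error term $\eta_{n,4}^\pm$. The error terms vanish at $x_j$ (respectively $x_4\pm i0$) and are $O(u^{-n})$ as $u\to\infty$, uniformly for $z\in Z_j$ ($j=1,2,3$), respectively $z\in Z_4^\pm$. The $k$'s are independent of $z$, continuous in $a\in[a_0,a_1]$, and such that each $w_j$ is independent of $n$ and the two relations in the claim hold for some $\lambda$.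
   Formalization: The relations fix λ only modulo an integer (λ→λ+1 with w_4→−w_4), so the expansion is proved for λ plus a suitable integer m(u,a), the same for every order, and for λ itself on a branch continuous in a (α also continuous) with λ→−1/2 at a=a_0 as u→∞. *)

theory Defs
  imports "HOL-Complex_Analysis.Complex_Analysis"
begin

text \<open>
  The differential equation is \<open>w'' = (u\<^sup>2 f + g) w\<close> with \<open>a0 \<le> a \<le> a1\<close> and \<open>u \<ge> umin > 0\<close>.
  Since \<open>f\<close>, \<open>g\<close> may depend on \<open>u\<close>, so may all quantities derived from them; the first
  argument is always \<open>u\<close>, the second (if present) is \<open>a\<close>.
\<close>

datatype cpoint = Fin complex | Infty

record tp_data =
  Dom   :: "complex set"                                \<comment> \<open>the domain \<open>Z\<close>\<close>
  a0    :: real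
  a1    :: real
  umin  :: real
  ff    :: "real \<Rightarrow> real \<Rightarrow> complex \<Rightarrow> complex"          \<comment> \<open>\<open>f\<close>\<close>
  gg    :: "real \<Rightarrow> complex \<Rightarrow> complex"                  \<comment> \<open>\<open>g\<close>\<close>
  tp1   :: "real \<Rightarrow> real \<Rightarrow> real"                        \<comment> \<open>the turning point \<open>z\<^sub>1\<close>\<close>
  tp2   :: "real \<Rightarrow> real \<Rightarrow> real"                        \<comment> \<open>the turning point \<open>z\<^sub>2\<close>\<close>
  px1   :: cpoint
  px2   :: ereal
  px3   :: cpoint
  px4   :: ereal
  root4 :: "real \<Rightarrow> real \<Rightarrow> complex \<Rightarrow> complex"          \<comment> \<open>the branch of \<open>f\<close> to the power 1/4\<close>
  xi    :: "real \<Rightarrow> real \<Rightarrow> complex \<Rightarrow> complex"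
  zeta  :: "real \<Rightarrow> real \<Rightarrow> complex \<Rightarrow> complex"
  Ehat  :: "nat \<Rightarrow> real \<Rightarrow> real \<Rightarrow> complex \<Rightarrow> complex"
  sep   :: real  \<comment> \<open>distance which progressive paths keep from the turning points\<close>

definition ereal_pt :: "ereal \<Rightarrow> cpoint" where
  "ereal_pt x = (if \<bar>x\<bar> = \<infinity> then Infty else Fin (complex_of_real (real_of_ereal x)))"

definition pt_nhds :: "cpoint \<Rightarrow> complex filter" where
  "pt_nhds p = (case p of Fin x \<Rightarrow> nhds x | Infty \<Rightarrow> at_infinity)"

definition boundary_point :: "complex set \<Rightarrow> cpoint \<Rightarrow> bool" where
  "boundary_point Z p \<longleftrightarrow> (case p of Fin x \<Rightarrow> x \<in> frontier Z | Infty \<Rightarrow> \<not> bounded Z)"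

definition params :: "tp_data \<Rightarrow> (real \<times> real) set" where
  "params P = {umin P..} \<times> {a0 P..a1 P}"

definition real_span :: "tp_data \<Rightarrow> real set" where
  "real_span P = {x. px4 P < ereal x \<and> ereal x < px2 P}"

definition turning_points :: "complex set \<Rightarrow> (complex \<Rightarrow> complex) \<Rightarrow> real \<Rightarrow> real \<Rightarrow> bool" where
  "turning_points Z f c1 c2 \<longleftrightarrow>
     f holomorphic_on Z \<and>
     (\<forall>x::real. of_real x \<in> Z \<longrightarrow> f (of_real x) \<in> \<real>) \<and>
     {z \<in> Z. f z = 0} = {of_real c1, of_real c2} \<and>
     (\<forall>x. c1 < x \<and> x < c2 \<longrightarrow> Re (f (of_real x)) < 0) \<and>
     (\<forall>x. of_real x \<in> Z \<and> (x < c1 \<or> c2 < x) \<longrightarrow> Re (f (of_real x)) > 0)"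

definition simple_turning_points :: "(complex \<Rightarrow> complex) \<Rightarrow> real \<Rightarrow> real \<Rightarrow> bool" where
  "simple_turning_points f c1 c2 \<longleftrightarrow>
     c1 < c2 \<and> deriv f (of_real c1) \<noteq> 0 \<and> deriv f (of_real c2) \<noteq> 0"

definition coalesced_turning_points :: "(complex \<Rightarrow> complex) \<Rightarrow> real \<Rightarrow> real \<Rightarrow> bool" where
  "coalesced_turning_points f c1 c2 \<longleftrightarrow>
     c1 = c2 \<and> deriv f (of_real c2) = 0 \<and> (deriv ^^ 2) f (of_real c2) \<noteq> 0"

text \<open>
  Poles and expansions are expressed on the part of \<open>Z\<close> close to the boundary point, because
  the values of \<open>f\<close>, \<open>g\<close> outside \<open>Z\<close> are irrelevant.
  In the finite case \<open>l\<close> bounds the pole order of \<open>g\<close> (\<open>l = 0\<close>: analytic).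
  At infinity \<open>F\<close>, \<open>G\<close> are the convergent series in \<open>1/z\<close>.  The leading coefficient of the
  series of \<open>g\<close> is not required to be nonzero (this would only normalise \<open>q\<close>), so that
  \<open>g = 0\<close> is included.
\<close>

definition admissible_singularity ::
  "complex set \<Rightarrow> (complex \<Rightarrow> complex) \<Rightarrow> (complex \<Rightarrow> complex) \<Rightarrow> cpoint \<Rightarrow> bool" where
  "admissible_singularity Z f g p \<longleftrightarrow>
     (case p of
        Fin x \<Rightarrow>
          (\<exists>r>0. \<exists>(m::nat) (l::nat) F G.
             F holomorphic_on ball x r \<and> G holomorphic_on ball x r \<and> F x \<noteq> 0 \<and>
             (\<forall>z \<in> Z \<inter> ball x r. f z = F z / (z - x) ^ m \<and> g z = G z / (z - x) ^ l) \<and>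
             (m > 2 \<and> real l < real m / 2 + 1 \<or> m = 2 \<and> l = 2 \<and> G x = -1/4))
      | Infty \<Rightarrow>
          (\<exists>r>0. \<exists>(p::int) (q::int) F G.
             F holomorphic_on ball 0 r \<and> G holomorphic_on ball 0 r \<and> F 0 \<noteq> 0 \<and>
             (\<forall>z \<in> Z. norm z > 1 / r \<longrightarrow>
                f z = z powi p * F (1 / z) \<and> g z = z powi q * G (1 / z)) \<and>
             (p > -2 \<and> real_of_int q < real_of_int p / 2 - 1 \<or> p = -2 \<and> q = -2 \<and> G 0 = -1/4)))"

definition cut_dom :: "tp_data \<Rightarrow> real \<Rightarrow> real \<Rightarrow> complex set" where
  "cut_dom P u a = Dom P - complex_of_real ` {..tp2 P u a}"

definition alpha :: "tp_data \<Rightarrow> real \<Rightarrow> real \<Rightarrow> real" where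
  "alpha P u a = sqrt (2 / pi *
     integral {tp1 P u a..tp2 P u a} (\<lambda>t. sqrt (- Re (ff P u a (of_real t)))))"

definition rootf :: "tp_data \<Rightarrow> real \<Rightarrow> real \<Rightarrow> complex \<Rightarrow> complex" where
  "rootf P u a z = (root4 P u a z)\<^sup>2"

definition cut_value :: "real \<Rightarrow> (complex \<Rightarrow> complex) \<Rightarrow> real \<Rightarrow> complex" where
  "cut_value \<sigma> h x = Lim (at_right 0) (\<lambda>\<epsilon>. h (Complex x (\<sigma> * \<epsilon>)))"

text \<open>
  All branches are fixed by their values for real \<open>z > z\<^sub>2\<close> and analytic continuation: \<open>root4\<close>
  and \<open>\<xi>\<close> to the cut domain, \<open>\<zeta>\<close> to the whole of \<open>Z\<close>.
\<close>

definition lg_variables :: "tp_data \<Rightarrow> real \<Rightarrow> real \<Rightarrow> bool" where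
  "lg_variables P u a \<longleftrightarrow>
     connected (cut_dom P u a) \<and>
     root4 P u a holomorphic_on cut_dom P u a \<and>
     (\<forall>z \<in> cut_dom P u a. root4 P u a z ^ 4 = ff P u a z) \<and>
     (\<forall>x \<in> real_span P. tp2 P u a < x \<longrightarrow>
        root4 P u a (of_real x) \<in> \<real> \<and> Re (root4 P u a (of_real x)) > 0) \<and>
     (\<forall>z \<in> cut_dom P u a. (xi P u a has_field_derivative rootf P u a z) (at z)) \<and>
     (xi P u a \<longlongrightarrow> 0) (at (of_real (tp2 P u a)) within cut_dom P u a) \<and>
     zeta P u a holomorphic_on Dom P \<and>
     zeta P u a (of_real (tp1 P u a)) = - of_real (alpha P u a) \<and>
     zeta P u a (of_real (tp2 P u a)) = of_real (alpha P u a) \<and>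
     (\<forall>x \<in> real_span P. tp2 P u a < x \<longrightarrow>
        zeta P u a (of_real x) \<in> \<real> \<and> alpha P u a \<le> Re (zeta P u a (of_real x)) \<and>
        xi P u a (of_real x) = of_real
          (integral {alpha P u a..Re (zeta P u a (of_real x))} (\<lambda>t. sqrt (t\<^sup>2 - (alpha P u a)\<^sup>2))))"

definition psi :: "(complex \<Rightarrow> complex) \<Rightarrow> (complex \<Rightarrow> complex) \<Rightarrow> complex \<Rightarrow> complex" where
  "psi f g z = (4 * f z * (deriv ^^ 2) f z - 5 * (deriv f z)\<^sup>2) / (16 * f z ^ 3) + g z / f z"

text \<open>\<open>Fhat r p s\<close> is the \<open>s\<close>-th coefficient for \<open>r\<close> the square root of \<open>f\<close> and \<open>p = \<psi>\<close>;
  the value at \<open>s = 0\<close> is never used.\<close>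

declare sum.cong [fundef_cong]

fun Fhat :: "(complex \<Rightarrow> complex) \<Rightarrow> (complex \<Rightarrow> complex) \<Rightarrow> nat \<Rightarrow> complex \<Rightarrow> complex" where
  "Fhat r p 0 = (\<lambda>z. 0)"
| "Fhat r p (Suc 0) = (\<lambda>z. p z / 2)"
| "Fhat r p (Suc (Suc 0)) = (\<lambda>z. - deriv p z / (4 * r z))"
| "Fhat r p (Suc (Suc (Suc n))) = (\<lambda>z.
     - deriv (Fhat r p (Suc (Suc n))) z / (2 * r z)
     - (\<Sum>j=1..Suc n. Fhat r p j z * Fhat r p (Suc (Suc n) - j) z) / 2)"

text \<open>No condition is put on the integration constants: in particular they may be independent
  of \<open>u\<close>.\<close>

definition lg_coefficients :: "tp_data \<Rightarrow> real \<Rightarrow> real \<Rightarrow> bool" where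
  "lg_coefficients P u a \<longleftrightarrow>
     (\<forall>s\<ge>1. \<forall>z \<in> cut_dom P u a. (Ehat P s u a has_field_derivative
        Fhat (rootf P u a) (psi (ff P u a) (gg P u)) s z * rootf P u a z) (at z))"

text \<open>
  Several of the \<open>x\<^sub>j\<close> may be the point at infinity, and a finite \<open>x\<^sub>j\<close> is approached from
  different sectors.  What is meant by \<open>z \<rightarrow> x\<^sub>j\<close> is therefore given by a filter on the cut
  domain.  As \<open>\<xi> \<sim> \<zeta>\<^sup>2/2\<close> for large \<open>\<zeta>\<close>, the condition \<open>\<zeta> \<rightarrow> i\<infinity>\<close> with \<open>Re \<xi> \<rightarrow> -\<infinity>\<close> amounts to
  \<open>Im \<zeta> \<rightarrow> +\<infinity>\<close> and \<open>Re \<xi> \<rightarrow> -\<infinity>\<close>, and similarly for the others.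
\<close>

definition approach ::
  "complex set \<Rightarrow> cpoint \<Rightarrow> (complex \<Rightarrow> real) \<Rightarrow> (complex \<Rightarrow> real) \<Rightarrow> complex filter" where
  "approach D p X Y =
     inf (inf (principal D) (pt_nhds p)) (inf (filtercomap X at_top) (filtercomap Y at_top))"

definition to_x1 :: "tp_data \<Rightarrow> real \<Rightarrow> real \<Rightarrow> complex filter" where
  "to_x1 P u a = approach (cut_dom P u a \<inter> {z. Im z > 0}) (px1 P)
     (\<lambda>z. - Re (xi P u a z)) (\<lambda>z. Im (zeta P u a z))"

definition to_x2 :: "tp_data \<Rightarrow> real \<Rightarrow> real \<Rightarrow> complex filter" where
  "to_x2 P u a = approach (cut_dom P u a) (ereal_pt (px2 P))
     (\<lambda>z. Re (xi P u a z)) (\<lambda>z. Re (zeta P u a z))"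

definition to_x3 :: "tp_data \<Rightarrow> real \<Rightarrow> real \<Rightarrow> complex filter" where
  "to_x3 P u a = approach (cut_dom P u a \<inter> {z. Im z < 0}) (px3 P)
     (\<lambda>z. - Re (xi P u a z)) (\<lambda>z. - Im (zeta P u a z))"

text \<open>\<open>\<sigma> = 1\<close> is \<open>x\<^sub>4 + i0\<close>, and \<open>\<sigma> = -1\<close> is \<open>x\<^sub>4 - i0\<close>.\<close>

definition to_x4 :: "real \<Rightarrow> tp_data \<Rightarrow> real \<Rightarrow> real \<Rightarrow> complex filter" where
  "to_x4 \<sigma> P u a = approach (cut_dom P u a \<inter> {z. \<sigma> * Im z > 0}) (ereal_pt (px4 P))
     (\<lambda>z. Re (xi P u a z)) (\<lambda>z. - Re (zeta P u a z))"

definition Ehat_x4 :: "real \<Rightarrow> tp_data \<Rightarrow> nat \<Rightarrow> real \<Rightarrow> real \<Rightarrow> complex" where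
  "Ehat_x4 \<sigma> P s u a = Lim (to_x4 \<sigma> P u a) (Ehat P s u a)"

definition singular_correspondence :: "tp_data \<Rightarrow> real \<Rightarrow> real \<Rightarrow> bool" where
  "singular_correspondence P u a \<longleftrightarrow>
     to_x1 P u a \<noteq> bot \<and> to_x3 P u a \<noteq> bot \<and>
     filterlim (\<lambda>x. Re (zeta P u a (of_real x))) at_top (filtercomap ereal (at_left (px2 P))) \<and>
     filterlim (\<lambda>x. Re (xi P u a (of_real x))) at_top (filtercomap ereal (at_left (px2 P))) \<and>
     filterlim (\<lambda>x. Re (zeta P u a (of_real x))) at_bot (filtercomap ereal (at_right (px4 P))) \<and>
     (\<forall>\<sigma>\<in>{1, -1}. filterlim (\<lambda>x. Re (cut_value \<sigma> (xi P u a) x)) at_top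
        (filtercomap ereal (at_right (px4 P))))"

text \<open>The last clause makes the notation \<open>Ehat_x4\<close>, and more generally the value of a coefficient
  at an \<open>x\<^sub>j\<close>, meaningful.\<close>

definition two_turning_point_equation :: "tp_data \<Rightarrow> bool" where
  "two_turning_point_equation P \<longleftrightarrow>
     umin P > 0 \<and> a0 P < a1 P \<and> sep P > 0 \<and>
     open (Dom P) \<and> connected (Dom P) \<and> of_real ` real_span P \<subseteq> Dom P \<and>
     boundary_point (Dom P) (px1 P) \<and> boundary_point (Dom P) (ereal_pt (px2 P)) \<and>
     boundary_point (Dom P) (px3 P) \<and> boundary_point (Dom P) (ereal_pt (px4 P)) \<and>
     (\<forall>x. px1 P = Fin x \<longrightarrow> Im x > 0) \<and> (\<forall>x. px3 P = Fin x \<longrightarrow> Im x < 0) \<and>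
     (\<forall>u\<ge>umin P. gg P u holomorphic_on Dom P \<and>
        continuous_on {a0 P..a1 P} (tp1 P u) \<and> continuous_on {a0 P..a1 P} (tp2 P u) \<and>
        coalesced_turning_points (ff P u (a0 P)) (tp1 P u (a0 P)) (tp2 P u (a0 P)) \<and>
        (\<forall>a. a0 P < a \<and> a \<le> a1 P \<longrightarrow>
           simple_turning_points (ff P u a) (tp1 P u a) (tp2 P u a))) \<and>
     (\<forall>(u, a) \<in> params P.
        {tp1 P u a, tp2 P u a} \<subseteq> real_span P \<and>
        turning_points (Dom P) (ff P u a) (tp1 P u a) (tp2 P u a) \<and>
        (\<forall>p \<in> {px1 P, ereal_pt (px2 P), px3 P, ereal_pt (px4 P)}.
           admissible_singularity (Dom P) (ff P u a) (gg P u) p) \<and>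
        lg_variables P u a \<and> lg_coefficients P u a \<and> singular_correspondence P u a \<and>
        (\<forall>G \<in> {to_x1 P u a, to_x2 P u a, to_x3 P u a, to_x4 1 P u a, to_x4 (-1) P u a}.
           \<forall>s\<ge>1. \<exists>l. (Ehat P s u a \<longlongrightarrow> l) G))"

definition R2_arc :: "real \<Rightarrow> real \<Rightarrow> (real \<Rightarrow> complex) \<Rightarrow> bool" where
  "R2_arc s t \<gamma> \<longleftrightarrow> (\<exists>\<gamma>' \<gamma>''.
     (\<forall>r \<in> {s..t}. (\<gamma> has_vector_derivative \<gamma>' r) (at r within {s..t}) \<and> \<gamma>' r \<noteq> 0 \<and>
        (\<gamma>' has_vector_derivative \<gamma>'' r) (at r within {s..t})) \<and>
     continuous_on {s..t} \<gamma>'')"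

text \<open>\<open>T\<close> is an interval and \<open>K\<close> is the set of junctions of the finite chain.  If an end of \<open>T\<close> is
  not in \<open>T\<close>, the arc there is only required to be \<open>R\<^sub>2\<close> on compact pieces (an infinite arc).\<close>

definition R2_chain :: "real set \<Rightarrow> (real \<Rightarrow> complex) \<Rightarrow> bool" where
  "R2_chain T \<gamma> \<longleftrightarrow> continuous_on T \<gamma> \<and>
     (\<exists>K. finite K \<and> (\<forall>s t. s < t \<and> {s..t} \<subseteq> T \<and> {s<..<t} \<inter> K = {} \<longrightarrow> R2_arc s t \<gamma>))"

text \<open>
  An end of a path is given by a point and the filter along which it is approached.  Paths run
  in the cut domain, where \<open>\<xi>\<close> is defined: the Liouville-Green forms below are not
  continuous across the cut.  The distance \<open>sep P\<close> from the turning points has to be the same for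
  all paths, as the error terms are not uniformly small near the turning points.
\<close>

definition progressive_link ::
  "tp_data \<Rightarrow> real \<Rightarrow> real \<Rightarrow> cpoint \<Rightarrow> complex filter \<Rightarrow> cpoint \<Rightarrow> complex filter \<Rightarrow> bool" where
  "progressive_link P u a p F q G \<longleftrightarrow> (\<exists>\<gamma>.
     R2_chain ({0<..<1} \<union> (if p = Infty then {} else {0}) \<union> (if q = Infty then {} else {1})) \<gamma> \<and>
     (\<forall>t \<in> {0<..<1}. \<gamma> t \<in> cut_dom P u a \<and>
        dist (\<gamma> t) (of_real (tp1 P u a)) \<ge> sep P \<and> dist (\<gamma> t) (of_real (tp2 P u a)) \<ge> sep P) \<and>
     (mono_on {0<..<1} (\<lambda>t. Re (of_real u * xi P u a (\<gamma> t))) \<or>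
      antimono_on {0<..<1} (\<lambda>t. Re (of_real u * xi P u a (\<gamma> t)))) \<and>
     (\<forall>x. p = Fin x \<longrightarrow> \<gamma> 0 = x) \<and> filterlim \<gamma> F (at_right 0) \<and>
     (\<forall>x. q = Fin x \<longrightarrow> \<gamma> 1 = x) \<and> filterlim \<gamma> G (at_left 1))"

definition reach ::
  "tp_data \<Rightarrow> real \<Rightarrow> real \<Rightarrow> cpoint \<Rightarrow> complex filter \<Rightarrow> complex set" where
  "reach P u a p F = {z \<in> cut_dom P u a. progressive_link P u a p F (Fin z) (nhds z)}"

definition Z1 :: "tp_data \<Rightarrow> real \<Rightarrow> real \<Rightarrow> complex set" where
  "Z1 P u a = reach P u a (px1 P) (to_x1 P u a)"

definition Z2 :: "tp_data \<Rightarrow> real \<Rightarrow> real \<Rightarrow> complex set" where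
  "Z2 P u a = reach P u a (ereal_pt (px2 P)) (to_x2 P u a)"

definition Z3 :: "tp_data \<Rightarrow> real \<Rightarrow> real \<Rightarrow> complex set" where
  "Z3 P u a = reach P u a (px3 P) (to_x3 P u a)"

definition Z4 :: "real \<Rightarrow> tp_data \<Rightarrow> real \<Rightarrow> real \<Rightarrow> complex set" where
  "Z4 \<sigma> P u a = reach P u a (ereal_pt (px4 P)) (to_x4 \<sigma> P u a)"

text \<open>\<open>x\<^sub>1, x\<^sub>2 \<in> Z\<^sub>1 \<inter> Z\<^sub>2\<close> and so on; as reversed paths are again progressive, each pair of
  points requires just one path.\<close>

definition singularities_linked :: "tp_data \<Rightarrow> bool" where
  "singularities_linked P \<longleftrightarrow> (\<forall>(u, a) \<in> params P.
     progressive_link P u a (px1 P) (to_x1 P u a) (ereal_pt (px2 P)) (to_x2 P u a) \<and>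
     progressive_link P u a (px1 P) (to_x1 P u a) (ereal_pt (px4 P)) (to_x4 1 P u a) \<and>
     progressive_link P u a (px3 P) (to_x3 P u a) (ereal_pt (px2 P)) (to_x2 P u a) \<and>
     progressive_link P u a (px3 P) (to_x3 P u a) (ereal_pt (px4 P)) (to_x4 (-1) P u a))"

definition ode_solution :: "tp_data \<Rightarrow> real \<Rightarrow> real \<Rightarrow> (complex \<Rightarrow> complex) \<Rightarrow> bool" where
  "ode_solution P u a w \<longleftrightarrow> w holomorphic_on Dom P \<and>
     (\<forall>z \<in> Dom P. (deriv ^^ 2) w z = (of_real (u\<^sup>2) * ff P u a z + gg P u z) * w z)"

definition recessive ::
  "tp_data \<Rightarrow> real \<Rightarrow> real \<Rightarrow> complex filter \<Rightarrow> (complex \<Rightarrow> complex) \<Rightarrow> bool" where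
  "recessive P u a F w \<longleftrightarrow>
     ode_solution P u a w \<and> (\<exists>z \<in> Dom P. w z \<noteq> 0) \<and>
     (\<forall>v. ode_solution P u a v \<and> (\<nexists>c. \<forall>z \<in> Dom P. v z = c * w z) \<longrightarrow>
        ((\<lambda>z. w z / v z) \<longlongrightarrow> 0) F)"

text \<open>\<open>\<sigma> = 1\<close> for \<open>j = 1, 3\<close>, and \<open>\<sigma> = -1\<close> for \<open>j = 2, 4\<close>.\<close>

definition lg_form ::
  "tp_data \<Rightarrow> real \<Rightarrow> nat \<Rightarrow> real \<Rightarrow> real \<Rightarrow> complex \<Rightarrow> (complex \<Rightarrow> complex) \<Rightarrow> complex \<Rightarrow> complex" where
  "lg_form P \<sigma> n u a k \<eta> z = k / root4 P u a z *
     (exp (of_real (\<sigma> * u) * xi P u a z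
        + (\<Sum>s=1..n-1. of_real (\<sigma> ^ s) * Ehat P s u a z / of_real (u ^ s))) * (1 + \<eta> z))"

text \<open>
  \<open>k n u a\<close> and \<open>\<eta> n u a z\<close> are the factor and the error term; \<open>w\<close> does not depend on \<open>n\<close>.
  The error term is defined by \<open>lg_form\<close> on the whole cut domain but is estimated on the set \<open>Zj\<close>
  only.  It vanishes along \<open>home\<close>, and it has values (limits) at the other singularities lying in
  \<open>Zj\<close>, which are approached along the filters in \<open>away\<close>.  The estimate is uniform in \<open>a \<in> A\<close>.
\<close>

definition lg_solution ::
  "tp_data \<Rightarrow> real set \<Rightarrow> real \<Rightarrow> (real \<Rightarrow> real \<Rightarrow> complex set)
   \<Rightarrow> (real \<Rightarrow> real \<Rightarrow> complex filter) \<Rightarrow> (real \<Rightarrow> real \<Rightarrow> complex filter) set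
   \<Rightarrow> (nat \<Rightarrow> real \<Rightarrow> real \<Rightarrow> complex) \<Rightarrow> (nat \<Rightarrow> real \<Rightarrow> real \<Rightarrow> complex \<Rightarrow> complex)
   \<Rightarrow> (real \<Rightarrow> real \<Rightarrow> complex \<Rightarrow> complex) \<Rightarrow> bool" where
  "lg_solution P A \<sigma> Zj home away k \<eta> w \<longleftrightarrow> (\<forall>n\<ge>1.
     (\<forall>u\<ge>umin P. continuous_on {a0 P..a1 P} (k n u)) \<and>
     (\<forall>(u, a) \<in> params P.
        (\<forall>z \<in> cut_dom P u a. w u a z = lg_form P \<sigma> n u a (k n u a) (\<eta> n u a) z) \<and>
        (\<eta> n u a \<longlongrightarrow> 0) (home u a) \<and>
        (\<forall>G \<in> away. \<exists>l. (\<eta> n u a \<longlongrightarrow> l) (G u a))) \<and>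
     (\<exists>C. \<forall>\<^sub>F u in at_top. \<forall>a \<in> A. \<forall>z \<in> Zj u a. norm (\<eta> n u a z) \<le> C / u ^ n))"

text \<open>
  The coefficients may depend on \<open>u\<close>, so the expansion means that for every \<open>N\<close> the remainder
  after \<open>N\<close> terms has the order of the next power of \<open>1/u\<close>.  With \<open>A = {a}\<close> it is the expansion for
  fixed \<open>a\<close>, with \<open>A = {a0 P..a1 P}\<close> the uniform one.
\<close>

definition connection_expansion :: "tp_data \<Rightarrow> real set \<Rightarrow> (real \<Rightarrow> real \<Rightarrow> complex) \<Rightarrow> bool" where
  "connection_expansion P A lam \<longleftrightarrow> (\<forall>N. \<exists>C. \<forall>\<^sub>F u in at_top. \<forall>a \<in> A.
     norm (lam u a + 1/2 -
       (of_real (u * (alpha P u a)\<^sup>2 / 2) + 1 / (2 * of_real pi * \<i>) *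
         (\<Sum>s<N. (Ehat_x4 (-1) P (2 * s + 1) u a - Ehat_x4 1 P (2 * s + 1) u a) / of_real (u ^ (2 * s + 1)))))
     \<le> C / u ^ (2 * N + 1))"

end

theory Submission
  imports Defs
begin

text \<open>
  Multiplied by \<open>f\<^sup>1\<^sup>/\<^sup>4 e\<^sup>\<plusminus>\<^sup>u\<^sup>\<xi>\<close>, the solutions have limits at the singularities, which are given by the
  normalising factors, the values of the coefficients and the values of the error terms.  The two linear
  relations between the solutions thus turn into relations between these constants: at each singularity
  the recessive solution drops out (\<open>connection_relations\<close>).  What links the two sides of the cut is that
  \<open>w3\<close> and \<open>w4\<close> are single-valued: to the left of \<open>z\<^sub>1\<close>, the branch of \<open>f\<^sup>1\<^sup>/\<^sup>4\<close> changes its sign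
  and \<open>\<xi>\<close> changes by \<open>-\<i>\<pi>\<alpha>\<^sup>2\<close> when the cut is crossed (\<open>cut_boundary_values\<close>,
  \<open>solution_across_cut\<close>).  These are the sources of the \<open>1/2\<close> and of the leading term of the expansion.

  Put \<open>X = 2\<pi>i (\<lambda> + 1/2 - u\<alpha>\<^sup>2/2)\<close>, and let \<open>D\<^sub>s\<close> be the difference of the values of the coefficient
  \<open>E\<^sub>s\<close> at \<open>x\<^sub>4 + i0\<close> and \<open>x\<^sub>4 - i0\<close>.  Elimination of the normalising factors, from one half of the
  relations and from the other, gives
  \<open>exp (X - \<Sum>\<^sub>s (-1)\<^sup>s D\<^sub>s/u\<^sup>s + \<theta>) = 1\<close> and \<open>exp (X + \<Sum>\<^sub>s D\<^sub>s/u\<^sup>s + \<theta>') = 1\<close>, with sums over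
  \<open>1 \<le> s < n\<close> and with \<open>\<theta>\<close> and \<open>\<theta>'\<close> of order \<open>u\<^sup>-\<^sup>n\<close>
  (\<open>exponent_equation_1\<close>, \<open>exponent_equation_2\<close>).  The mean of the two exponents contains the odd
  terms only (\<open>average_exponents\<close>), and these make up the expansion.

  It remains to control the multiples of \<open>2\<pi>i\<close>.  The two exponents belong to the same multiple, and the
  multiple does not change with \<open>n\<close>, provided that all \<open>D\<^sub>s\<close> stay bounded as \<open>u \<rightarrow> \<infinity>\<close>.  They do:
  comparing the forms of one solution for two consecutive \<open>n\<close> along a progressive path, one sees that
  the increments of \<open>E\<^sub>s\<close> are bounded (\<open>coefficient_change_bound\<close>), and four such paths join
  \<open>x\<^sub>4 - i0\<close> to \<open>x\<^sub>4 + i0\<close> via \<open>x\<^sub>3\<close>, \<open>x\<^sub>2\<close>, \<open>x\<^sub>1\<close>.  When \<open>\<lambda>\<close> and \<open>\<alpha>\<close> are continuous in \<open>a\<close>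
  and \<open>\<lambda> \<rightarrow> -1/2\<close> at the coalescence of the turning points, continuity forces the integer to be zero
  for large \<open>u\<close> (\<open>expansion_continued_from_coalescence\<close>).
\<close>

section \<open>Boundary values on the cut\<close>

text \<open>Dividing out the two zeros leaves a function \<open>h\<close> that is analytic and, because the multiplicities
  of the zeros are known, zero-free.  On the real interval the sign pattern of \<open>f\<close> is that of
  \<open>(x - c1)(x - c2)\<close>, so \<open>h\<close> is positive there.  The form of the factorization does not distinguish
  simple zeros from a double one, and everything below treats the two cases together.\<close>

lemma turning_point_factorization:
  fixes f :: "complex \<Rightarrow> complex"
  assumes Z: "open Z" and tp: "turning_points Z f c1 c2"
    and mult: "simple_turning_points f c1 c2 \<or> coalesced_turning_points f c1 c2"
    and I: "open I" "of_real ` I \<subseteq> Z" "c1 \<in> I" "c2 \<in> I"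
  obtains h where "h holomorphic_on Z"
    and "\<And>z. z \<in> Z \<Longrightarrow> f z = (z - of_real c1) * (z - of_real c2) * h z"
    and "\<And>x. x \<in> I \<Longrightarrow> h (of_real x) \<in> \<real> \<and> Re (h (of_real x)) > 0"
proof -
  let ?c1 = "complex_of_real c1" and ?c2 = "complex_of_real c2"
  have holf: "f holomorphic_on Z" and freal: "\<And>x. of_real x \<in> Z \<Longrightarrow> f (of_real x) \<in> \<real>"
    and zeros: "{z \<in> Z. f z = 0} = {?c1, ?c2}"
    and neg: "\<And>x. c1 < x \<Longrightarrow> x < c2 \<Longrightarrow> Re (f (of_real x)) < 0"
    and pos: "\<And>x. of_real x \<in> Z \<Longrightarrow> x < c1 \<or> c2 < x \<Longrightarrow> Re (f (of_real x)) > 0"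
    using tp by (auto simp: turning_points_def)
  have c12: "c1 \<le> c2"
    using mult by (auto simp: simple_turning_points_def coalesced_turning_points_def)
  have cZ: "?c1 \<in> Z" "?c2 \<in> Z" and f0: "f ?c1 = 0" "f ?c2 = 0"
    using zeros by auto
  define f1 where "f1 z = (if z = ?c1 then deriv f ?c1 else (f z - f ?c1) / (z - ?c1))" for z
  have hol1: "f1 holomorphic_on Z"
    using pole_lemma[OF holf, of ?c1] cZ Z by (simp add: f1_def[abs_def] interior_open)
  have f_f1: "f z = (z - ?c1) * f1 z" for z
    by (simp add: f1_def f0)
  have f1c2: "f1 ?c2 = 0"
    using mult by (auto simp: f1_def f0 simple_turning_points_def coalesced_turning_points_def)
  define h where "h z = (if z = ?c2 then deriv f1 ?c2 else (f1 z - f1 ?c2) / (z - ?c2))" for z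
  have holh: "h holomorphic_on Z"
    using pole_lemma[OF hol1, of ?c2] cZ Z by (simp add: h_def[abs_def] interior_open)
  have f1_h: "f1 z = (z - ?c2) * h z" for z
    by (simp add: h_def f1c2)
  have fh: "f z = (z - ?c1) * (z - ?c2) * h z" for z
    by (simp add: f_f1 f1_h)
  \<comment> \<open>At the zeros, \<open>h\<close> is read off from \<open>f'\<close> (simple) or \<open>f''\<close> (double).\<close>
  have dh: "(h has_field_derivative deriv h z) (at z)" if "z \<in> Z" for z
    using holomorphic_derivI[OF holh Z that] .
  have df: "deriv f z = (z - ?c2) * h z + (z - ?c1) * h z + (z - ?c1) * (z - ?c2) * deriv h z"
    if "z \<in> Z" for z
  proof -
    have "((\<lambda>z. (z - ?c1) * (z - ?c2) * h z) has_field_derivative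
      (z - ?c2) * h z + (z - ?c1) * h z + (z - ?c1) * (z - ?c2) * deriv h z) (at z)"
      by (rule derivative_eq_intros dh[OF that] refl)+ (simp add: algebra_simps)
    then show ?thesis
      using DERIV_imp_deriv[of f] by (simp add: fh[abs_def] DERIV_imp_deriv)
  qed
  have h_nz: "h z \<noteq> 0" if "z \<in> Z" for z
  proof (cases "z = ?c1 \<or> z = ?c2")
    case False
    then have "f z \<noteq> 0" using zeros that by blast
    then show ?thesis by (metis fh mult_zero_right)
  next
    case True
    show ?thesis
    proof (cases "c1 = c2")
      case False
      then have "simple_turning_points f c1 c2"
        using mult by (auto simp: coalesced_turning_points_def)
      then show ?thesis
        using True df[OF cZ(1)] df[OF cZ(2)] by (auto simp: simple_turning_points_def)
    next
      case eq: True
      then have "(deriv ^^ 2) f ?c2 \<noteq> 0"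
        using mult by (auto simp: coalesced_turning_points_def simple_turning_points_def)
      moreover have "(deriv ^^ 2) f ?c2 = 2 * h ?c2"
      proof -
        have "eventually (\<lambda>z. z \<in> Z) (nhds ?c2)"
          using Z cZ by (simp add: eventually_nhds_in_open)
        then have ev: "eventually (\<lambda>z. deriv f z
            = 2 * (z - ?c2) * h z + (z - ?c2) * (z - ?c2) * deriv h z) (nhds ?c2)"
          by eventually_elim (simp add: df eq)
        have "((\<lambda>z. 2 * (z - ?c2) * h z + (z - ?c2) * (z - ?c2) * deriv h z)
             has_field_derivative 2 * h ?c2) (at ?c2)"
          using holomorphic_derivI[OF holomorphic_deriv[OF holh Z] Z cZ(2)]
          by (auto intro!: derivative_eq_intros dh[OF cZ(2)])
        then show ?thesis
          using deriv_cong_ev[OF ev refl] by (simp add: numeral_2_eq_2 DERIV_imp_deriv)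
      qed
      ultimately show ?thesis using True eq by auto
    qed
  qed
  \<comment> \<open>The sign is found by division off the zeros of \<open>f\<close> and extended to them by continuity.\<close>
  have away: "h (of_real x) \<in> \<real> \<and> Re (h (of_real x)) > 0" if "x \<in> I" "x \<noteq> c1" "x \<noteq> c2" for x
  proof -
    have xZ: "of_real x \<in> Z" using I that by auto
    have eq: "h (of_real x) = f (of_real x) / of_real ((x - c1) * (x - c2))"
      using that by (simp add: fh)
    then have real: "h (of_real x) \<in> \<real>" using freal[OF xZ] by simp
    have "Re (h (of_real x)) = Re (f (of_real x)) / ((x - c1) * (x - c2))"
      unfolding eq by (simp only: Re_divide_of_real)
    moreover have "\<dots> > 0"
    proof (cases "c1 < x \<and> x < c2")
      case True
      then show ?thesis using neg[of x]
        by (intro divide_neg_neg mult_pos_neg) auto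
    next
      case False
      then have "x < c1 \<or> c2 < x" using that by auto
      then show ?thesis using pos[OF xZ] c12
        by (intro divide_pos_pos) (auto simp: zero_less_mult_iff)
    qed
    ultimately show ?thesis using real by simp
  qed
  have lim: "h (of_real x) \<in> \<real> \<and> Re (h (of_real x)) > 0" if x: "x \<in> I" for x
  proof -
    have xZ: "of_real x \<in> Z" using I that by auto
    have "isCont h (of_real x)"
      using dh[OF xZ] by (rule DERIV_isCont)
    then have "isCont (\<lambda>y. h (of_real y)) x"
      by (intro isCont_o2[of x of_real h]) auto
    then have t: "((\<lambda>y. h (of_real y)) \<longlongrightarrow> h (of_real x)) (at x)"
      by (simp only: isCont_def)
    have "eventually (\<lambda>y. y \<in> I - {c1, c2} - {x}) (at x)"
    proof -
      have "open (I - ({c1, c2} - {x}))" using I by (intro open_Diff finite_imp_closed) auto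
      then have "eventually (\<lambda>y. y \<in> I - ({c1, c2} - {x})) (at x)"
        using x by (intro eventually_at_in_open') auto
      then show ?thesis using eventually_neq_at_within[of x x UNIV]
        by eventually_elim auto
    qed
    then have ev: "eventually (\<lambda>y. Im (h (of_real y)) = 0 \<and> Re (h (of_real y)) \<ge> 0) (at x)"
      by eventually_elim (use away in \<open>auto simp: complex_is_Real_iff less_imp_le\<close>)
    have "0 \<le> Re (h (of_real x))"
      by (rule tendsto_lowerbound[OF tendsto_Re[OF t]]) (use ev in \<open>auto elim: eventually_mono\<close>)
    moreover have "Im (h (of_real x)) = 0"
    proof (rule tendsto_unique[OF _ tendsto_Im[OF t]])
      show "((\<lambda>y. Im (h (of_real y))) \<longlongrightarrow> 0) (at x)"
        by (rule tendsto_eventually) (use ev in \<open>auto elim: eventually_mono\<close>)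
    qed simp
    ultimately show ?thesis
      using h_nz[OF xZ] by (auto simp: complex_is_Real_iff complex_eq_iff less_le)
  qed
  show ?thesis
    by (rule that[OF holh fh lim])
qed

text \<open>The principal square root is discontinuous on the negative axis.  Prescribing the sign \<open>\<sigma>\<close> of the
  imaginary part gives a globally continuous function that agrees with it on the half plane
  \<open>\<sigma> Im w > 0\<close>; it supplies the boundary values on that side of the cut.\<close>

definition side_sqrt :: "real \<Rightarrow> complex \<Rightarrow> complex" where
  "side_sqrt \<sigma> w = Complex (sqrt ((cmod w + Re w) / 2)) (\<sigma> * sqrt ((cmod w - Re w) / 2))"

lemma csqrt_eq_side_sqrt: "\<sigma> \<in> {1, -1} \<Longrightarrow> \<sigma> * Im w > 0 \<Longrightarrow> csqrt w = side_sqrt \<sigma> w"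
  by (auto simp: side_sqrt_def complex_eq_iff sgn_if)

lemma continuous_on_side_sqrt [continuous_intros]:
  "continuous_on S g \<Longrightarrow> continuous_on S (\<lambda>z. side_sqrt \<sigma> (g z))"
  unfolding side_sqrt_def Complex_eq by (intro continuous_intros)  auto

lemma side_sqrt_nonneg: "x \<ge> 0 \<Longrightarrow> side_sqrt \<sigma> (of_real x) = of_real (sqrt x)"
  by (simp add: side_sqrt_def complex_eq_iff)

lemma side_sqrt_nonpos: "x \<le> 0 \<Longrightarrow> side_sqrt \<sigma> (of_real x) = of_real \<sigma> * \<i> * of_real (sqrt (- x))"
  by (simp add: side_sqrt_def complex_eq_iff)

text \<open>The fourth power of the quotient of the two sides is 1.  The slit rectangle is star-shaped with
  respect to \<open>y\<close>, hence connected, so the quotient is constant; at \<open>y\<close> both sides are positive.\<close>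

lemma fourth_root_near_axis:
  fixes r h :: "complex \<Rightarrow> complex" and x y c1 c2 \<delta> :: real
  defines "K \<equiv> cbox (Complex x (-\<delta>)) (Complex y \<delta>) - complex_of_real ` {..c2}"
  assumes c: "c1 \<le> c2" "x \<le> y" "c2 < y" "\<delta> \<ge> 0"
    and h: "continuous_on K h" "\<And>z. z \<in> K \<Longrightarrow> Re (h z) > 0"
    and r: "continuous_on K r"
    and r4: "\<And>z. z \<in> K \<Longrightarrow> r z ^ 4 = (z - of_real c1) * (z - of_real c2) * h z"
    and pos: "r (of_real y) \<in> \<real>" "Re (r (of_real y)) > 0" "h (of_real y) \<in> \<real>"
    and z: "z \<in> K"
  shows "r z = csqrt (csqrt (z - of_real c1)) * csqrt (csqrt (z - of_real c2)) * csqrt (csqrt (h z))"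
proof -
  define q where "q w = csqrt (csqrt w)" for w
  have q4: "q w ^ 4 = w" for w
    using power_mult[of "q w" 2 2] by (simp add: q_def)
  have q0: "q w = 0 \<longleftrightarrow> w = 0" for w
    by (simp add: q_def)
  have contq: "continuous_on S (\<lambda>z. q (g z))"
    if "continuous_on S g" "\<And>z. z \<in> S \<Longrightarrow> g z \<notin> \<real>\<^sub>\<le>\<^sub>0" for S and g :: "complex \<Rightarrow> complex"
  proof -
    have "continuous_on (- \<real>\<^sub>\<le>\<^sub>0) q"
      unfolding q_def
      by (rule continuous_on_compose2[OF continuous_on_csqrt continuous_on_csqrt]) auto
    then show ?thesis
      by (rule continuous_on_compose2) (use that in auto)
  qed
  define Q where "Q z = q (z - of_real c1) * q (z - of_real c2) * q (h z)" for z
  have slit: "z - of_real c1 \<notin> \<real>\<^sub>\<le>\<^sub>0" "z - of_real c2 \<notin> \<real>\<^sub>\<le>\<^sub>0" if "z \<in> K" for z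
  proof -
    have *: "Im z \<noteq> 0 \<or> Re z > c2"
    proof (rule ccontr)
      assume "\<not> ?thesis"
      then have "z = of_real (Re z)" "Re z \<le> c2" by (auto simp: complex_eq_iff)
      then have "z \<in> complex_of_real ` {..c2}" by blast
      then show False using that by (simp add: K_def)
    qed
    then show "z - of_real c1 \<notin> \<real>\<^sub>\<le>\<^sub>0" "z - of_real c2 \<notin> \<real>\<^sub>\<le>\<^sub>0"
      using c(1) by (auto simp: complex_nonpos_Reals_iff)
  qed
  have hslit: "h z \<notin> \<real>\<^sub>\<le>\<^sub>0" if "z \<in> K" for z
    using h(2)[OF that] by (auto simp: complex_nonpos_Reals_iff)
  have contQ: "continuous_on K Q"
    unfolding Q_def
    by (intro continuous_on_mult contq continuous_intros h slit hslit)
  have Q4: "Q z ^ 4 = (z - of_real c1) * (z - of_real c2) * h z" for z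
    by (simp add: Q_def power_mult_distrib q4)
  have Qnz: "Q z \<noteq> 0" if "z \<in> K" for z
    using slit[OF that] hslit[OF that] by (auto simp: Q_def q0)
  have yK: "of_real y \<in> K"
    using c by (auto simp: K_def in_cbox_complex_iff)
  have star: "starlike K"
    unfolding starlike_def
  proof (intro bexI[OF _ yK] ballI subsetI)
    fix z w assume z: "z \<in> K" and w: "w \<in> closed_segment (of_real y) z"
    have "w \<in> cbox (Complex x (-\<delta>)) (Complex y \<delta>)"
      using z w yK closed_segment_subset[OF _ _ convex_box(1)] unfolding K_def by blast
    moreover have "w \<notin> complex_of_real ` {..c2}"
    proof
      assume "w \<in> complex_of_real ` {..c2}"
      then obtain t where t: "w = of_real t" "t \<le> c2" by auto
      obtain v where v: "0 \<le> v" "v \<le> 1" "w = (1 - v) *\<^sub>R of_real y + v *\<^sub>R z"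
        using w by (auto simp: closed_segment_def)
      have i: "v * Im z = 0" and re: "t = (1 - v) * y + v * Re z"
        using t v by (auto simp: complex_eq_iff)
      show False
      proof (cases "v = 0")
        case True
        then show False using re t c by simp
      next
        case False
        then have im: "Im z = 0" using i by simp
        have "Re z > c2" using slit(2)[OF z] im by (simp add: complex_nonpos_Reals_iff)
        then have "(1 - v) * c2 + v * c2 < (1 - v) * y + v * Re z"
          using v c False by (intro add_le_less_mono mult_left_mono mult_strict_left_mono) auto
        then show False using re t by (simp add: algebra_simps)
      qed
    qed
    ultimately show "w \<in> K" by (simp add: K_def)
  qed
  have root1: "(r z / Q z) ^ 4 = 1" if "z \<in> K" for z
    using that Qnz[OF that] r4[OF that] by (simp add: power_divide Q4[symmetric])
  have "(\<lambda>z. r z / Q z) constant_on K"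
  proof (intro continuous_finite_range_constant starlike_imp_connected star)
    show "continuous_on K (\<lambda>z. r z / Q z)"
      using Qnz by (intro continuous_on_divide r contQ) auto
    have "(\<lambda>z. r z / Q z) ` K \<subseteq> {w. w ^ 4 = 1}"
      using root1 by blast
    then show "finite ((\<lambda>z. r z / Q z) ` K)"
      by (rule finite_subset) (rule finite_roots_unity, simp)
  qed
  then obtain k where k: "\<And>z. z \<in> K \<Longrightarrow> r z / Q z = k"
    by (auto simp: constant_on_def)
  have "k = 1"
  proof -
    have qpos: "\<exists>s>0. q (of_real t) = of_real s" if "t > 0" for t :: real
      using that by (intro exI[of _ "sqrt (sqrt t)"]) (simp add: q_def of_real_sqrt[symmetric])
    obtain s where s: "h (of_real y) = of_real s" "s > 0"
      using pos(3) h(2)[OF yK] by (auto elim!: Reals_cases)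
    obtain p where p: "r (of_real y) = of_real p" "p > 0"
      using pos(1,2) by (auto elim!: Reals_cases)
    obtain s1 where s1: "q (of_real y - of_real c1) = of_real s1" "s1 > 0"
      using qpos[of "y - c1"] c by auto
    obtain s2 where s2: "q (of_real y - of_real c2) = of_real s2" "s2 > 0"
      using qpos[of "y - c2"] c by auto
    obtain s3 where s3: "q (of_real s) = of_real s3" "s3 > 0"
      using qpos[of s] s by auto
    have keq: "k = of_real (p / (s1 * s2 * s3))"
      using k[OF yK] by (simp add: Q_def s s1 s2 s3 p)
    define t where "t = p / (s1 * s2 * s3)"
    have t: "t > 0" using p s1 s2 s3 by (simp add: t_def)
    have "k ^ 4 = 1"
      using root1[OF yK] unfolding k[OF yK] .
    then have "complex_of_real (t ^ 4) = of_real 1" by (simp add: keq t_def)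
    then have "t ^ 4 = 1" by (simp only: of_real_eq_iff)
    then have "t = 1" using t power_eq_imp_eq_base[of t 4 1] by simp
    then show ?thesis using p(2) by (auto simp: keq t_def)
  qed
  then show ?thesis
    using k[OF z] Qnz[OF z] by (simp add: Q_def q_def field_simps)
qed

lemma tendsto_Complex_at_right_0:
  "((\<lambda>\<epsilon>. Complex x (\<sigma> * \<epsilon>)) \<longlongrightarrow> of_real x) (at_right 0)"
proof -
  have "((\<lambda>\<epsilon>. of_real x + \<i> * of_real (\<sigma> * \<epsilon>)) \<longlongrightarrow> of_real x + \<i> * of_real (\<sigma> * 0)) (at_right 0)"
    by (intro tendsto_intros)
  then show ?thesis by (simp add: Complex_eq)
qed

lemma nonreal_notin: "Im z \<noteq> 0 \<Longrightarrow> z \<notin> complex_of_real ` S"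
  by auto

lemma has_vector_derivative_Complex_fst:
  "((\<lambda>t. Complex t c) has_vector_derivative 1) (at t within S)"
proof -
  have "((\<lambda>t. of_real t + \<i> * of_real c) has_vector_derivative 1) (at t within S)"
    by (auto intro!: derivative_eq_intros simp: has_vector_derivative_of_real)
  then show ?thesis by (simp add: Complex_eq)
qed

lemma turning_point_multiplicity:
  assumes P: "two_turning_point_equation P" and ua: "(u, a) \<in> params P"
  shows "simple_turning_points (ff P u a) (tp1 P u a) (tp2 P u a) \<or>
    coalesced_turning_points (ff P u a) (tp1 P u a) (tp2 P u a)"
proof -
  have u: "u \<ge> umin P" and a: "a0 P \<le> a" "a \<le> a1 P"
    using ua by (auto simp: params_def)
  show ?thesis
  proof (cases "a = a0 P")
    case True
    then show ?thesis
      using P u by (auto simp: two_turning_point_equation_def)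
  next
    case False
    then show ?thesis
      using P u a by (auto simp: two_turning_point_equation_def)
  qed
qed

text \<open>To the left of \<open>z\<^sub>1\<close> each of the factors \<open>(z - z\<^sub>1)\<close> and \<open>(z - z\<^sub>2)\<close> contributes the argument
  \<open>\<plusminus>\<pi>/4\<close> to the fourth root, so the values of \<open>root4\<close> on the two sides have opposite signs.
  The values of \<open>f\<^sup>1\<^sup>/\<^sup>2\<close> on the two sides agree to the left of \<open>z\<^sub>1\<close> and to the right of \<open>z\<^sub>2\<close>
  and are opposite in between.  Integrating along both sides of the axis from a common point
  \<open>y > z\<^sub>2\<close>, one finds that \<open>\<xi>\<close> jumps by \<open>-2\<i>\<close> times the integral of \<open>(-f)\<^sup>1\<^sup>/\<^sup>2\<close> over
  \<open>[z\<^sub>1, z\<^sub>2]\<close>, which is \<open>-\<i>\<pi>\<alpha>\<^sup>2\<close>.\<close>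

lemma cut_boundary_values:
  assumes P: "two_turning_point_equation P" and ua: "(u, a) \<in> params P"
    and x: "px4 P < ereal x" "x < tp1 P u a"
  obtains r X where
    "((\<lambda>\<epsilon>. root4 P u a (Complex x \<epsilon>)) \<longlongrightarrow> r) (at_right 0)"
    "((\<lambda>\<epsilon>. root4 P u a (Complex x (- \<epsilon>))) \<longlongrightarrow> - r) (at_right 0)"
    "((\<lambda>\<epsilon>. xi P u a (Complex x \<epsilon>)) \<longlongrightarrow> X - \<i> * of_real (pi * (alpha P u a)\<^sup>2)) (at_right 0)"
    "((\<lambda>\<epsilon>. xi P u a (Complex x (- \<epsilon>))) \<longlongrightarrow> X) (at_right 0)"
proof -
  define Z where "Z = Dom P"
  define D where "D = cut_dom P u a"
  define f where "f = ff P u a"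
  define c1 where "c1 = tp1 P u a"
  define c2 where "c2 = tp2 P u a"
  define r where "r = root4 P u a"
  define I where "I = real_span P"
  have Z: "open Z" "of_real ` I \<subseteq> Z"
    using P by (auto simp: two_turning_point_equation_def Z_def I_def)
  have pr: "c1 \<in> I" "c2 \<in> I" "turning_points Z f c1 c2" "lg_variables P u a"
    using P ua by (auto simp: two_turning_point_equation_def Z_def I_def f_def c1_def c2_def)
  have mult: "simple_turning_points f c1 c2 \<or> coalesced_turning_points f c1 c2"
    using turning_point_multiplicity[OF P ua] by (simp add: f_def c1_def c2_def)
  have c12: "c1 \<le> c2"
    using mult by (auto simp: simple_turning_points_def coalesced_turning_points_def)
  have xc: "x < c1" using x by (simp add: c1_def)
  have xI: "x \<in> I"
  proof -
    have "ereal x < ereal c1" using xc by simp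
    also have "\<dots> < px2 P" using pr by (simp add: I_def real_span_def)
    finally show ?thesis using x by (simp add: I_def real_span_def)
  qed
  have openI: "open I"
  proof -
    have "open (ereal -` {px4 P<..<px2 P})"
      by (intro open_vimage continuous_on_ereal) auto
    moreover have "ereal -` {px4 P<..<px2 P} = I"
      by (auto simp: I_def real_span_def)
    ultimately show ?thesis by simp
  qed
  obtain h where h: "h holomorphic_on Z"
    and fh: "\<And>z. z \<in> Z \<Longrightarrow> f z = (z - of_real c1) * (z - of_real c2) * h z"
    and hpos: "\<And>x. x \<in> I \<Longrightarrow> h (of_real x) \<in> \<real> \<and> Re (h (of_real x)) > 0"
    using turning_point_factorization[OF Z(1) pr(3) mult openI Z(2) pr(1,2)] by metis
  have conth: "continuous_on Z h" using h by (rule holomorphic_on_imp_continuous_on)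
  obtain y where y: "c2 < y" "y \<in> I"
  proof -
    have c2: "px4 P < ereal c2" "ereal c2 < px2 P"
      using pr by (auto simp: I_def real_span_def)
    then obtain y where y: "ereal c2 < ereal y" "ereal y < px2 P" using ereal_dense2 by blast
    have "px4 P < ereal y" using c2(1) y(1) by (rule less_trans)
    then show ?thesis using y by (intro that[of y]) (auto simp: I_def real_span_def)
  qed
  have xy: "x \<le> y" using xc c12 y by simp
  have seg: "t \<in> I" if "t \<in> {x..y}" for t
  proof -
    have "px4 P < ereal t" using x(1) that by (metis atLeastAtMost_iff ereal_less_eq(3) less_le_trans)
    moreover have "ereal t < px2 P"
      using y(2) that by (metis (mono_tags, lifting) I_def atLeastAtMost_iff ereal_less_eq(3) le_less_trans mem_Collect_eq real_span_def)
    ultimately show ?thesis by (simp add: I_def real_span_def)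
  qed
  \<comment> \<open>A thin rectangle around \<open>[x, y]\<close> on which \<open>h\<close> keeps a positive real part, so that the
    principal roots of \<open>h\<close> are analytic.\<close>
  define U where "U = Z \<inter> h -` {w. 0 < Re w}"
  have "open U"
    unfolding U_def by (intro continuous_open_preimage conth Z open_halfspace_Re_gt)
  moreover have "of_real ` {x..y} \<subseteq> U"
    using seg Z hpos by (auto simp: U_def)
  moreover have "compact (complex_of_real ` {x..y})"
    by (intro compact_continuous_image continuous_intros) auto
  ultimately obtain \<delta> where \<delta>: "\<delta> > 0" "{z. infdist z (complex_of_real ` {x..y}) \<le> \<delta>} \<subseteq> U"
    using compact_in_open_separated[of "complex_of_real ` {x..y}" U] xy by auto
  define K where "K = cbox (Complex x (-\<delta>)) (Complex y \<delta>)"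
  have KU: "K \<subseteq> U"
  proof
    fix z assume z: "z \<in> K"
    then have "of_real (Re z) \<in> complex_of_real ` {x..y}"
      by (auto simp: K_def in_cbox_complex_iff)
    then have "infdist z (complex_of_real ` {x..y}) \<le> dist z (of_real (Re z))"
      by (rule infdist_le)
    also have "\<dots> = \<bar>Im z\<bar>"
      by (simp add: dist_norm cmod_eq_Im[of "z - of_real (Re z)"])
    also have "\<dots> \<le> \<delta>" using z by (auto simp: K_def in_cbox_complex_iff)
    finally show "z \<in> U" using \<delta>(2) by auto
  qed
  have KZ: "K \<subseteq> Z" and Kpos: "\<And>z. z \<in> K \<Longrightarrow> Re (h z) > 0"
    using KU by (auto simp: U_def)
  have Dcut: "D = Z - complex_of_real ` {..c2}"
    by (simp add: D_def cut_dom_def Z_def c2_def)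
  have KD: "K - complex_of_real ` {..c2} \<subseteq> D"
    using KZ by (auto simp: Dcut)
  have rD: "continuous_on D r" "\<And>z. z \<in> D \<Longrightarrow> r z ^ 4 = f z"
    "r (of_real y) \<in> \<real>" "Re (r (of_real y)) > 0"
    and xi: "\<And>z. z \<in> D \<Longrightarrow> (xi P u a has_field_derivative rootf P u a z) (at z)"
    using pr(4) y by (auto simp: lg_variables_def r_def D_def f_def I_def c2_def holomorphic_on_imp_continuous_on)
  have rK: "r z = csqrt (csqrt (z - of_real c1)) * csqrt (csqrt (z - of_real c2)) * csqrt (csqrt (h z))"
    if z: "z \<in> K - complex_of_real ` {..c2}" for z
  proof (rule fourth_root_near_axis[of c1 c2 x y \<delta> h r])
    show "continuous_on (cbox (Complex x (- \<delta>)) (Complex y \<delta>) - complex_of_real ` {..c2}) h"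
      using conth KZ by (rule_tac continuous_on_subset[of Z]) (auto simp: K_def)
    show "continuous_on (cbox (Complex x (- \<delta>)) (Complex y \<delta>) - complex_of_real ` {..c2}) r"
      using rD(1) KD by (auto simp: K_def intro: continuous_on_subset)
    show "r z ^ 4 = (z - of_real c1) * (z - of_real c2) * h z"
      if "z \<in> cbox (Complex x (- \<delta>)) (Complex y \<delta>) - complex_of_real ` {..c2}" for z
    proof -
      have "z \<in> D" "z \<in> Z" using that KD KZ by (auto simp: K_def)
      then show ?thesis using rD(2)[of z] fh[of z] by simp
    qed
    show "0 < Re (h z)" if "z \<in> cbox (Complex x (- \<delta>)) (Complex y \<delta>) - complex_of_real ` {..c2}" for z
      using that Kpos[of z] by (simp add: K_def)
    show "z \<in> cbox (Complex x (- \<delta>)) (Complex y \<delta>) - complex_of_real ` {..c2}"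
      using z by (simp add: K_def)
  qed (use c12 xy y \<delta> rD hpos in auto)
  \<comment> \<open>\<open>B \<sigma>\<close> extends \<open>f\<^sup>1\<^sup>/\<^sup>2\<close> continuously from the open upper (\<open>\<sigma> = 1\<close>) or lower (\<open>\<sigma> = -1\<close>)
    half of the rectangle to its real axis.\<close>
  define B where "B \<sigma> z = side_sqrt \<sigma> (z - of_real c1) * side_sqrt \<sigma> (z - of_real c2) * csqrt (h z)" for \<sigma> z
  note off = nonreal_notin[of _ "{..c2}"]
  have rB: "rootf P u a z = B \<sigma> z" if "\<sigma> \<in> {1, -1}" "z \<in> K" "\<sigma> * Im z > 0" for \<sigma> z
  proof -
    have "Im z \<noteq> 0" using that by auto
    then have "r z = csqrt (csqrt (z - of_real c1)) * csqrt (csqrt (z - of_real c2)) * csqrt (csqrt (h z))"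
      using rK[of z] off[of z] that by simp
    then have "rootf P u a z = csqrt (z - of_real c1) * csqrt (z - of_real c2) * csqrt (h z)"
      by (simp add: rootf_def r_def[symmetric] power_mult_distrib)
    then show ?thesis
      using that by (simp add: B_def csqrt_eq_side_sqrt)
  qed
  have contB: "continuous_on K (B \<sigma>)" for \<sigma>
  proof -
    have "continuous_on K (\<lambda>z. csqrt (h z))"
      by (rule continuous_on_compose2[OF continuous_on_csqrt continuous_on_subset[OF conth KZ]])
        (use Kpos in \<open>force simp: complex_nonpos_Reals_iff\<close>)
    then show ?thesis
      unfolding B_def by (intro continuous_intros)
  qed
  have inK: "Complex t (\<sigma> * \<epsilon>) \<in> K" if "\<sigma> \<in> {1, -1}" "0 \<le> \<epsilon>" "\<epsilon> \<le> \<delta>" "t \<in> {x..y}" for \<sigma> \<epsilon> t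
    using that by (auto simp: K_def in_cbox_complex_iff)
  have small: "eventually (\<lambda>\<epsilon>. 0 < \<epsilon> \<and> \<epsilon> \<le> \<delta>) (at_right 0)"
    using \<delta>(1) by (auto simp: eventually_at_right intro!: exI[of _ \<delta>])
  define s1 s2 where "s1 = sqrt (c1 - x)" and "s2 = sqrt (c2 - x)"
  have s: "s1 > 0" "s2 > 0" using xc c12 by (auto simp: s1_def s2_def)
  have lim_r: "((\<lambda>\<epsilon>. r (Complex x (\<sigma> * \<epsilon>))) \<longlongrightarrow>
      csqrt (of_real \<sigma> * \<i> * of_real s1) * csqrt (of_real \<sigma> * \<i> * of_real s2) * csqrt (csqrt (h (of_real x))))
      (at_right 0)" if \<sigma>: "\<sigma> \<in> {1, -1}" for \<sigma>
  proof -
    note lim = tendsto_Complex_at_right_0[of x \<sigma>]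
    have side: "((\<lambda>\<epsilon>. csqrt (side_sqrt \<sigma> (Complex x (\<sigma> * \<epsilon>) - of_real c))) \<longlongrightarrow>
        csqrt (of_real \<sigma> * \<i> * of_real (sqrt (c - x)))) (at_right 0)" if "x < c" for c
    proof (rule isCont_tendsto_compose[OF continuous_at_csqrt])
      have "continuous_on UNIV (\<lambda>z. side_sqrt \<sigma> (z - of_real c))"
        by (intro continuous_intros)
      then have "isCont (\<lambda>z. side_sqrt \<sigma> (z - of_real c)) (of_real x)"
        by (simp add: continuous_on_eq_continuous_at)
      from isCont_tendsto_compose[OF this lim]
      show "((\<lambda>\<epsilon>. side_sqrt \<sigma> (Complex x (\<sigma> * \<epsilon>) - of_real c)) \<longlongrightarrow>
          of_real \<sigma> * \<i> * of_real (sqrt (c - x))) (at_right 0)"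
        using side_sqrt_nonpos[of "x - c" \<sigma>] that by simp
      show "of_real \<sigma> * \<i> * of_real (sqrt (c - x)) \<notin> \<real>\<^sub>\<le>\<^sub>0"
        using \<sigma> that by (auto simp: complex_nonpos_Reals_iff)
    qed
    have hx: "h (of_real x) \<notin> \<real>\<^sub>\<le>\<^sub>0" "h (of_real x) \<noteq> 0"
      using hpos[OF xI] by (auto simp: complex_nonpos_Reals_iff)
    have "isCont h (of_real x)"
      using holomorphic_derivI[OF h Z(1), of "of_real x"] xI Z(2) by (auto intro: DERIV_isCont)
    then have "((\<lambda>\<epsilon>. h (Complex x (\<sigma> * \<epsilon>))) \<longlongrightarrow> h (of_real x)) (at_right 0)"
      by (rule isCont_tendsto_compose[OF _ lim])
    then have "((\<lambda>\<epsilon>. csqrt (csqrt (h (Complex x (\<sigma> * \<epsilon>))))) \<longlongrightarrow> csqrt (csqrt (h (of_real x)))) (at_right 0)"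
      by (intro isCont_tendsto_compose[OF continuous_at_csqrt])
        (use hx in auto)
    then have "((\<lambda>\<epsilon>. csqrt (side_sqrt \<sigma> (Complex x (\<sigma> * \<epsilon>) - of_real c1))
          * csqrt (side_sqrt \<sigma> (Complex x (\<sigma> * \<epsilon>) - of_real c2)) * csqrt (csqrt (h (Complex x (\<sigma> * \<epsilon>))))) \<longlongrightarrow>
      csqrt (of_real \<sigma> * \<i> * of_real s1) * csqrt (of_real \<sigma> * \<i> * of_real s2) * csqrt (csqrt (h (of_real x))))
      (at_right 0)"
      unfolding s1_def s2_def using xc c12 by (intro tendsto_mult side) auto
    then show ?thesis
    proof (rule Lim_transform_eventually)
      show "\<forall>\<^sub>F \<epsilon> in at_right 0. csqrt (side_sqrt \<sigma> (Complex x (\<sigma> * \<epsilon>) - of_real c1))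
          * csqrt (side_sqrt \<sigma> (Complex x (\<sigma> * \<epsilon>) - of_real c2)) * csqrt (csqrt (h (Complex x (\<sigma> * \<epsilon>))))
          = r (Complex x (\<sigma> * \<epsilon>))"
        using small
      proof eventually_elim
        case (elim \<epsilon>)
        have p: "\<sigma> * Im (Complex x (\<sigma> * \<epsilon>)) > 0" using \<sigma> elim by auto
        then have "Im (Complex x (\<sigma> * \<epsilon>)) \<noteq> 0" by auto
        then have "Complex x (\<sigma> * \<epsilon>) \<in> K - complex_of_real ` {..c2}"
          using inK[OF \<sigma>, of \<epsilon> x] elim xy off by auto
        from rK[OF this] show ?case
          using p by (simp add: csqrt_eq_side_sqrt[OF \<sigma>] del: csqrt.simps)
      qed
    qed
  qed
  have lim_xi: "((\<lambda>\<epsilon>. xi P u a (Complex x (\<sigma> * \<epsilon>))) \<longlongrightarrow>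
      xi P u a (of_real y) - integral {x..y} (\<lambda>t. B \<sigma> (of_real t))) (at_right 0)"
    if \<sigma>: "\<sigma> \<in> {1, -1}" for \<sigma>
  proof -
    define J where "J \<epsilon> = integral (cbox x y) (\<lambda>t. B \<sigma> (Complex t (\<sigma> * \<epsilon>)))" for \<epsilon>
    have "continuous_on {0..\<delta>} J"
      unfolding J_def
    proof (rule integral_continuous_on_param)
      have "continuous_on ({0..\<delta>} \<times> cbox x y) (\<lambda>p. B \<sigma> (Complex (snd p) (\<sigma> * fst p)))"
        by (rule continuous_on_compose2[OF contB])
          (use inK[OF \<sigma>] in \<open>auto simp: Complex_eq intro!: continuous_intros\<close>)
      then show "continuous_on ({0..\<delta>} \<times> cbox x y) (\<lambda>(\<epsilon>, t). B \<sigma> (Complex t (\<sigma> * \<epsilon>)))"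
        by (simp add: case_prod_unfold)
    qed
    then have "(J \<longlongrightarrow> J 0) (at 0 within {0..\<delta>})"
      using \<delta>(1) by (simp add: continuous_on_def)
    then have J: "(J \<longlongrightarrow> J 0) (at_right 0)"
      using \<delta>(1) by (simp add: at_within_Icc_at_right)
    have J0: "J 0 = integral {x..y} (\<lambda>t. B \<sigma> (of_real t))"
      by (simp add: J_def Complex_eq)
    have yD: "of_real y \<in> D"
      using y Z by (auto simp: Dcut)
    have "((\<lambda>\<epsilon>. xi P u a (Complex y (\<sigma> * \<epsilon>))) \<longlongrightarrow> xi P u a (of_real y)) (at_right 0)"
      by (rule isCont_tendsto_compose[OF _ tendsto_Complex_at_right_0])
        (rule DERIV_isCont[OF xi[OF yD]])
    from tendsto_diff[OF this J]
    show ?thesis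
      unfolding J0
    proof (rule Lim_transform_eventually)
      show "\<forall>\<^sub>F \<epsilon> in at_right 0. xi P u a (Complex y (\<sigma> * \<epsilon>)) - J \<epsilon> = xi P u a (Complex x (\<sigma> * \<epsilon>))"
        using small
      proof eventually_elim
        case (elim \<epsilon>)
        have p: "\<sigma> * Im (Complex t (\<sigma> * \<epsilon>)) > 0" for t using \<sigma> elim by auto
        have "((\<lambda>t. rootf P u a (Complex t (\<sigma> * \<epsilon>))) has_integral
            xi P u a (Complex y (\<sigma> * \<epsilon>)) - xi P u a (Complex x (\<sigma> * \<epsilon>))) {x..y}"
        proof (rule fundamental_theorem_of_calculus[OF xy])
          fix t assume t: "t \<in> {x..y}"
          have "Im (Complex t (\<sigma> * \<epsilon>)) \<noteq> 0" using p[of t] by auto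
          then have "Complex t (\<sigma> * \<epsilon>) \<in> K - complex_of_real ` {..c2}"
            using inK[OF \<sigma>, of \<epsilon> t] elim t off by auto
          then have "Complex t (\<sigma> * \<epsilon>) \<in> D" using KD by blast
          from field_vector_diff_chain_within[OF has_vector_derivative_Complex_fst
              has_field_derivative_at_within[OF xi[OF this]]]
          show "((\<lambda>t. xi P u a (Complex t (\<sigma> * \<epsilon>))) has_vector_derivative rootf P u a (Complex t (\<sigma> * \<epsilon>)))
              (at t within {x..y})"
            by (simp add: o_def)
        qed
        moreover have "integral {x..y} (\<lambda>t. rootf P u a (Complex t (\<sigma> * \<epsilon>))) = J \<epsilon>"
          unfolding J_def interval_cbox[symmetric]
          by (intro integral_cong rB \<sigma> inK p) (use elim in auto)
        ultimately show ?case by (simp add: has_integral_iff algebra_simps)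
      qed
    qed
  qed
  have jump: "integral {x..y} (\<lambda>t. B 1 (of_real t)) - integral {x..y} (\<lambda>t. B (-1) (of_real t))
      = \<i> * of_real (pi * (alpha P u a)\<^sup>2)"
  proof -
    have int: "(\<lambda>t. B \<sigma> (of_real t)) integrable_on {x..y}" for \<sigma>
    proof (rule integrable_continuous_interval, rule continuous_on_compose2[OF contB])
      show "complex_of_real ` {x..y} \<subseteq> K" using inK[of 1 0] \<delta>(1) by (auto simp: Complex_eq)
    qed (intro continuous_intros)
    define g where "g t = sqrt (- Re (f (of_real t)))" for t
    have diff: "B 1 (of_real t) - B (-1) (of_real t) = (if t \<in> {c1..c2} then 2 * \<i> * of_real (g t) else 0)"
      if t: "t \<in> {x..y}" for t
    proof -
      have tI: "t \<in> I" using seg t by simp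
      obtain p where p: "h (of_real t) = of_real p" "p > 0"
        using hpos[OF tI] by (auto elim!: Reals_cases)
      have d: "complex_of_real t - of_real c = of_real (t - c)" for c by simp
      consider "t < c1" | "t \<in> {c1..c2}" | "c2 < t" by fastforce
      then show ?thesis
      proof cases
        case 2
        have tZ: "of_real t \<in> Z" using tI Z by auto
        have "Re (f (of_real t)) = (t - c1) * (t - c2) * p"
          using fh[OF tZ] p by simp
        then have "g t = sqrt ((t - c1) * ((c2 - t) * p))"
          by (simp add: g_def algebra_simps)
        then have "g t = sqrt (t - c1) * sqrt (c2 - t) * sqrt p"
          by (simp add: real_sqrt_mult)
        then show ?thesis
          using 2 p unfolding B_def d
          by (simp add: side_sqrt_nonneg side_sqrt_nonpos of_real_sqrt[symmetric] del: of_real_diff)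
      qed (use c12 in \<open>auto simp: B_def d side_sqrt_nonneg side_sqrt_nonpos simp del: of_real_diff\<close>)
    qed
    have sub: "{c1..c2} \<inter> {x..y} = {c1..c2}" using xc y by auto
    have contg: "continuous_on {c1..c2} g"
    proof -
      have "continuous_on Z f" using pr(3) by (simp add: turning_points_def holomorphic_on_imp_continuous_on)
      then have "continuous_on {c1..c2} (\<lambda>t. f (of_real t))"
        by (rule continuous_on_compose2)
          (use seg Z(2) xc y in \<open>auto intro!: continuous_on_of_real\<close>)
      then show ?thesis
        unfolding g_def by (intro continuous_intros)
    qed
    have "integral {x..y} (\<lambda>t. B 1 (of_real t)) - integral {x..y} (\<lambda>t. B (-1) (of_real t))
        = integral {x..y} (\<lambda>t. B 1 (of_real t) - B (-1) (of_real t))"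
      by (rule integral_diff[symmetric, OF int int])
    also have "\<dots> = integral {x..y} (\<lambda>t. if t \<in> {c1..c2} then 2 * \<i> * of_real (g t) else 0)"
      by (rule integral_cong) (rule diff)
    also have "\<dots> = integral {c1..c2} (\<lambda>t. 2 * \<i> * of_real (g t))"
      by (simp only: integral_restrict_Int sub)
    also have "\<dots> = 2 * \<i> * of_real (integral {c1..c2} g)"
      using integral_linear[OF integrable_continuous_interval[OF contg], of "\<lambda>t. 2 * \<i> * complex_of_real t"]
      by (simp add: o_def bounded_linear_const_mult bounded_linear_of_real)
    also have "\<dots> = \<i> * of_real (pi * (alpha P u a)\<^sup>2)"
    proof -
      have "integral {c1..c2} g \<ge> 0"
      proof (rule integral_nonneg[OF integrable_continuous_interval[OF contg]])
        fix t assume "t \<in> {c1..c2}"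
        have "Re (f (of_real t)) \<le> 0"
        proof (cases "t = c1 \<or> t = c2")
          case True
          have "{z \<in> Z. f z = 0} = {of_real c1, of_real c2}"
            using pr(3) by (simp add: turning_points_def)
          then have "f (of_real t) = 0" using True by blast
          then show ?thesis by simp
        next
          case False
          then show ?thesis using pr(3) \<open>t \<in> {c1..c2}\<close> by (auto simp: turning_points_def less_imp_le)
        qed
        then show "0 \<le> g t" by (simp add: g_def)
      qed
      moreover have "alpha P u a = sqrt (2 / pi * integral {c1..c2} g)"
        by (simp add: alpha_def g_def[abs_def] f_def c1_def c2_def)
      ultimately have "(alpha P u a)\<^sup>2 = 2 / pi * integral {c1..c2} g"
        by simp
      then show ?thesis by simp
    qed
    finally show ?thesis .
  qed
  have csq: "csqrt (\<i> * of_real s) = \<i> * csqrt (- \<i> * of_real s)" if "s > 0" for s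
    using csqrt_minus[of "- \<i> * of_real s"] that by simp
  show ?thesis
  proof (rule that)
    show "((\<lambda>\<epsilon>. root4 P u a (Complex x \<epsilon>)) \<longlongrightarrow>
       csqrt (\<i> * of_real s1) * csqrt (\<i> * of_real s2) * csqrt (csqrt (h (of_real x)))) (at_right 0)"
      using lim_r[of 1] by (simp add: r_def del: csqrt.simps)
    show "((\<lambda>\<epsilon>. root4 P u a (Complex x (- \<epsilon>))) \<longlongrightarrow>
       - (csqrt (\<i> * of_real s1) * csqrt (\<i> * of_real s2) * csqrt (csqrt (h (of_real x))))) (at_right 0)"
      using lim_r[of "-1"] unfolding csq[OF s(1)] csq[OF s(2)]
      by (simp add: r_def algebra_simps del: csqrt.simps csqrt_minus)
    show "((\<lambda>\<epsilon>. xi P u a (Complex x (- \<epsilon>))) \<longlongrightarrow>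
       xi P u a (of_real y) - integral {x..y} (\<lambda>t. B (-1) (of_real t))) (at_right 0)"
      using lim_xi[of "-1"] by simp
    show "((\<lambda>\<epsilon>. xi P u a (Complex x \<epsilon>)) \<longlongrightarrow>
       xi P u a (of_real y) - integral {x..y} (\<lambda>t. B (-1) (of_real t))
       - \<i> * of_real (pi * (alpha P u a)\<^sup>2)) (at_right 0)"
      using lim_xi[of 1] unfolding jump[symmetric] by simp
  qed
qed

section \<open>Limits at the two sides of the fourth singularity\<close>

lemma xi_tendsto_cut_value:
  assumes P: "two_turning_point_equation P" and ua: "(u, a) \<in> params P"
    and x: "px4 P < ereal x" "x < tp1 P u a" and \<sigma>: "\<sigma> \<in> {1, -1}"
  shows "((\<lambda>\<epsilon>. xi P u a (Complex x (\<sigma> * \<epsilon>))) \<longlongrightarrow> cut_value \<sigma> (xi P u a) x) (at_right 0)"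
proof -
  obtain r X :: complex where *: "((\<lambda>\<epsilon>. xi P u a (Complex x \<epsilon>)) \<longlongrightarrow> X - \<i> * of_real (pi * (alpha P u a)\<^sup>2)) (at_right 0)"
    "((\<lambda>\<epsilon>. xi P u a (Complex x (- \<epsilon>))) \<longlongrightarrow> X) (at_right 0)"
    using cut_boundary_values[OF P ua x] by metis
  have "\<exists>l. ((\<lambda>\<epsilon>. xi P u a (Complex x (\<sigma> * \<epsilon>))) \<longlongrightarrow> l) (at_right 0)"
    using \<sigma> * by auto
  then show ?thesis
    unfolding cut_value_def by (auto intro: tendsto_Lim[THEN ssubst])
qed

text \<open>The point \<open>p\<close> may be \<open>-\<infinity>\<close>, and then the filter is \<open>at_bot\<close>; this form covers both cases.\<close>

lemma eventually_right_of_ereal: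
  assumes "p < ereal c"
  shows "eventually Q (filtercomap ereal (at_right p)) \<longleftrightarrow>
    (\<exists>b>p. \<forall>x. p < ereal x \<and> ereal x < b \<longrightarrow> Q x)"
proof
  assume "eventually Q (filtercomap ereal (at_right p))"
  then obtain R where "eventually R (at_right p)" "\<forall>x. R (ereal x) \<longrightarrow> Q x"
    by (auto simp: eventually_filtercomap)
  then show "\<exists>b>p. \<forall>x. p < ereal x \<and> ereal x < b \<longrightarrow> Q x"
    using eventually_at_right[OF assms, of R] by blast
next
  assume "\<exists>b>p. \<forall>x. p < ereal x \<and> ereal x < b \<longrightarrow> Q x"
  then obtain b where b: "b > p" "\<forall>x. p < ereal x \<and> ereal x < b \<longrightarrow> Q x" by blast
  have "eventually (\<lambda>y. p < y \<and> y < b) (at_right p)"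
    using eventually_at_right[OF b(1), of "\<lambda>y. p < y \<and> y < b"] b(1) by blast
  then show "eventually Q (filtercomap ereal (at_right p))"
    unfolding eventually_filtercomap using b(2) by blast
qed

text \<open>A property that holds near \<open>x\<^sub>4\<close> on one side of the cut holds in an iterated sense: for the points
  \<open>x\<close> of the cut near \<open>x\<^sub>4\<close> and then, on the perpendicular through \<open>x\<close>, close to the cut.  In this
  form it can be combined with the boundary values at \<open>x\<close>.\<close>

lemma eventually_to_x4:
  assumes P: "two_turning_point_equation P" and ua: "(u, a) \<in> params P"
    and \<sigma>: "\<sigma> \<in> {1, -1}" and ev: "eventually Q (to_x4 \<sigma> P u a)"
  shows "\<forall>\<^sub>F x in filtercomap ereal (at_right (px4 P)). \<forall>\<^sub>F \<epsilon> in at_right 0. Q (Complex x (\<sigma> * \<epsilon>))"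
proof -
  let ?F = "filtercomap ereal (at_right (px4 P))"
  have dom: "open (Dom P)" "of_real ` real_span P \<subseteq> Dom P"
    and tp: "px4 P < ereal (tp1 P u a)" "ereal (tp1 P u a) < px2 P"
    and zeta: "zeta P u a holomorphic_on Dom P"
    and sing: "filterlim (\<lambda>x. Re (zeta P u a (of_real x))) at_bot ?F"
      "filterlim (\<lambda>x. Re (cut_value \<sigma> (xi P u a) x)) at_top ?F"
    using P ua \<sigma> by (auto simp: two_turning_point_equation_def real_span_def lg_variables_def singular_correspondence_def)
  obtain Q1 M1 M2 where Q1: "eventually Q1 (pt_nhds (ereal_pt (px4 P)))"
    and Q: "\<And>z. z \<in> cut_dom P u a \<Longrightarrow> \<sigma> * Im z > 0 \<Longrightarrow> Q1 z \<Longrightarrow> Re (xi P u a z) > M1 \<Longrightarrow>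
      - Re (zeta P u a z) > M2 \<Longrightarrow> Q z"
  proof -
    let ?X = "\<lambda>z. Re (xi P u a z)" and ?Y = "\<lambda>z. - Re (zeta P u a z)"
    obtain A B where AB: "eventually A (inf (principal (cut_dom P u a \<inter> {z. \<sigma> * Im z > 0})) (pt_nhds (ereal_pt (px4 P))))"
        "eventually B (inf (filtercomap ?X at_top) (filtercomap ?Y at_top))" "\<And>z. A z \<Longrightarrow> B z \<Longrightarrow> Q z"
      using ev unfolding to_x4_def approach_def eventually_inf[of Q] by blast
    obtain A1 Q1 where A: "\<And>z. z \<in> cut_dom P u a \<inter> {z. \<sigma> * Im z > 0} \<Longrightarrow> A1 z"
        "eventually Q1 (pt_nhds (ereal_pt (px4 P)))" "\<And>z. A1 z \<Longrightarrow> Q1 z \<Longrightarrow> A z"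
      using AB(1) unfolding eventually_inf[of A] eventually_principal by blast
    obtain B1 B2 where B: "eventually B1 (filtercomap ?X at_top)" "eventually B2 (filtercomap ?Y at_top)"
        "\<And>z. B1 z \<Longrightarrow> B2 z \<Longrightarrow> B z"
      using AB(2) unfolding eventually_inf[of B] by blast
    obtain M1 where M1: "\<And>z. ?X z > M1 \<Longrightarrow> B1 z"
      using B(1) unfolding eventually_filtercomap_at_top_dense by blast
    obtain M2 where M2: "\<And>z. ?Y z > M2 \<Longrightarrow> B2 z"
      using B(2) unfolding eventually_filtercomap_at_top_dense by blast
    show ?thesis
      by (rule that[OF A(2), of M1 M2]) (use A B AB M1 M2 in auto)
  qed
  have near: "\<forall>\<^sub>F x in ?F. \<forall>\<^sub>F \<epsilon> in at_right 0. Q1 (Complex x (\<sigma> * \<epsilon>))"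
  proof (cases "px4 P")
    case (real c)
    then have "eventually Q1 (nhds (of_real c))"
      using Q1 by (simp add: pt_nhds_def ereal_pt_def)
    then have "eventually (\<lambda>w. eventually Q1 (nhds w)) (nhds (of_real c))"
      by (simp add: eventually_eventually)
    moreover have "((\<lambda>x. complex_of_real x) \<longlongrightarrow> of_real c) ?F"
    proof -
      have "((\<lambda>x. ereal x) \<longlongrightarrow> ereal c) ?F"
        unfolding real
        by (rule filterlim_mono[OF filterlim_filtercomap]) (auto intro!: filtercomap_mono at_within_le_nhds)
      then have "((\<lambda>x. x) \<longlongrightarrow> c) ?F" by simp
      then show ?thesis by (rule tendsto_of_real)
    qed
    ultimately have "\<forall>\<^sub>F x in ?F. eventually Q1 (nhds (of_real x))"
      by (rule eventually_compose_filterlim)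
    then show ?thesis
      by eventually_elim (rule eventually_compose_filterlim[OF _ tendsto_Complex_at_right_0])
  next
    case MInf
    then obtain b where b: "\<And>z. norm z \<ge> b \<Longrightarrow> Q1 z"
      using Q1 by (auto simp: pt_nhds_def ereal_pt_def eventually_at_infinity)
    show ?thesis
      unfolding eventually_right_of_ereal[OF tp(1)]
    proof (intro exI[of _ "ereal (- \<bar>b\<bar>)"] conjI allI impI)
      fix x assume "px4 P < ereal x \<and> ereal x < ereal (- \<bar>b\<bar>)"
      then have "x < - \<bar>b\<bar>" by simp
      then have "\<bar>x\<bar> \<ge> b" by linarith
      then have "norm (Complex x (\<sigma> * \<epsilon>)) \<ge> b" for \<epsilon>
        using abs_Re_le_cmod[of "Complex x (\<sigma> * \<epsilon>)"] by simp
      then show "\<forall>\<^sub>F \<epsilon> in at_right 0. Q1 (Complex x (\<sigma> * \<epsilon>))" using b by simp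
    qed (simp add: MInf)
  qed (use tp in simp)
  have range: "\<forall>\<^sub>F x in ?F. px4 P < ereal x \<and> x < tp1 P u a"
    unfolding eventually_right_of_ereal[OF tp(1)] using tp(1) by (intro exI[of _ "ereal (tp1 P u a)"]) auto
  have z4: "\<forall>\<^sub>F x in ?F. - Re (zeta P u a (of_real x)) > M2"
    using sing(1) by (auto simp: filterlim_at_bot_dense elim!: allE[of _ "- M2"] eventually_mono)
  have x4: "\<forall>\<^sub>F x in ?F. Re (cut_value \<sigma> (xi P u a) x) > M1"
    using sing(2) by (auto simp: filterlim_at_top_dense)
  show ?thesis
    using near range z4 x4
  proof eventually_elim
    case (elim x)
    then have x: "px4 P < ereal x" "x < tp1 P u a" by auto
    have "x \<in> real_span P" using x tp by (auto simp: real_span_def intro: less_trans[of _ "ereal (tp1 P u a)"])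
    then have xZ: "of_real x \<in> Dom P" using dom by auto
    note lim = tendsto_Complex_at_right_0[of x \<sigma>]
    have "\<forall>\<^sub>F \<epsilon> in at_right 0. Complex x (\<sigma> * \<epsilon>) \<in> Dom P"
      by (rule topological_tendstoD[OF lim dom(1) xZ])
    moreover have "\<forall>\<^sub>F \<epsilon> in at_right 0. - Re (zeta P u a (Complex x (\<sigma> * \<epsilon>))) > M2"
    proof (rule order_tendstoD(1)[OF _ elim(3)])
      have "isCont (zeta P u a) (of_real x)"
        using holomorphic_derivI[OF zeta dom(1) xZ] by (rule DERIV_isCont)
      then show "((\<lambda>\<epsilon>. - Re (zeta P u a (Complex x (\<sigma> * \<epsilon>)))) \<longlongrightarrow> - Re (zeta P u a (of_real x))) (at_right 0)"
        by (intro tendsto_intros isCont_tendsto_compose[OF _ lim])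
    qed
    moreover have "\<forall>\<^sub>F \<epsilon> in at_right 0. Re (xi P u a (Complex x (\<sigma> * \<epsilon>))) > M1"
      by (rule order_tendstoD(1)[OF tendsto_Re[OF xi_tendsto_cut_value[OF P ua x \<sigma>]] elim(4)])
    moreover have "\<forall>\<^sub>F \<epsilon> in at_right (0::real). \<epsilon> > 0" by (rule eventually_at_right_less)
    ultimately show ?case
      using elim(1)
    proof eventually_elim
      case (elim \<epsilon>)
      have im: "\<sigma> * Im (Complex x (\<sigma> * \<epsilon>)) > 0" using \<sigma> elim by auto
      then have "Im (Complex x (\<sigma> * \<epsilon>)) \<noteq> 0" by auto
      then have "Complex x (\<sigma> * \<epsilon>) \<notin> complex_of_real ` {..tp2 P u a}" by (rule nonreal_notin)
      then have "Complex x (\<sigma> * \<epsilon>) \<in> cut_dom P u a" using elim by (auto simp: cut_dom_def)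
      then show ?case using Q im elim by blast
    qed
  qed
qed

text \<open>Both limits at \<open>x\<^sub>4\<close> are approximated at points lying just above and just below one and the same
  point of the cut, where the jump relation links the two values.\<close>

lemma limits_across_cut:
  assumes P: "two_turning_point_equation P" and ua: "(u, a) \<in> params P"
    and U: "(U \<longlongrightarrow> L) (to_x4 1 P u a)" and V: "(V \<longlongrightarrow> M) (to_x4 (-1) P u a)"
    and jump: "\<And>x. px4 P < ereal x \<Longrightarrow> x < tp1 P u a \<Longrightarrow>
      ((\<lambda>\<epsilon>. U (Complex x \<epsilon>) - \<rho> * V (Complex x (- \<epsilon>))) \<longlongrightarrow> 0) (at_right 0)"
  shows "L = \<rho> * (M :: complex)"
proof (rule ccontr)
  assume "L \<noteq> \<rho> * M"
  define e where "e = norm (L - \<rho> * M) / (norm \<rho> + 3)"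
  have pos: "norm \<rho> + 3 > 0" using norm_ge_zero[of \<rho>] by linarith
  have e: "e > 0" using \<open>L \<noteq> \<rho> * M\<close> pos by (simp add: e_def)
  have tp: "px4 P < ereal (tp1 P u a)"
    using P ua by (auto simp: two_turning_point_equation_def real_span_def)
  have "\<forall>\<^sub>F x in filtercomap ereal (at_right (px4 P)). (\<forall>\<^sub>F \<epsilon> in at_right 0. dist (U (Complex x (1 * \<epsilon>))) L < e)
     \<and> (\<forall>\<^sub>F \<epsilon> in at_right 0. dist (V (Complex x (-1 * \<epsilon>))) M < e)"
    by (intro eventually_conj eventually_to_x4[OF P ua] tendstoD[OF U e] tendstoD[OF V e]) auto
  then obtain b where b: "b > px4 P" "\<And>x. px4 P < ereal x \<Longrightarrow> ereal x < b \<Longrightarrow>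
      (\<forall>\<^sub>F \<epsilon> in at_right 0. dist (U (Complex x \<epsilon>)) L < e) \<and> (\<forall>\<^sub>F \<epsilon> in at_right 0. dist (V (Complex x (- \<epsilon>))) M < e)"
    unfolding eventually_right_of_ereal[OF tp] by auto
  obtain x where x: "px4 P < ereal x" "ereal x < min b (ereal (tp1 P u a))"
    using b(1) tp ereal_dense2[of "px4 P" "min b (ereal (tp1 P u a))"] by auto
  have "\<forall>\<^sub>F \<epsilon> in at_right 0. dist (U (Complex x \<epsilon>) - \<rho> * V (Complex x (- \<epsilon>))) 0 < e"
    by (rule tendstoD[OF jump e]) (use x in auto)
  moreover have "\<forall>\<^sub>F \<epsilon> in at_right 0. dist (U (Complex x \<epsilon>)) L < e"
    "\<forall>\<^sub>F \<epsilon> in at_right 0. dist (V (Complex x (- \<epsilon>))) M < e"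
    using b(2)[of x] x by auto
  ultimately have "\<forall>\<^sub>F \<epsilon> in at_right (0::real). False"
  proof eventually_elim
    case (elim \<epsilon>)
    let ?U = "U (Complex x \<epsilon>)" and ?V = "V (Complex x (- \<epsilon>))"
    have "L - \<rho> * M = (?U - \<rho> * ?V) - (?U - L) + \<rho> * (?V - M)" by (simp add: algebra_simps)
    also have "norm \<dots> \<le> norm (?U - \<rho> * ?V) + norm (?U - L) + norm \<rho> * norm (?V - M)"
      by (metis (no_types, opaque_lifting) add_mono norm_mult norm_triangle_le norm_triangle_ineq4 order_refl)
    also have "\<dots> \<le> e + e + norm \<rho> * e"
      using elim by (intro add_mono mult_left_mono) (auto simp: dist_norm)
    also have "\<dots> < e * (norm \<rho> + 3)" using e by (simp add: algebra_simps)
    also have "\<dots> = norm (L - \<rho> * M)" using pos by (simp add: e_def)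
    finally show ?case by simp
  qed
  then show False by simp
qed

text \<open>A solution is single-valued across the cut, whereas its Liouville-Green form is not.  Hence the jumps
  of \<open>root4\<close> and \<open>\<xi>\<close> fix the ratio of the constants by which the solution is described at
  \<open>x\<^sub>4 + i0\<close> and at \<open>x\<^sub>4 - i0\<close>.\<close>

lemma solution_across_cut:
  assumes P: "two_turning_point_equation P" and ua: "(u, a) \<in> params P"
    and w: "continuous_on (Dom P) w"
    and U: "((\<lambda>z. w z * root4 P u a z * exp (of_real \<tau> * xi P u a z)) \<longlongrightarrow> L) (to_x4 1 P u a)"
    and V: "((\<lambda>z. w z * root4 P u a z * exp (of_real \<tau> * xi P u a z)) \<longlongrightarrow> M) (to_x4 (-1) P u a)"
  shows "L = - exp (- of_real (\<tau> * pi * (alpha P u a)\<^sup>2) * \<i>) * M"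
proof (rule limits_across_cut[OF P ua U V])
  fix x assume x: "px4 P < ereal x" "x < tp1 P u a"
  obtain r X :: complex where
    r: "((\<lambda>\<epsilon>. root4 P u a (Complex x \<epsilon>)) \<longlongrightarrow> r) (at_right 0)"
    "((\<lambda>\<epsilon>. root4 P u a (Complex x (- \<epsilon>))) \<longlongrightarrow> - r) (at_right 0)"
    and X: "((\<lambda>\<epsilon>. xi P u a (Complex x \<epsilon>)) \<longlongrightarrow> X - \<i> * of_real (pi * (alpha P u a)\<^sup>2)) (at_right 0)"
    "((\<lambda>\<epsilon>. xi P u a (Complex x (- \<epsilon>))) \<longlongrightarrow> X) (at_right 0)"
    using cut_boundary_values[OF P ua x] by metis
  have dom: "open (Dom P)" "of_real ` real_span P \<subseteq> Dom P"
    and tp: "ereal (tp1 P u a) < px2 P"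
    using P ua by (auto simp: two_turning_point_equation_def real_span_def)
  have "x \<in> real_span P" using x tp by (auto simp: real_span_def intro: less_trans[of _ "ereal (tp1 P u a)"])
  then have "isCont w (of_real x)"
    using w dom by (auto simp: continuous_on_eq_continuous_at)
  then have w: "((\<lambda>\<epsilon>. w (Complex x \<epsilon>)) \<longlongrightarrow> w (of_real x)) (at_right 0)"
    "((\<lambda>\<epsilon>. w (Complex x (- \<epsilon>))) \<longlongrightarrow> w (of_real x)) (at_right 0)"
    using isCont_tendsto_compose[OF _ tendsto_Complex_at_right_0[of x 1]]
      isCont_tendsto_compose[OF _ tendsto_Complex_at_right_0[of x "-1"]] by auto
  let ?\<rho> = "- exp (- of_real (\<tau> * pi * (alpha P u a)\<^sup>2) * \<i>)"
  have "((\<lambda>\<epsilon>. w (Complex x \<epsilon>) * root4 P u a (Complex x \<epsilon>) * exp (of_real \<tau> * xi P u a (Complex x \<epsilon>))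
     - ?\<rho> * (w (Complex x (- \<epsilon>)) * root4 P u a (Complex x (- \<epsilon>)) * exp (of_real \<tau> * xi P u a (Complex x (- \<epsilon>)))))
     \<longlongrightarrow> w (of_real x) * r * exp (of_real \<tau> * (X - \<i> * of_real (pi * (alpha P u a)\<^sup>2)))
        - ?\<rho> * (w (of_real x) * (- r) * exp (of_real \<tau> * X))) (at_right 0)"
    by (intro tendsto_intros w r X)
  also have "w (of_real x) * r * exp (of_real \<tau> * (X - \<i> * of_real (pi * (alpha P u a)\<^sup>2)))
        - ?\<rho> * (w (of_real x) * (- r) * exp (of_real \<tau> * X)) = 0"
    by (simp add: algebra_simps exp_diff exp_minus field_simps)
  finally show "((\<lambda>\<epsilon>. w (Complex x \<epsilon>) * root4 P u a (Complex x \<epsilon>) * exp (of_real \<tau> * xi P u a (Complex x \<epsilon>))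
     - ?\<rho> * (w (Complex x (- \<epsilon>)) * root4 P u a (Complex x (- \<epsilon>)) * exp (of_real \<tau> * xi P u a (Complex x (- \<epsilon>)))))
     \<longlongrightarrow> 0) (at_right 0)" .
qed

section \<open>Progressive paths\<close>

lemma R2_arc_affine:
  assumes \<gamma>: "R2_arc lo hi \<gamma>" and d: "d \<noteq> 0"
    and im: "(\<lambda>r. c + d * r) ` {s..t} \<subseteq> {lo..hi}"
  shows "R2_arc s t (\<lambda>r. \<gamma> (c + d * r))"
proof -
  obtain \<gamma>' \<gamma>'' where g: "\<And>r. r \<in> {lo..hi} \<Longrightarrow> (\<gamma> has_vector_derivative \<gamma>' r) (at r within {lo..hi})"
      "\<And>r. r \<in> {lo..hi} \<Longrightarrow> \<gamma>' r \<noteq> 0"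
      "\<And>r. r \<in> {lo..hi} \<Longrightarrow> (\<gamma>' has_vector_derivative \<gamma>'' r) (at r within {lo..hi})"
      "continuous_on {lo..hi} \<gamma>''"
    using \<gamma> unfolding R2_arc_def by blast
  have chain: "((\<lambda>r. f (c + d * r)) has_vector_derivative d *\<^sub>R f' (c + d * r)) (at r within {s..t})"
    if "\<And>r. r \<in> {lo..hi} \<Longrightarrow> (f has_vector_derivative f' r) (at r within {lo..hi})" "r \<in> {s..t}"
    for f f' :: "real \<Rightarrow> complex" and r
  proof -
    have "((\<lambda>r. c + d * r) has_vector_derivative d) (at r within {s..t})"
      by (auto intro!: derivative_eq_intros)
    moreover have "(f has_vector_derivative f' (c + d * r)) (at (c + d * r) within (\<lambda>r. c + d * r) ` {s..t})"
    proof (rule has_vector_derivative_within_subset[OF that(1) im])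
      show "c + d * r \<in> {lo..hi}" using that(2) im by blast
    qed
    ultimately show ?thesis
      using vector_diff_chain_within[of "\<lambda>r. c + d * r" d r "{s..t}" f] by (simp add: o_def)
  qed
  show ?thesis
    unfolding R2_arc_def
  proof (intro exI conjI ballI)
    fix r assume r: "r \<in> {s..t}"
    then have r': "c + d * r \<in> {lo..hi}" using im by blast
    show "((\<lambda>r. \<gamma> (c + d * r)) has_vector_derivative d *\<^sub>R \<gamma>' (c + d * r)) (at r within {s..t})"
      using g(1) r by (rule chain)
    show "d *\<^sub>R \<gamma>' (c + d * r) \<noteq> 0" using g(2)[OF r'] d by simp
    show "((\<lambda>r. d *\<^sub>R \<gamma>' (c + d * r)) has_vector_derivative d *\<^sub>R (d *\<^sub>R \<gamma>'' (c + d * r))) (at r within {s..t})"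
      using chain[OF g(3) r] by (rule bounded_linear.has_vector_derivative[OF bounded_linear_scaleR_right])
  next
    show "continuous_on {s..t} (\<lambda>r. d *\<^sub>R (d *\<^sub>R \<gamma>'' (c + d * r)))"
      by (intro continuous_intros continuous_on_compose2[OF g(4)] im)
  qed
qed

text \<open>Initial pieces and reversals of a path are reparametrizations by affine maps.\<close>

lemma R2_chain_affine:
  assumes \<gamma>: "R2_chain T \<gamma>" and d: "d \<noteq> 0" and T': "\<And>r. r \<in> T' \<Longrightarrow> c + d * r \<in> T"
  shows "R2_chain T' (\<lambda>r. \<gamma> (c + d * r))"
proof -
  obtain K where K: "finite K" "\<And>s t. s < t \<Longrightarrow> {s..t} \<subseteq> T \<Longrightarrow> {s<..<t} \<inter> K = {} \<Longrightarrow> R2_arc s t \<gamma>"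
    and cont: "continuous_on T \<gamma>"
    using \<gamma> unfolding R2_chain_def by blast
  have "continuous_on T' (\<lambda>r. \<gamma> (c + d * r))"
    using T' by (intro continuous_on_compose2[OF cont] continuous_intros) auto
  moreover have "R2_arc s t (\<lambda>r. \<gamma> (c + d * r))"
    if st: "s < t" "{s..t} \<subseteq> T'" "{s<..<t} \<inter> (\<lambda>k. (k - c) / d) ` K = {}" for s t
  proof -
    define lo hi where "lo = min (c + d * s) (c + d * t)" and "hi = max (c + d * s) (c + d * t)"
    have im: "(\<lambda>r. c + d * r) ` {s..t} = {lo..hi}"
      using st(1) d image_affinity_atLeastAtMost[of d c s t]
      by (cases "d > 0") (auto simp: lo_def hi_def algebra_simps min_def max_def mult_le_cancel_left)
    have inv: "c + d * ((k - c) / d) = k" for k using d by simp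
    have "R2_arc lo hi \<gamma>"
    proof (rule K(2))
      show "lo < hi" using st(1) d by (auto simp: lo_def hi_def min_def max_def mult_less_cancel_left neq_iff)
      show "{lo..hi} \<subseteq> T" unfolding im[symmetric] using T' st(2) by auto
      show "{lo<..<hi} \<inter> K = {}"
      proof (rule equals0I)
        fix k assume k: "k \<in> {lo<..<hi} \<inter> K"
        then have "k \<in> (\<lambda>r. c + d * r) ` {s..t}" unfolding im by auto
        then obtain r where r: "r \<in> {s..t}" "k = c + d * r" by auto
        have "r \<noteq> s" "r \<noteq> t" using k r by (auto simp: lo_def hi_def)
        then have "r \<in> {s<..<t}" using r by auto
        moreover have "r = (k - c) / d" using r d by simp
        ultimately show False using st(3) k by blast
      qed
    qed
    then show ?thesis by (rule R2_arc_affine) (use d im in auto)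
  qed
  moreover have "finite ((\<lambda>k. (k - c) / d) ` K)" using K(1) by simp
  ultimately show ?thesis unfolding R2_chain_def by blast
qed

lemma progressive_link_reverse:
  assumes "progressive_link P u a p F q G"
  shows "progressive_link P u a q G p F"
proof -
  obtain \<gamma> where \<gamma>: "R2_chain ({0<..<1} \<union> (if p = Infty then {} else {0}) \<union> (if q = Infty then {} else {1})) \<gamma>"
     "\<forall>t \<in> {0<..<1}. \<gamma> t \<in> cut_dom P u a \<and>
        dist (\<gamma> t) (of_real (tp1 P u a)) \<ge> sep P \<and> dist (\<gamma> t) (of_real (tp2 P u a)) \<ge> sep P"
     "mono_on {0<..<1} (\<lambda>t. Re (of_real u * xi P u a (\<gamma> t))) \<or>
      antimono_on {0<..<1} (\<lambda>t. Re (of_real u * xi P u a (\<gamma> t)))"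
     "\<forall>x. p = Fin x \<longrightarrow> \<gamma> 0 = x" "filterlim \<gamma> F (at_right 0)"
     "\<forall>x. q = Fin x \<longrightarrow> \<gamma> 1 = x" "filterlim \<gamma> G (at_left 1)"
    using assms unfolding progressive_link_def by blast
  define \<rho> where "\<rho> t = \<gamma> (1 + (-1) * t)" for t
  have "R2_chain ({0<..<1} \<union> (if q = Infty then {} else {0}) \<union> (if p = Infty then {} else {1})) \<rho>"
    unfolding \<rho>_def by (rule R2_chain_affine[OF \<gamma>(1)]) (auto split: if_splits)
  moreover have "\<forall>t \<in> {0<..<1}. \<rho> t \<in> cut_dom P u a \<and>
        dist (\<rho> t) (of_real (tp1 P u a)) \<ge> sep P \<and> dist (\<rho> t) (of_real (tp2 P u a)) \<ge> sep P"
    using \<gamma>(2) by (auto simp: \<rho>_def)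
  moreover have "mono_on {0<..<1} (\<lambda>t. Re (of_real u * xi P u a (\<rho> t))) \<or>
      antimono_on {0<..<1} (\<lambda>t. Re (of_real u * xi P u a (\<rho> t)))"
    using \<gamma>(3) unfolding monotone_on_def \<rho>_def by (elim disjE) (rule disjI2, simp, rule disjI1, simp)
  moreover have "\<forall>x. q = Fin x \<longrightarrow> \<rho> 0 = x" "\<forall>x. p = Fin x \<longrightarrow> \<rho> 1 = x"
    using \<gamma>(4,6) by (auto simp: \<rho>_def)
  moreover have "filterlim \<rho> G (at_right 0)"
  proof -
    have "filterlim (\<lambda>t. 1 - t) (at_left 1) (at_right (0::real))"
      unfolding filterlim_at
      by (auto intro!: tendsto_eq_intros simp: eventually_at intro!: exI[of _ 1])
    from filterlim_compose[OF \<gamma>(7) this] show ?thesis by (simp add: \<rho>_def[abs_def])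
  qed
  moreover have "filterlim \<rho> F (at_left 1)"
  proof -
    have "filterlim (\<lambda>t. 1 - t) (at_right 0) (at_left (1::real))"
      unfolding filterlim_at
      by (auto intro!: tendsto_eq_intros simp: eventually_at intro!: exI[of _ 1])
    from filterlim_compose[OF \<gamma>(5) this] show ?thesis by (simp add: \<rho>_def[abs_def])
  qed
  ultimately show ?thesis
    unfolding progressive_link_def by blast
qed

text \<open>Every interior point of a progressive path is itself reached from the beginning of the path,
  by the initial piece.  So an error term that is estimated on \<open>reach\<close> is estimated along the whole path.\<close>

lemma progressive_link_path:
  assumes "progressive_link P u a p F q G"
  shows "\<exists>\<gamma>::real \<Rightarrow> complex. continuous_on {0<..<1} \<gamma> \<and> (\<forall>t\<in>{0<..<1}. \<gamma> t \<in> reach P u a p F) \<and>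
    filterlim \<gamma> F (at_right 0) \<and> filterlim \<gamma> G (at_left 1)"
proof -
  obtain \<gamma> where \<gamma>: "R2_chain ({0<..<1} \<union> (if p = Infty then {} else {0}) \<union> (if q = Infty then {} else {1})) \<gamma>"
     "\<forall>t \<in> {0<..<1}. \<gamma> t \<in> cut_dom P u a \<and>
        dist (\<gamma> t) (of_real (tp1 P u a)) \<ge> sep P \<and> dist (\<gamma> t) (of_real (tp2 P u a)) \<ge> sep P"
     "mono_on {0<..<1} (\<lambda>t. Re (of_real u * xi P u a (\<gamma> t))) \<or>
      antimono_on {0<..<1} (\<lambda>t. Re (of_real u * xi P u a (\<gamma> t)))"
     "\<forall>x. p = Fin x \<longrightarrow> \<gamma> 0 = x" "filterlim \<gamma> F (at_right 0)"
     "\<forall>x. q = Fin x \<longrightarrow> \<gamma> 1 = x" "filterlim \<gamma> G (at_left 1)"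
    using assms unfolding progressive_link_def by blast
  have cont: "continuous_on {0<..<1} \<gamma>"
    using \<gamma>(1) by (auto simp: R2_chain_def intro: continuous_on_subset)
  have reach: "\<gamma> t \<in> reach P u a p F" if t: "t \<in> {0<..<1}" for t
  proof -
    define \<rho> where "\<rho> s = \<gamma> (0 + t * s)" for s
    have ts: "t * s \<in> {0<..<1}" if "s \<in> {0<..<1}" for s
      using mult_strict_mono[of t 1 s 1] t that by auto
    have "R2_chain ({0<..<1} \<union> (if p = Infty then {} else {0}) \<union> (if Fin (\<gamma> t) = Infty then {} else {1})) \<rho>"
      unfolding \<rho>_def by (rule R2_chain_affine[OF \<gamma>(1)]) (use t ts in \<open>auto split: if_splits\<close>)
    moreover have "\<forall>t \<in> {0<..<1}. \<rho> t \<in> cut_dom P u a \<and>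
        dist (\<rho> t) (of_real (tp1 P u a)) \<ge> sep P \<and> dist (\<rho> t) (of_real (tp2 P u a)) \<ge> sep P"
      using \<gamma>(2) ts by (simp add: \<rho>_def)
    moreover have "mono_on {0<..<1} (\<lambda>s. Re (of_real u * xi P u a (\<rho> s))) \<or>
      antimono_on {0<..<1} (\<lambda>s. Re (of_real u * xi P u a (\<rho> s)))"
      using \<gamma>(3) t ts unfolding monotone_on_def \<rho>_def by (elim disjE) (rule disjI1, simp, rule disjI2, simp)
    moreover have "\<forall>x. p = Fin x \<longrightarrow> \<rho> 0 = x" "\<forall>x. Fin (\<gamma> t) = Fin x \<longrightarrow> \<rho> 1 = x"
      using \<gamma>(4) by (auto simp: \<rho>_def)
    moreover have "filterlim \<rho> F (at_right 0)"
    proof -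
      have "filterlim (\<lambda>s. t * s) (at_right 0) (at_right 0)"
        unfolding filterlim_at
        using t by (auto intro!: tendsto_eq_intros simp: eventually_at_right_less eventually_at intro!: exI[of _ 1])
      from filterlim_compose[OF \<gamma>(5) this] show ?thesis by (simp add: \<rho>_def[abs_def])
    qed
    moreover have "filterlim \<rho> (nhds (\<gamma> t)) (at_left 1)"
    proof -
      have "isCont \<gamma> t"
        using cont t by (simp add: continuous_on_eq_continuous_at)
      moreover have "((\<lambda>s. t * s) \<longlongrightarrow> t) (at_left 1)"
        by (auto intro!: tendsto_eq_intros)
      ultimately show ?thesis by (simp add: \<rho>_def[abs_def] isCont_tendsto_compose)
    qed
    moreover have "\<gamma> t \<in> cut_dom P u a" using \<gamma>(2) t by auto
    ultimately show ?thesis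
      unfolding reach_def progressive_link_def by blast
  qed
  show ?thesis using cont reach \<gamma>(5,7) by blast
qed

section \<open>Error terms and coefficients along progressive paths\<close>

lemma lg_solutionD:
  assumes "lg_solution P A \<sigma> Zj home away k \<eta> w" "n \<ge> 1" "(u, a) \<in> params P"
  shows "\<And>z. z \<in> cut_dom P u a \<Longrightarrow> w u a z = lg_form P \<sigma> n u a (k n u a) (\<eta> n u a) z"
    and "(\<eta> n u a \<longlongrightarrow> 0) (home u a)"
  using assms unfolding lg_solution_def by blast+

lemma lg_error_bound_along_path:
  assumes lg: "lg_solution P A \<sigma> Zj home away k \<eta> w" and n: "n \<ge> 1"
  obtains C where "C \<ge> 0" "\<forall>\<^sub>F u in at_top. \<forall>a\<in>A. \<forall>z\<in>Zj u a. norm (\<eta> n u a z) \<le> C / u ^ n"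
proof -
  from lg n obtain C where C: "\<forall>\<^sub>F u in at_top. \<forall>a\<in>A. \<forall>z\<in>Zj u a. norm (\<eta> n u a z) \<le> C / u ^ n"
    unfolding lg_solution_def by blast
  have "\<forall>\<^sub>F u in at_top. \<forall>a\<in>A. \<forall>z\<in>Zj u a. norm (\<eta> n u a z) \<le> \<bar>C\<bar> / u ^ n"
    using C eventually_gt_at_top[of 0]
  proof eventually_elim
    case (elim u)
    have "C / u ^ n \<le> \<bar>C\<bar> / u ^ n" using elim by (intro divide_right_mono) auto
    then show ?case using elim(1) by (meson order_trans)
  qed
  then show ?thesis by (intro that[of "\<bar>C\<bar>"]) auto
qed

lemma eventually_params:
  assumes "A \<subseteq> {a0 P..a1 P}"
  shows "\<forall>\<^sub>F u in at_top. \<forall>a\<in>A. (u, a) \<in> params P"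
  using eventually_ge_at_top[of "umin P"] by eventually_elim (use assms in \<open>auto simp: params_def\<close>)

lemma filter_nontrivial_of_path:
  assumes "progressive_link P u a p F q G" shows "F \<noteq> bot" "G \<noteq> bot"
proof -
  obtain \<gamma> :: "real \<Rightarrow> complex" where "continuous_on {0<..<1} \<gamma>"
    "\<forall>t\<in>{0<..<1}. \<gamma> t \<in> reach P u a p F"
    "filterlim \<gamma> F (at_right 0)" "filterlim \<gamma> G (at_left 1)"
    using progressive_link_path[OF assms] by blast
  then show "F \<noteq> bot" "G \<noteq> bot"
    using filtermap_bot_iff[of \<gamma> "at_right 0"] filtermap_bot_iff[of \<gamma> "at_left 1"]
    by (auto simp: filterlim_def bot_unique)
qed

lemma lg_error_limit:
  assumes lg: "lg_solution P A \<sigma> Zj home away k \<eta> w" and n: "n \<ge> 1"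
    and G: "G \<in> away" and ua: "(u, a) \<in> params P" and nt: "G u a \<noteq> bot"
  shows "(\<eta> n u a \<longlongrightarrow> Lim (G u a) (\<eta> n u a)) (G u a)"
proof -
  obtain l where "(\<eta> n u a \<longlongrightarrow> l) (G u a)"
    using lg n G ua unfolding lg_solution_def by blast
  then show ?thesis using tendsto_Lim[OF nt] by metis
qed

text \<open>The value of an error term at the far singularity inherits the estimate from the path that leads there.\<close>

lemma lg_error_value_bound:
  assumes lg: "lg_solution P A \<sigma> (\<lambda>u a. reach P u a p (home u a)) home away k \<eta> w" and n: "n \<ge> 1"
    and G: "G \<in> away" and A: "A \<subseteq> {a0 P..a1 P}"
    and link: "\<And>u a. (u, a) \<in> params P \<Longrightarrow> progressive_link P u a p (home u a) q (G u a)"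
  shows "\<exists>C. \<forall>\<^sub>F u in at_top. \<forall>a\<in>A. norm (Lim (G u a) (\<eta> n u a)) \<le> C / u ^ n"
proof -
  obtain C where "C \<ge> 0" "\<forall>\<^sub>F u in at_top. \<forall>a\<in>A. \<forall>z\<in>reach P u a p (home u a). norm (\<eta> n u a z) \<le> C / u ^ n"
    using lg_error_bound_along_path[OF lg n] by blast
  note bound = this(2)
  have "\<forall>\<^sub>F u in at_top. \<forall>a\<in>A. norm (Lim (G u a) (\<eta> n u a)) \<le> C / u ^ n"
    using bound eventually_params[OF A]
  proof eventually_elim
    case (elim u)
    show ?case
    proof
      fix a assume a: "a \<in> A"
      with elim have ua: "(u, a) \<in> params P" by blast
      obtain \<gamma> :: "real \<Rightarrow> complex" where \<gamma>: "\<forall>t\<in>{0<..<1}. \<gamma> t \<in> reach P u a p (home u a)" "filterlim \<gamma> (G u a) (at_left 1)"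
        using progressive_link_path[OF link[OF ua]] by blast
      note nt = filter_nontrivial_of_path(2)[OF link[OF ua]]
      have "((\<lambda>t. norm (\<eta> n u a (\<gamma> t))) \<longlongrightarrow> norm (Lim (G u a) (\<eta> n u a))) (at_left 1)"
        by (intro tendsto_norm filterlim_compose[OF lg_error_limit[OF lg n G ua nt] \<gamma>(2)])
      moreover have "\<forall>\<^sub>F t in at_left 1. norm (\<eta> n u a (\<gamma> t)) \<le> C / u ^ n"
      proof -
        have "\<forall>\<^sub>F t in at_left (1::real). t \<in> {0<..<1}"
          by (intro eventually_at_leftI[of 0]) auto
        then show ?thesis by eventually_elim (use \<gamma>(1) elim a in blast)
      qed
      ultimately show "norm (Lim (G u a) (\<eta> n u a)) \<le> C / u ^ n"
        by (intro tendsto_upperbound) auto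
    qed
  qed
  then show ?thesis by blast
qed

text \<open>A continuous logarithm that starts near 0 cannot jump to another branch: every value is close to a
  multiple of \<open>2\<pi>i\<close>, and the discs around different multiples are disjoint.\<close>

lemma norm_le_of_exp_near_one:
  fixes \<phi> :: "real \<Rightarrow> complex"
  assumes cont: "continuous_on {0<..<1} \<phi>" and start: "(\<phi> \<longlongrightarrow> 0) (at_right 0)"
    and near: "\<And>t. t \<in> {0<..<1} \<Longrightarrow> \<exists>\<theta>. exp (\<phi> t) = exp \<theta> \<and> norm \<theta> \<le> \<beta>" and \<beta>: "\<beta> \<le> 1/2"
    and t: "t \<in> {0<..<1}"
  shows "norm (\<phi> t) \<le> \<beta>"
proof -
  have dich: "norm (\<phi> t) \<le> \<beta> \<or> norm (\<phi> t) > 2" if t: "t \<in> {0<..<1}" for t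
  proof -
    obtain \<theta> where \<theta>: "exp (\<phi> t) = exp \<theta>" "norm \<theta> \<le> \<beta>" using near[OF t] by blast
    obtain k :: int where k: "\<phi> t = \<theta> + of_int (2 * k) * of_real pi * \<i>"
      using \<theta>(1) exp_eq[of "\<phi> t" \<theta>] by (auto simp: algebra_simps)
    show ?thesis
    proof (cases "k = 0")
      case True
      then show ?thesis using k \<theta> by simp
    next
      case False
      have "norm (\<phi> t - \<theta>) = 2 * \<bar>of_int k\<bar> * pi" by (simp add: k norm_mult)
      moreover have "\<bar>of_int k :: real\<bar> \<ge> 1" using False by linarith
      then have "2 * \<bar>of_int k\<bar> * pi \<ge> 2 * 1 * pi" by (intro mult_right_mono) auto
      moreover have "norm (\<phi> t - \<theta>) \<le> norm (\<phi> t) + \<beta>"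
        using norm_triangle_ineq4[of "\<phi> t" \<theta>] \<theta>(2) by linarith
      ultimately show ?thesis using pi_gt3 \<beta> by linarith
    qed
  qed
  have "connected (\<phi> ` {0<..<1})"
    by (intro connected_continuous_image cont) auto
  moreover have "open (ball 0 1 :: complex set)" "open (- cball 0 2 :: complex set)"
    by (auto intro: open_Compl)
  moreover have "ball 0 1 \<inter> - cball 0 2 \<inter> \<phi> ` {0<..<1} = {}" by auto
  moreover have "\<phi> ` {0<..<1} \<subseteq> ball 0 1 \<union> - cball 0 2"
  proof
    fix y assume "y \<in> \<phi> ` {0<..<1}"
    then obtain t where "y = \<phi> t" "t \<in> {0<..<1}" by blast
    then show "y \<in> ball 0 1 \<union> - cball 0 2" using dich[of t] \<beta> by auto
  qed
  ultimately have "ball 0 1 \<inter> \<phi> ` {0<..<1} = {} \<or> - cball 0 2 \<inter> \<phi> ` {0<..<1} = {}"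
    by (rule connectedD)
  moreover have "ball 0 1 \<inter> \<phi> ` {0<..<1} \<noteq> {}"
  proof -
    have "\<forall>\<^sub>F t in at_right 0. dist (\<phi> t) 0 < 1" by (rule tendstoD[OF start]) simp
    moreover have "\<forall>\<^sub>F t in at_right (0::real). t \<in> {0<..<1}" by (intro eventually_at_rightI[of 0 1]) auto
    ultimately have "\<forall>\<^sub>F t in at_right 0. dist (\<phi> t) 0 < 1 \<and> t \<in> {0<..<1}" by eventually_elim auto
    then obtain t where "dist (\<phi> t) 0 < 1" "t \<in> {0<..<1}"
      using eventually_happens[of _ "at_right (0::real)"] by auto
    then show ?thesis by (auto simp: dist_norm)
  qed
  ultimately have "\<phi> t \<notin> - cball 0 2" using t by blast
  then show ?thesis using dich[OF t] by auto
qed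

lemma one_plus_eq_exp:
  fixes l :: complex
  assumes "norm l < 1/2"
  obtains \<theta> where "1 + l = exp \<theta>" "norm \<theta> \<le> 2 * norm l"
proof
  have "1 + l \<noteq> 0"
  proof
    assume "1 + l = 0"
    then have "l = - 1" by (simp add: add_eq_0_iff)
    then show False using assms by simp
  qed
  then show "1 + l = exp (Ln (1 + l))" by simp
  show "norm (Ln (1 + l)) \<le> 2 * norm l" using assms by (rule norm_Ln_le)
qed

lemma cancel_lg_factor:
  fixes r p q :: complex
  assumes "k / r * (exp (p + S) * (1 + h)) = k' / r * (exp (p + (q + S)) * (1 + h'))" "r \<noteq> 0"
  shows "k * (1 + h) = k' * exp q * (1 + h')"
proof -
  have e: "exp (p + (q + S)) = exp (p + S) * exp q"
    by (simp add: exp_add)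
  have "(exp (p + S) / r) * (k * (1 + h)) = (exp (p + S) / r) * (k' * exp q * (1 + h'))"
    using assms(1) unfolding e by (simp add: mult_ac)
  then show ?thesis using assms(2) by (simp only: mult_cancel_left) auto
qed

text \<open>The coefficients may depend on \<open>u\<close>, so nothing said about them directly prevents their increments from
  growing with \<open>u\<close>.  The error terms prevent it: as the solution does not depend on \<open>n\<close>, the ratio
  of its forms with indices \<open>n\<close> and \<open>n + 1\<close> shows that
  \<open>exp (\<plusminus>(E\<^sub>n(z) - E\<^sub>n(home)) / u\<^sup>n)\<close> equals 1 up to an error \<open>O(u\<^sup>-\<^sup>n)\<close> on the whole
  path.  By continuity along the path the exponent itself is \<open>O(u\<^sup>-\<^sup>n)\<close>, not just modulo \<open>2\<pi>i\<close>.\<close>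

lemma coefficient_change_bound:
  assumes lg: "lg_solution P A \<sigma> (\<lambda>u a. reach P u a p (home u a)) home away k \<eta> w" and n: "n \<ge> 1"
    and \<sigma>: "\<bar>\<sigma>\<bar> = 1" and P: "umin P > 0" and A: "A \<subseteq> {a0 P..a1 P}"
    and link: "\<And>u a. (u, a) \<in> params P \<Longrightarrow> progressive_link P u a p (home u a) q (G u a)"
    and nz: "\<And>u a. (u, a) \<in> params P \<Longrightarrow> k n u a \<noteq> 0"
    and root: "\<And>u a z. (u, a) \<in> params P \<Longrightarrow> z \<in> cut_dom P u a \<Longrightarrow> root4 P u a z \<noteq> 0"
    and cont: "\<And>u a. (u, a) \<in> params P \<Longrightarrow> continuous_on (cut_dom P u a) (Ehat P n u a)"
    and home: "\<And>u a. (u, a) \<in> params P \<Longrightarrow> \<exists>l. (Ehat P n u a \<longlongrightarrow> l) (home u a)"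
    and G: "\<And>u a. (u, a) \<in> params P \<Longrightarrow> \<exists>l. (Ehat P n u a \<longlongrightarrow> l) (G u a)"
  shows "\<exists>C. \<forall>\<^sub>F u in at_top. \<forall>a\<in>A.
    norm (Lim (G u a) (Ehat P n u a) - Lim (home u a) (Ehat P n u a)) \<le> C"
proof -
  obtain C where C: "C \<ge> 0" "\<forall>\<^sub>F u in at_top. \<forall>a\<in>A. \<forall>z\<in>reach P u a p (home u a). norm (\<eta> n u a z) \<le> C / u ^ n"
    using lg_error_bound_along_path[OF lg n] by blast
  obtain C' where C': "C' \<ge> 0"
    "\<forall>\<^sub>F u in at_top. \<forall>a\<in>A. \<forall>z\<in>reach P u a p (home u a). norm (\<eta> (Suc n) u a z) \<le> C' / u ^ Suc n"
    using lg_error_bound_along_path[OF lg, of "Suc n"] by auto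
  have "\<forall>\<^sub>F u in at_top. \<forall>a\<in>A.
    norm (Lim (G u a) (Ehat P n u a) - Lim (home u a) (Ehat P n u a)) \<le> 2 * (C + C')"
    using C(2) C'(2) eventually_params[OF A] eventually_ge_at_top[of 1] eventually_ge_at_top[of "4 * (C + C')"]
  proof eventually_elim
    case (elim u)
    note bnd = elim(1) and bnd' = elim(2) and par = elim(3) and u1 = elim(4) and u2 = elim(5)
    have u0: "u > 0" using u1 by linarith
    define \<beta> where "\<beta> = 2 * (C + C') / u ^ n"
    have un: "u \<le> u ^ n" using u1 n self_le_power[of u n] by auto
    have CC: "C + C' \<ge> 0" using C C' by simp
    have \<beta>: "\<beta> \<le> 1 / 2"
    proof -
      have "\<beta> \<le> 2 * (C + C') / u"
        unfolding \<beta>_def using un u0 CC by (intro divide_left_mono) auto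
      also have "\<dots> \<le> 1/2" using u2 u0 by (simp add: field_simps)
      finally show ?thesis .
    qed
    show ?case
    proof
      fix a assume a: "a \<in> A"
      then have ua: "(u, a) \<in> params P" using par by blast
      obtain \<gamma> :: "real \<Rightarrow> complex" where \<gamma>: "continuous_on {0<..<1} \<gamma>" "\<forall>t\<in>{0<..<1}. \<gamma> t \<in> reach P u a p (home u a)"
        "filterlim \<gamma> (home u a) (at_right 0)" "filterlim \<gamma> (G u a) (at_left 1)"
        using progressive_link_path[OF link[OF ua]] by blast
      note nt = filter_nontrivial_of_path[OF link[OF ua]]
      have EH: "(Ehat P n u a \<longlongrightarrow> Lim (home u a) (Ehat P n u a)) (home u a)"
        using home[OF ua] tendsto_Lim[OF nt(1)] by metis
      have EG: "(Ehat P n u a \<longlongrightarrow> Lim (G u a) (Ehat P n u a)) (G u a)"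
        using G[OF ua] tendsto_Lim[OF nt(2)] by metis
      let ?e = "Lim (home u a) (Ehat P n u a)"
      have \<gamma>D: "\<gamma> t \<in> cut_dom P u a" if "t \<in> {0<..<1}" for t
        using bspec[OF \<gamma>(2) that] by (simp add: reach_def)
      define c where "c = complex_of_real (\<sigma> ^ n) / of_real (u ^ n)"
      have nc: "norm c = 1 / u ^ n" using \<sigma> u0 by (simp add: c_def norm_divide norm_power)
      have c0: "c \<noteq> 0" using nc u0 by auto
      have form: "w u a z = lg_form P \<sigma> n u a (k n u a) (\<eta> n u a) z"
        "w u a z = lg_form P \<sigma> (Suc n) u a (k (Suc n) u a) (\<eta> (Suc n) u a) z" if "z \<in> cut_dom P u a" for z
        by (rule lg_solutionD(1)[OF lg n ua that], rule lg_solutionD(1)[OF lg le_SucI[OF n] ua that])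
      have rel: "k n u a * (1 + \<eta> n u a z) = k (Suc n) u a * exp (c * Ehat P n u a z) * (1 + \<eta> (Suc n) u a z)"
        if z: "z \<in> cut_dom P u a" for z
      proof -
        have "{1..Suc n - 1} = insert n {1..n-1}" using n by auto
        moreover have "n \<notin> {1..n-1}" using n by auto
        ultimately have sum: "(\<Sum>s=1..Suc n - 1. of_real (\<sigma> ^ s) * Ehat P s u a z / of_real (u ^ s))
          = c * Ehat P n u a z + (\<Sum>s=1..n-1. of_real (\<sigma> ^ s) * Ehat P s u a z / of_real (u ^ s))"
          by (simp add: c_def)
        show ?thesis
          using trans[OF form(1)[OF z, symmetric] form(2)[OF z]] root[OF ua z]
          unfolding lg_form_def sum by (rule cancel_lg_factor)
      qed
      have \<eta>0: "(\<eta> n u a \<longlongrightarrow> 0) (home u a)" "(\<eta> (Suc n) u a \<longlongrightarrow> 0) (home u a)"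
        by (rule lg_solutionD(2)[OF lg n ua], rule lg_solutionD(2)[OF lg le_SucI[OF n] ua])
      have k_eq: "k n u a = k (Suc n) u a * exp (c * ?e)"
      proof -
        have 1: "((\<lambda>z. k n u a * (1 + \<eta> n u a z)) \<longlongrightarrow> k n u a * (1 + 0)) (home u a)"
          by (intro tendsto_intros \<eta>0)
        have 2: "((\<lambda>z. k (Suc n) u a * exp (c * Ehat P n u a z) * (1 + \<eta> (Suc n) u a z)) \<longlongrightarrow>
           k (Suc n) u a * exp (c * ?e) * (1 + 0)) (home u a)"
          by (intro tendsto_intros \<eta>0 EH)
        have "\<forall>\<^sub>F t in at_right (0::real). t \<in> {0<..<1}" by (intro eventually_at_rightI[of 0 1]) auto
        then have "\<forall>\<^sub>F t in at_right 0. k n u a * (1 + \<eta> n u a (\<gamma> t))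
            = k (Suc n) u a * exp (c * Ehat P n u a (\<gamma> t)) * (1 + \<eta> (Suc n) u a (\<gamma> t))"
          by eventually_elim (intro rel \<gamma>D)
        from Lim_transform_eventually[OF filterlim_compose[OF 1 \<gamma>(3)] this]
        show ?thesis
          using tendsto_unique[OF _ _ filterlim_compose[OF 2 \<gamma>(3)]] by auto
      qed
      define \<phi> where "\<phi> t = c * (Ehat P n u a (\<gamma> t) - ?e)" for t
      have "norm (\<phi> t) \<le> \<beta>" if "t \<in> {0<..<1}" for t
      proof (rule norm_le_of_exp_near_one[OF _ _ _ \<beta> that])
        show "continuous_on {0<..<1} \<phi>"
          unfolding \<phi>_def by (intro continuous_intros continuous_on_compose2[OF cont[OF ua] \<gamma>(1)]) (use \<gamma>D in auto)
        have "(\<phi> \<longlongrightarrow> c * (?e - ?e)) (at_right 0)"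
          unfolding \<phi>_def by (intro tendsto_intros filterlim_compose[OF EH \<gamma>(3)])
        then show "(\<phi> \<longlongrightarrow> 0) (at_right 0)" by simp
      next
        fix t :: real assume t: "t \<in> {0<..<1}"
        have b1: "norm (\<eta> n u a (\<gamma> t)) \<le> C / u ^ n" using bnd a bspec[OF \<gamma>(2) t] by blast
        have "norm (\<eta> (Suc n) u a (\<gamma> t)) \<le> C' / u ^ Suc n" using bnd' a bspec[OF \<gamma>(2) t] by blast
        also have "\<dots> \<le> C' / u ^ n"
          using C' u1 u0 by (intro divide_left_mono) (auto simp: power_increasing)
        finally have b2: "norm (\<eta> (Suc n) u a (\<gamma> t)) \<le> C' / u ^ n" .
        have sum: "C / u ^ n + C' / u ^ n = \<beta> / 2" by (simp add: \<beta>_def add_divide_distrib)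
        have "C / u ^ n \<ge> 0" "C' / u ^ n \<ge> 0" using C C' u0 by auto
        then have small: "norm (\<eta> n u a (\<gamma> t)) < 1/2" "norm (\<eta> (Suc n) u a (\<gamma> t)) < 1/2"
          using b1 b2 sum \<beta> by linarith+
        obtain \<theta> where \<theta>: "1 + \<eta> n u a (\<gamma> t) = exp \<theta>" "norm \<theta> \<le> 2 * norm (\<eta> n u a (\<gamma> t))"
          using one_plus_eq_exp[OF small(1)] by blast
        obtain \<theta>' where \<theta>': "1 + \<eta> (Suc n) u a (\<gamma> t) = exp \<theta>'" "norm \<theta>' \<le> 2 * norm (\<eta> (Suc n) u a (\<gamma> t))"
          using one_plus_eq_exp[OF small(2)] by blast
        have "k (Suc n) u a \<noteq> 0" using nz[OF ua] k_eq by auto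
        then have "exp (c * ?e) * exp \<theta> = exp (c * Ehat P n u a (\<gamma> t)) * exp \<theta>'"
          using rel[OF \<gamma>D[OF t]] unfolding k_eq \<theta> \<theta>' by (simp add: algebra_simps)
        then have "exp (\<phi> t) = exp (\<theta> - \<theta>')"
          by (simp add: \<phi>_def algebra_simps exp_diff field_simps)
        moreover have "norm (\<theta> - \<theta>') \<le> \<beta>"
          using norm_triangle_ineq4[of \<theta> \<theta>'] \<theta>(2) \<theta>'(2) b1 b2 sum by linarith
        ultimately show "\<exists>\<theta>. exp (\<phi> t) = exp \<theta> \<and> norm \<theta> \<le> \<beta>" by blast
      qed
      moreover have "((\<lambda>t. norm (\<phi> t)) \<longlongrightarrow> norm (c * (Lim (G u a) (Ehat P n u a) - ?e))) (at_left 1)"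
        unfolding \<phi>_def by (intro tendsto_intros filterlim_compose[OF EG \<gamma>(4)])
      moreover have "\<forall>\<^sub>F t in at_left (1::real). t \<in> {0<..<1}"
        by (intro eventually_at_leftI[of 0]) auto
      ultimately have "norm (c * (Lim (G u a) (Ehat P n u a) - ?e)) \<le> \<beta>"
        by (intro tendsto_upperbound[of "\<lambda>t. norm (\<phi> t)" _ "at_left (1::real)"]) (auto elim: eventually_mono)
      then show "norm (Lim (G u a) (Ehat P n u a) - ?e) \<le> 2 * (C + C')"
        unfolding norm_mult nc \<beta>_def using u0 by (simp add: divide_le_cancel)
    qed
  qed
  then show ?thesis by blast
qed

section \<open>Relations between the solutions at the singularities\<close>

lemma approach_filterlims:
  "eventually (\<lambda>z. z \<in> D) (approach D p X Y)" "filterlim X at_top (approach D p X Y)"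
proof -
  have "approach D p X Y \<le> principal D" "approach D p X Y \<le> filtercomap X at_top"
    unfolding approach_def by (simp_all add: le_infI1 le_infI2)
  then show "eventually (\<lambda>z. z \<in> D) (approach D p X Y)" "filterlim X at_top (approach D p X Y)"
    by (auto simp: le_principal filterlim_iff_le_filtercomap)
qed

text \<open>Normalised with the opposite exponential, a solution that is recessive at a singularity disappears
  from every linear relation in the limit.\<close>

lemma normalised_solution_decays:
  fixes g \<xi> :: "'a \<Rightarrow> complex"
  assumes g: "((\<lambda>z. g z * exp (of_real \<tau> * \<xi> z)) \<longlongrightarrow> L) F"
    and \<xi>: "filterlim (\<lambda>z. (\<tau> - \<tau>') * Re (\<xi> z)) at_top F"
  shows "((\<lambda>z. g z * exp (of_real \<tau>' * \<xi> z)) \<longlongrightarrow> 0) F"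
proof -
  have "((\<lambda>z. exp (- ((\<tau> - \<tau>') * Re (\<xi> z)))) \<longlongrightarrow> 0) F"
    by (rule filterlim_compose[OF exp_at_bot filterlim_uminus_at_bot_at_top[THEN filterlim_compose]]) (rule \<xi>)
  then have "((\<lambda>z. norm (exp (of_real (\<tau>' - \<tau>) * \<xi> z))) \<longlongrightarrow> 0) F"
    by (simp add: norm_exp_eq_Re algebra_simps)
  then have "((\<lambda>z. exp (of_real (\<tau>' - \<tau>) * \<xi> z)) \<longlongrightarrow> 0) F"
    by (rule tendsto_norm_zero_cancel)
  from tendsto_mult[OF g this]
  have "((\<lambda>z. g z * (exp (of_real \<tau> * \<xi> z) * exp (of_real (\<tau>' - \<tau>) * \<xi> z))) \<longlongrightarrow> 0) F"
    by (simp add: mult.assoc)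
  then show ?thesis
    by (simp add: exp_add[symmetric] algebra_simps)
qed

definition lg_exponent :: "real \<Rightarrow> nat \<Rightarrow> real \<Rightarrow> (nat \<Rightarrow> complex) \<Rightarrow> complex" where
  "lg_exponent \<sigma> n u e = (\<Sum>s=1..n-1. of_real (\<sigma> ^ s) * e s / of_real (u ^ s))"

lemma lg_normalised_limit:
  assumes w: "\<And>z. z \<in> cut_dom P u a \<Longrightarrow> w z = lg_form P \<sigma> n u a k \<eta> z"
    and root: "\<And>z. z \<in> cut_dom P u a \<Longrightarrow> root4 P u a z \<noteq> 0"
    and F: "eventually (\<lambda>z. z \<in> cut_dom P u a) F" and u: "u > 0"
    and E: "\<And>s. s \<ge> 1 \<Longrightarrow> (Ehat P s u a \<longlongrightarrow> e s) F" and \<eta>: "(\<eta> \<longlongrightarrow> l) F" and \<tau>: "\<tau> = - \<sigma> * u"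
  shows "((\<lambda>z. w z * root4 P u a z * exp (of_real \<tau> * xi P u a z)) \<longlongrightarrow>
    k * exp (lg_exponent \<sigma> n u e) * (1 + l)) F"
proof -
  have "((\<lambda>z. lg_exponent \<sigma> n u (\<lambda>s. Ehat P s u a z)) \<longlongrightarrow> lg_exponent \<sigma> n u e) F"
    unfolding lg_exponent_def by (intro tendsto_intros E) (use u in auto)
  then have "((\<lambda>z. k * exp (lg_exponent \<sigma> n u (\<lambda>s. Ehat P s u a z)) * (1 + \<eta> z)) \<longlongrightarrow>
    k * exp (lg_exponent \<sigma> n u e) * (1 + l)) F"
    by (intro tendsto_intros \<eta>)
  then show ?thesis
  proof (rule Lim_transform_eventually)
    show "\<forall>\<^sub>F z in F. k * exp (lg_exponent \<sigma> n u (\<lambda>s. Ehat P s u a z)) * (1 + \<eta> z)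
      = w z * root4 P u a z * exp (of_real \<tau> * xi P u a z)"
      using F
    proof eventually_elim
      case (elim z)
      show ?case
        using w[OF elim] root[OF elim] \<tau>
        by (simp add: lg_form_def lg_exponent_def exp_add exp_minus field_simps)
    qed
  qed
qed

locale connection_problem =
  fixes P :: tp_data
    and A :: "real set"
    and w1 w2 w3 w4 :: "real \<Rightarrow> real \<Rightarrow> complex \<Rightarrow> complex"
    and k1 k2 k3 k4p k4m :: "nat \<Rightarrow> real \<Rightarrow> real \<Rightarrow> complex"
    and \<eta>1 \<eta>2 \<eta>3 \<eta>4p \<eta>4m :: "nat \<Rightarrow> real \<Rightarrow> real \<Rightarrow> complex \<Rightarrow> complex"
    and lam :: "real \<Rightarrow> real \<Rightarrow> complex"
  assumes setting: "two_turning_point_equation P" "singularities_linked P"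
    and A: "A \<subseteq> {a0 P..a1 P}"
    and recessive: "\<And>u a. (u, a) \<in> params P \<Longrightarrow>
        recessive P u a (to_x1 P u a) (w1 u a) \<and>
        recessive P u a (to_x2 P u a) (w2 u a) \<and>
        recessive P u a (to_x3 P u a) (w3 u a) \<and>
        recessive P u a (sup (to_x4 1 P u a) (to_x4 (-1) P u a)) (w4 u a)"
    and lg1: "lg_solution P A 1 (Z1 P) (to_x1 P) {to_x2 P, to_x4 1 P} k1 \<eta>1 w1"
    and lg2: "lg_solution P A (-1) (Z2 P) (to_x2 P) {to_x1 P, to_x3 P} k2 \<eta>2 w2"
    and lg3: "lg_solution P A 1 (Z3 P) (to_x3 P) {to_x2 P, to_x4 (-1) P} k3 \<eta>3 w3"
    and lg4p: "lg_solution P A (-1) (Z4 1 P) (to_x4 1 P) {to_x1 P} k4p \<eta>4p w4"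
    and lg4m: "lg_solution P A (-1) (Z4 (-1) P) (to_x4 (-1) P) {to_x3 P} k4m \<eta>4m w4"
    and normalized: "\<And>u a z. (u, a) \<in> params P \<Longrightarrow> z \<in> Dom P \<Longrightarrow>
        w2 u a z = w1 u a z + w3 u a z"
    and connection: "\<And>u a z. (u, a) \<in> params P \<Longrightarrow> z \<in> Dom P \<Longrightarrow>
        w4 u a z = exp (lam u a * of_real pi * \<i>) * w1 u a z
          + exp (- lam u a * of_real pi * \<i>) * w3 u a z"
begin

lemma u_pos: "(u, a) \<in> params P \<Longrightarrow> u > 0"
  using setting(1) by (auto simp: two_turning_point_equation_def params_def)

lemma root4_nonzero:
  assumes ua: "(u, a) \<in> params P" and z: "z \<in> cut_dom P u a"
  shows "root4 P u a z \<noteq> 0"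
proof -
  have tp: "turning_points (Dom P) (ff P u a) (tp1 P u a) (tp2 P u a)" "lg_variables P u a"
    using setting(1) ua by (auto simp: two_turning_point_equation_def)
  have le: "tp1 P u a \<le> tp2 P u a"
    using turning_point_multiplicity[OF setting(1) ua]
    by (auto simp: simple_turning_points_def coalesced_turning_points_def)
  have zD: "z \<in> Dom P" "z \<notin> complex_of_real ` {..tp2 P u a}" using z by (auto simp: cut_dom_def)
  have "{z \<in> Dom P. ff P u a z = 0} = {of_real (tp1 P u a), of_real (tp2 P u a)}"
    using tp by (simp add: turning_points_def)
  then have "ff P u a z = 0 \<Longrightarrow> z \<in> complex_of_real ` {..tp2 P u a}"
    using zD(1) le by (auto dest: equalityD1)
  then have "ff P u a z \<noteq> 0" using zD by blast
  moreover have "root4 P u a z ^ 4 = ff P u a z"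
    using tp z by (auto simp: lg_variables_def)
  ultimately show ?thesis by auto
qed

lemma coefficient_continuous:
  assumes ua: "(u, a) \<in> params P" and n: "n \<ge> 1"
  shows "continuous_on (cut_dom P u a) (Ehat P n u a)"
proof -
  have "lg_coefficients P u a"
    using setting(1) ua by (auto simp: two_turning_point_equation_def)
  then show ?thesis
    using n unfolding lg_coefficients_def
    by (intro continuous_at_imp_continuous_on ballI) (blast intro: DERIV_isCont)
qed

lemma coefficient_limits:
  assumes "(u, a) \<in> params P" "s \<ge> 1"
  shows "\<exists>l. (Ehat P s u a \<longlongrightarrow> l) (to_x1 P u a)" "\<exists>l. (Ehat P s u a \<longlongrightarrow> l) (to_x2 P u a)"
    "\<exists>l. (Ehat P s u a \<longlongrightarrow> l) (to_x3 P u a)" "\<exists>l. (Ehat P s u a \<longlongrightarrow> l) (to_x4 1 P u a)"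
    "\<exists>l. (Ehat P s u a \<longlongrightarrow> l) (to_x4 (-1) P u a)"
proof -
  have "\<forall>G \<in> {to_x1 P u a, to_x2 P u a, to_x3 P u a, to_x4 1 P u a, to_x4 (-1) P u a}.
           \<forall>s\<ge>1. \<exists>l. (Ehat P s u a \<longlongrightarrow> l) G"
    using setting(1) assms(1) by (auto simp: two_turning_point_equation_def)
  then show "\<exists>l. (Ehat P s u a \<longlongrightarrow> l) (to_x1 P u a)" "\<exists>l. (Ehat P s u a \<longlongrightarrow> l) (to_x2 P u a)"
    "\<exists>l. (Ehat P s u a \<longlongrightarrow> l) (to_x3 P u a)" "\<exists>l. (Ehat P s u a \<longlongrightarrow> l) (to_x4 1 P u a)"
    "\<exists>l. (Ehat P s u a \<longlongrightarrow> l) (to_x4 (-1) P u a)"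
    using assms(2) by blast+
qed

lemma links:
  assumes "(u, a) \<in> params P"
  shows "progressive_link P u a (px1 P) (to_x1 P u a) (ereal_pt (px2 P)) (to_x2 P u a)"
    "progressive_link P u a (px1 P) (to_x1 P u a) (ereal_pt (px4 P)) (to_x4 1 P u a)"
    "progressive_link P u a (px3 P) (to_x3 P u a) (ereal_pt (px2 P)) (to_x2 P u a)"
    "progressive_link P u a (px3 P) (to_x3 P u a) (ereal_pt (px4 P)) (to_x4 (-1) P u a)"
  using setting(2) assms by (auto simp: singularities_linked_def)

lemmas back_links = links[THEN progressive_link_reverse]

lemma filters_nontrivial:
  assumes "(u, a) \<in> params P"
  shows "to_x1 P u a \<noteq> bot" "to_x2 P u a \<noteq> bot" "to_x3 P u a \<noteq> bot"
    "to_x4 1 P u a \<noteq> bot" "to_x4 (-1) P u a \<noteq> bot"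
  using filter_nontrivial_of_path links[OF assms] by blast+

lemma filters_in_cut_dom:
  "eventually (\<lambda>z. z \<in> cut_dom P u a) (to_x1 P u a)"
  "eventually (\<lambda>z. z \<in> cut_dom P u a) (to_x2 P u a)"
  "eventually (\<lambda>z. z \<in> cut_dom P u a) (to_x3 P u a)"
  "eventually (\<lambda>z. z \<in> cut_dom P u a) (to_x4 \<sigma> P u a)"
  unfolding to_x1_def to_x2_def to_x3_def to_x4_def
  by (auto intro: eventually_mono[OF approach_filterlims(1)])

lemma xi_at_singularities:
  "filterlim (\<lambda>z. - Re (xi P u a z)) at_top (to_x1 P u a)"
  "filterlim (\<lambda>z. Re (xi P u a z)) at_top (to_x2 P u a)"
  "filterlim (\<lambda>z. - Re (xi P u a z)) at_top (to_x3 P u a)"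
  "filterlim (\<lambda>z. Re (xi P u a z)) at_top (to_x4 \<sigma> P u a)"
  unfolding to_x1_def to_x2_def to_x3_def to_x4_def by (rule approach_filterlims(2))+

lemma solution_props:
  assumes ua: "(u, a) \<in> params P"
  shows "continuous_on (Dom P) (w3 u a)" "continuous_on (Dom P) (w4 u a)"
    and "\<exists>z\<in>Dom P. w1 u a z \<noteq> 0" "\<exists>z\<in>Dom P. w2 u a z \<noteq> 0" "\<exists>z\<in>Dom P. w3 u a z \<noteq> 0" "\<exists>z\<in>Dom P. w4 u a z \<noteq> 0"
    and "continuous_on (Dom P) (w1 u a)" "continuous_on (Dom P) (w2 u a)"
  using recessive[OF ua]
  by (auto simp: recessive_def ode_solution_def holomorphic_on_imp_continuous_on)

text \<open>The cut has empty interior, so a solution that vanished off the cut would vanish everywhere.\<close>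

lemma lg_factor_nonzero:
  assumes lg: "lg_solution P A \<sigma> Zj home away k \<eta> w" and n: "n \<ge> 1" and ua: "(u, a) \<in> params P"
    and cont: "continuous_on (Dom P) (w u a)" and nz: "\<exists>z\<in>Dom P. w u a z \<noteq> 0"
  shows "k n u a \<noteq> 0"
proof
  assume "k n u a = 0"
  then have zero: "w u a z = 0" if "z \<in> cut_dom P u a" for z
    using lg_solutionD(1)[OF lg n ua that] by (simp add: lg_form_def)
  obtain z where z: "z \<in> Dom P" "w u a z \<noteq> 0" using nz by blast
  have openD: "open (Dom P)" using setting(1) by (simp add: two_turning_point_equation_def)
  then have "isCont (w u a) z" using cont z by (simp add: continuous_on_eq_continuous_at)
  then have lim: "((\<lambda>\<epsilon>. w u a (z + \<i> * of_real \<epsilon>)) \<longlongrightarrow> w u a z) (at 0)"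
    by (rule isCont_tendsto_compose) (auto intro!: tendsto_eq_intros)
  have "\<forall>\<^sub>F \<epsilon> in at 0. z + \<i> * of_real \<epsilon> \<in> Dom P"
    by (rule topological_tendstoD[OF _ openD z(1)]) (auto intro!: tendsto_eq_intros)
  moreover have "\<forall>\<^sub>F \<epsilon> in at 0. \<epsilon> \<noteq> - Im z"
  proof (cases "Im z = 0")
    case True
    then show ?thesis by (simp add: eventually_neq_at_within)
  next
    case False
    then have "open (- {- Im z})" "0 \<in> - {- Im z}" by auto
    from eventually_at_in_open'[OF this] show ?thesis by simp
  qed
  ultimately have "\<forall>\<^sub>F \<epsilon> in at 0. w u a (z + \<i> * of_real \<epsilon>) = 0"
  proof eventually_elim
    case (elim \<epsilon>)
    then have "Im (z + \<i> * of_real \<epsilon>) \<noteq> 0" by auto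
    then have "z + \<i> * of_real \<epsilon> \<notin> complex_of_real ` {..tp2 P u a}" by (rule nonreal_notin)
    then show ?case using elim by (intro zero) (simp add: cut_dom_def)
  qed
  then have "((\<lambda>\<epsilon>. w u a (z + \<i> * of_real \<epsilon>)) \<longlongrightarrow> 0) (at 0)"
    by (rule tendsto_eventually)
  then show False using tendsto_unique[OF _ lim] z by auto
qed

lemma factors_nonzero:
  assumes ua: "(u, a) \<in> params P" and n: "n \<ge> 1"
  shows "k1 n u a \<noteq> 0" "k2 n u a \<noteq> 0" "k3 n u a \<noteq> 0" "k4p n u a \<noteq> 0" "k4m n u a \<noteq> 0"
  using lg_factor_nonzero[OF lg1 n ua] lg_factor_nonzero[OF lg2 n ua] lg_factor_nonzero[OF lg3 n ua]
    lg_factor_nonzero[OF lg4p n ua] lg_factor_nonzero[OF lg4m n ua] solution_props[OF ua] by blast+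

text \<open>Apart from the third, each relation arises from a linear relation between the solutions at one
  singularity, multiplied by \<open>f\<^sup>1\<^sup>/\<^sup>4\<close> and by the exponential that makes the dominant
  solutions converge.  In the first one \<open>w1\<close> disappears at \<open>x\<^sub>1\<close>, in the second one \<open>w3\<close> at \<open>x\<^sub>3\<close>, in the fourth one \<open>w2\<close> at
  \<open>x\<^sub>2\<close>.  The third one compares the two descriptions of \<open>w4\<close> across the cut at \<open>x\<^sub>4\<close>.  For
  the last one, the disappearance of \<open>w4\<close> at \<open>x\<^sub>4 + i0\<close> makes \<open>w3\<close> asymptotic to
  \<open>- e\<^sup>2\<^sup>\<lambda>\<^sup>\<pi>\<^sup>i w1\<close> there, and \<open>w3\<close> is followed across the cut to \<open>x\<^sub>4 - i0\<close>, where its own form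
  is available.\<close>

lemma connection_relations:
  assumes ua: "(u, a) \<in> params P" and n: "n \<ge> 1"
  defines "\<mu> \<equiv> lam u a * of_real pi * \<i>" and "\<phi> \<equiv> complex_of_real (u * pi * (alpha P u a)\<^sup>2) * \<i>"
  shows "k4p n u a * (1 + Lim (to_x1 P u a) (\<eta>4p n u a)) = exp (- \<mu>) * k2 n u a * (1 + Lim (to_x1 P u a) (\<eta>2 n u a))"
    and "k4m n u a * (1 + Lim (to_x3 P u a) (\<eta>4m n u a)) = exp \<mu> * k2 n u a * (1 + Lim (to_x3 P u a) (\<eta>2 n u a))"
    and "k4p n u a * exp (lg_exponent (-1) n u (\<lambda>s. Ehat_x4 1 P s u a))
      = - exp (- \<phi>) * k4m n u a * exp (lg_exponent (-1) n u (\<lambda>s. Ehat_x4 (-1) P s u a))"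
    and "k1 n u a * (1 + Lim (to_x2 P u a) (\<eta>1 n u a)) + k3 n u a * (1 + Lim (to_x2 P u a) (\<eta>3 n u a)) = 0"
    and "exp (2 * \<mu>) * k1 n u a * exp (lg_exponent 1 n u (\<lambda>s. Ehat_x4 1 P s u a)) * (1 + Lim (to_x4 1 P u a) (\<eta>1 n u a))
      = exp \<phi> * k3 n u a * exp (lg_exponent 1 n u (\<lambda>s. Ehat_x4 (-1) P s u a)) * (1 + Lim (to_x4 (-1) P u a) (\<eta>3 n u a))"
proof -
  have u: "u > 0" using u_pos[OF ua] .
  note nt = filters_nontrivial[OF ua] and root = root4_nonzero[OF ua]
  define U where "U w \<tau> z = w z * root4 P u a z * exp (of_real \<tau> * xi P u a z)" for w :: "complex \<Rightarrow> complex" and \<tau> z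
  define e where "e G s = Lim G (Ehat P s u a)" for G s
  have E: "(Ehat P s u a \<longlongrightarrow> e G s) G"
    if "s \<ge> 1" "G \<in> {to_x1 P u a, to_x2 P u a, to_x3 P u a, to_x4 1 P u a, to_x4 (-1) P u a}" for G s
    using coefficient_limits[OF ua that(1)] that(2) nt tendsto_Lim[of G "Ehat P s u a"] unfolding e_def by auto
  have cutG: "eventually (\<lambda>z. z \<in> cut_dom P u a) G"
    if "G \<in> {to_x1 P u a, to_x2 P u a, to_x3 P u a, to_x4 1 P u a, to_x4 (-1) P u a}" for G
    using that filters_in_cut_dom by auto
  have far: "(U (w u a) (- \<sigma> * u) \<longlongrightarrow> k n u a * exp (lg_exponent \<sigma> n u (e (G u a))) * (1 + Lim (G u a) (\<eta> n u a))) (G u a)"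
    if lg: "lg_solution P A \<sigma> Zj home away k \<eta> w" and G: "G \<in> away"
      "G u a \<in> {to_x1 P u a, to_x2 P u a, to_x3 P u a, to_x4 1 P u a, to_x4 (-1) P u a}" for \<sigma> Zj home away k \<eta> w G
    unfolding U_def
  proof (rule lg_normalised_limit[OF lg_solutionD(1)[OF lg n ua] root cutG[OF G(2)] u E[OF _ G(2)] _ refl])
    show "(\<eta> n u a \<longlongrightarrow> Lim (G u a) (\<eta> n u a)) (G u a)"
      by (rule lg_error_limit[OF lg n G(1) ua]) (use G(2) nt in auto)
  qed auto
  have near: "(U (w u a) (- \<sigma> * u) \<longlongrightarrow> k n u a * exp (lg_exponent \<sigma> n u (e (home u a)))) (home u a)"
    if lg: "lg_solution P A \<sigma> Zj home away k \<eta> w" and G: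
      "home u a \<in> {to_x1 P u a, to_x2 P u a, to_x3 P u a, to_x4 1 P u a, to_x4 (-1) P u a}" for \<sigma> Zj home away k \<eta> w
  proof -
    have "(U (w u a) (- \<sigma> * u) \<longlongrightarrow> k n u a * exp (lg_exponent \<sigma> n u (e (home u a))) * (1 + 0)) (home u a)"
      unfolding U_def
      by (rule lg_normalised_limit[OF lg_solutionD(1)[OF lg n ua] root cutG[OF G] u E[OF _ G] lg_solutionD(2)[OF lg n ua] refl]) auto
    then show ?thesis by simp
  qed
  have decay: "(U w \<tau>' \<longlongrightarrow> 0) F" if "(U w \<tau> \<longlongrightarrow> L) F" "filterlim (\<lambda>z. (\<tau> - \<tau>') * Re (xi P u a z)) at_top F" for w \<tau> \<tau>' L F
    using normalised_solution_decays[of "\<lambda>z. w z * root4 P u a z" \<tau> "xi P u a" L F \<tau>'] that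
    unfolding U_def by simp
  have up: "filterlim (\<lambda>z. (c :: real) * f z) at_top F" if "c > 0" "filterlim f at_top F" for c f and F :: "complex filter"
    using that filterlim_tendsto_pos_mult_at_top[OF tendsto_const] by blast
  have at13: "filterlim (\<lambda>z. (- 1 * u - (- (-1) * u)) * Re (xi P u a z)) at_top F"
    if "filterlim (\<lambda>z. - Re (xi P u a z)) at_top F" for F
    using up[OF _ that, of "2 * u"] u by (simp add: algebra_simps)
  have at24: "filterlim (\<lambda>z. (- (-1) * u - (- 1 * u)) * Re (xi P u a z)) at_top F"
    if "filterlim (\<lambda>z. Re (xi P u a z)) at_top F" for F
    using up[OF _ that, of "2 * u"] u by (simp add: algebra_simps)
  have U2: "U (w2 u a) \<tau> z = U (w1 u a) \<tau> z + U (w3 u a) \<tau> z"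
    and U4: "U (w4 u a) \<tau> z = exp \<mu> * U (w1 u a) \<tau> z + exp (- \<mu>) * U (w3 u a) \<tau> z" if "z \<in> cut_dom P u a" for z \<tau>
  proof -
    have "z \<in> Dom P" using that by (simp add: cut_dom_def)
    then show "U (w2 u a) \<tau> z = U (w1 u a) \<tau> z + U (w3 u a) \<tau> z"
      "U (w4 u a) \<tau> z = exp \<mu> * U (w1 u a) \<tau> z + exp (- \<mu>) * U (w3 u a) \<tau> z"
      using normalized[OF ua] connection[OF ua] by (simp_all add: U_def \<mu>_def algebra_simps)
  qed
  have cancel: "x * (1 + s) = t * k * (1 + r)"
    if "x * y * (1 + s) = t * (k * y * (1 + r))" "y \<noteq> 0" for x y s t k r :: complex
  proof -
    have "y * (x * (1 + s)) = y * (t * k * (1 + r))" using that(1) by (simp only: mult_ac)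
    then show ?thesis using that(2) by simp
  qed
  show "k4p n u a * (1 + Lim (to_x1 P u a) (\<eta>4p n u a)) = exp (- \<mu>) * k2 n u a * (1 + Lim (to_x1 P u a) (\<eta>2 n u a))"
  proof (rule cancel)
    let ?F = "to_x1 P u a"
    have z: "(U (w1 u a) (- (-1) * u) \<longlongrightarrow> 0) ?F"
      by (rule decay[OF near[OF lg1] at13]) (simp_all add: xi_at_singularities)
    have 2: "(U (w2 u a) (- (-1) * u) \<longlongrightarrow> k2 n u a * exp (lg_exponent (-1) n u (e ?F)) * (1 + Lim ?F (\<eta>2 n u a))) ?F"
      by (rule far[OF lg2]) auto
    have 4: "(U (w4 u a) (- (-1) * u) \<longlongrightarrow> k4p n u a * exp (lg_exponent (-1) n u (e ?F)) * (1 + Lim ?F (\<eta>4p n u a))) ?F"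
      by (rule far[OF lg4p]) auto
    have "((\<lambda>z. exp \<mu> * U (w1 u a) (- (-1) * u) z + exp (- \<mu>) * (U (w2 u a) (- (-1) * u) z - U (w1 u a) (- (-1) * u) z)) \<longlongrightarrow>
      exp \<mu> * 0 + exp (- \<mu>) * (k2 n u a * exp (lg_exponent (-1) n u (e ?F)) * (1 + Lim ?F (\<eta>2 n u a)) - 0)) ?F"
      by (intro tendsto_intros z 2)
    moreover have "\<forall>\<^sub>F z in ?F. exp \<mu> * U (w1 u a) (- (-1) * u) z + exp (- \<mu>) * (U (w2 u a) (- (-1) * u) z - U (w1 u a) (- (-1) * u) z)
      = U (w4 u a) (- (-1) * u) z"
      using filters_in_cut_dom(1) by eventually_elim (simp only: U2 U4 add_diff_cancel_left')
    ultimately have "(U (w4 u a) (- (-1) * u) \<longlongrightarrow>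
      exp \<mu> * 0 + exp (- \<mu>) * (k2 n u a * exp (lg_exponent (-1) n u (e ?F)) * (1 + Lim ?F (\<eta>2 n u a)) - 0)) ?F"
      by (rule Lim_transform_eventually)
    from tendsto_unique[OF nt(1) 4 this]
    show "k4p n u a * exp (lg_exponent (-1) n u (e ?F)) * (1 + Lim ?F (\<eta>4p n u a))
      = exp (- \<mu>) * (k2 n u a * exp (lg_exponent (-1) n u (e ?F)) * (1 + Lim ?F (\<eta>2 n u a)))" by simp
  qed simp
  show "k4m n u a * (1 + Lim (to_x3 P u a) (\<eta>4m n u a)) = exp \<mu> * k2 n u a * (1 + Lim (to_x3 P u a) (\<eta>2 n u a))"
  proof (rule cancel)
    let ?F = "to_x3 P u a"
    have z: "(U (w3 u a) (- (-1) * u) \<longlongrightarrow> 0) ?F"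
      by (rule decay[OF near[OF lg3] at13]) (simp_all add: xi_at_singularities)
    have 2: "(U (w2 u a) (- (-1) * u) \<longlongrightarrow> k2 n u a * exp (lg_exponent (-1) n u (e ?F)) * (1 + Lim ?F (\<eta>2 n u a))) ?F"
      by (rule far[OF lg2]) auto
    have 4: "(U (w4 u a) (- (-1) * u) \<longlongrightarrow> k4m n u a * exp (lg_exponent (-1) n u (e ?F)) * (1 + Lim ?F (\<eta>4m n u a))) ?F"
      by (rule far[OF lg4m]) auto
    have "((\<lambda>z. exp \<mu> * (U (w2 u a) (- (-1) * u) z - U (w3 u a) (- (-1) * u) z) + exp (- \<mu>) * U (w3 u a) (- (-1) * u) z) \<longlongrightarrow>
      exp \<mu> * (k2 n u a * exp (lg_exponent (-1) n u (e ?F)) * (1 + Lim ?F (\<eta>2 n u a)) - 0) + exp (- \<mu>) * 0) ?F"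
      by (intro tendsto_intros z 2)
    moreover have "\<forall>\<^sub>F z in ?F. exp \<mu> * (U (w2 u a) (- (-1) * u) z - U (w3 u a) (- (-1) * u) z) + exp (- \<mu>) * U (w3 u a) (- (-1) * u) z
      = U (w4 u a) (- (-1) * u) z"
      using filters_in_cut_dom(3) by eventually_elim (simp only: U2 U4 add_diff_cancel_right')
    ultimately have "(U (w4 u a) (- (-1) * u) \<longlongrightarrow>
      exp \<mu> * (k2 n u a * exp (lg_exponent (-1) n u (e ?F)) * (1 + Lim ?F (\<eta>2 n u a)) - 0) + exp (- \<mu>) * 0) ?F"
      by (rule Lim_transform_eventually)
    from tendsto_unique[OF nt(3) 4 this]
    show "k4m n u a * exp (lg_exponent (-1) n u (e ?F)) * (1 + Lim ?F (\<eta>4m n u a))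
      = exp \<mu> * (k2 n u a * exp (lg_exponent (-1) n u (e ?F)) * (1 + Lim ?F (\<eta>2 n u a)))" by simp
  qed simp
  have e4: "e (to_x4 \<sigma> P u a) = (\<lambda>s. Ehat_x4 \<sigma> P s u a)" for \<sigma>
    by (simp add: e_def Ehat_x4_def fun_eq_iff)
  have near4p: "(U (w4 u a) (- (-1) * u) \<longlongrightarrow> k4p n u a * exp (lg_exponent (-1) n u (\<lambda>s. Ehat_x4 1 P s u a))) (to_x4 1 P u a)"
    using near[OF lg4p] by (simp add: e4)
  have near4m: "(U (w4 u a) (- (-1) * u) \<longlongrightarrow> k4m n u a * exp (lg_exponent (-1) n u (\<lambda>s. Ehat_x4 (-1) P s u a))) (to_x4 (-1) P u a)"
    using near[OF lg4m] by (simp add: e4)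
  show "k4p n u a * exp (lg_exponent (-1) n u (\<lambda>s. Ehat_x4 1 P s u a))
      = - exp (- \<phi>) * k4m n u a * exp (lg_exponent (-1) n u (\<lambda>s. Ehat_x4 (-1) P s u a))"
    using solution_across_cut[OF setting(1) ua solution_props(2)[OF ua], of "- (-1) * u"] near4p near4m
    unfolding U_def by (simp add: \<phi>_def mult.assoc)
  show "k1 n u a * (1 + Lim (to_x2 P u a) (\<eta>1 n u a)) + k3 n u a * (1 + Lim (to_x2 P u a) (\<eta>3 n u a)) = 0"
  proof -
    let ?F = "to_x2 P u a"
    have z: "(U (w2 u a) (- 1 * u) \<longlongrightarrow> 0) ?F"
      by (rule decay[OF near[OF lg2] at24]) (simp_all add: xi_at_singularities)
    have 1: "(U (w1 u a) (- 1 * u) \<longlongrightarrow> k1 n u a * exp (lg_exponent 1 n u (e ?F)) * (1 + Lim ?F (\<eta>1 n u a))) ?F"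
      by (rule far[OF lg1]) auto
    have 3: "(U (w3 u a) (- 1 * u) \<longlongrightarrow> k3 n u a * exp (lg_exponent 1 n u (e ?F)) * (1 + Lim ?F (\<eta>3 n u a))) ?F"
      by (rule far[OF lg3]) auto
    have "\<forall>\<^sub>F z in ?F. U (w1 u a) (- 1 * u) z + U (w3 u a) (- 1 * u) z = U (w2 u a) (- 1 * u) z"
      using filters_in_cut_dom(2) by eventually_elim (simp only: U2)
    from tendsto_unique[OF nt(2) Lim_transform_eventually[OF tendsto_add[OF 1 3] this] z]
    have "exp (lg_exponent 1 n u (e ?F)) * (k1 n u a * (1 + Lim ?F (\<eta>1 n u a)) + k3 n u a * (1 + Lim ?F (\<eta>3 n u a))) = 0"
      by (simp add: algebra_simps)
    then show ?thesis by simp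
  qed
  show "exp (2 * \<mu>) * k1 n u a * exp (lg_exponent 1 n u (\<lambda>s. Ehat_x4 1 P s u a)) * (1 + Lim (to_x4 1 P u a) (\<eta>1 n u a))
      = exp \<phi> * k3 n u a * exp (lg_exponent 1 n u (\<lambda>s. Ehat_x4 (-1) P s u a)) * (1 + Lim (to_x4 (-1) P u a) (\<eta>3 n u a))"
  proof -
    let ?F = "to_x4 1 P u a" and ?G = "to_x4 (-1) P u a"
    let ?L1 = "k1 n u a * exp (lg_exponent 1 n u (\<lambda>s. Ehat_x4 1 P s u a)) * (1 + Lim ?F (\<eta>1 n u a))"
    let ?L3 = "k3 n u a * exp (lg_exponent 1 n u (\<lambda>s. Ehat_x4 (-1) P s u a)) * (1 + Lim ?G (\<eta>3 n u a))"
    have z: "(U (w4 u a) (- 1 * u) \<longlongrightarrow> 0) ?F"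
      by (rule decay[OF near4p at24]) (simp add: xi_at_singularities)
    have 1: "(U (w1 u a) (- 1 * u) \<longlongrightarrow> ?L1) ?F"
      using far[OF lg1, of "to_x4 1 P"] by (simp add: e4)
    have 3: "(U (w3 u a) (- 1 * u) \<longlongrightarrow> ?L3) ?G"
      using far[OF lg3, of "to_x4 (-1) P"] by (simp add: e4)
    have "((\<lambda>z. exp \<mu> * U (w4 u a) (- 1 * u) z - exp (2 * \<mu>) * U (w1 u a) (- 1 * u) z) \<longlongrightarrow> exp \<mu> * 0 - exp (2 * \<mu>) * ?L1) ?F"
      by (intro tendsto_intros z 1)
    moreover have "\<forall>\<^sub>F z in ?F. exp \<mu> * U (w4 u a) (- 1 * u) z - exp (2 * \<mu>) * U (w1 u a) (- 1 * u) z = U (w3 u a) (- 1 * u) z"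
      using filters_in_cut_dom(4)
    proof eventually_elim
      case (elim z)
      have "exp \<mu> * exp (- \<mu>) = 1" "exp (2 * \<mu>) = exp \<mu> * exp \<mu>"
        by (simp_all add: exp_add[symmetric])
      then show ?case unfolding U4[OF elim] by (simp add: distrib_left mult.assoc[symmetric])
    qed
    ultimately have "(U (w3 u a) (- 1 * u) \<longlongrightarrow> exp \<mu> * 0 - exp (2 * \<mu>) * ?L1) ?F"
      by (rule Lim_transform_eventually)
    then have "exp \<mu> * 0 - exp (2 * \<mu>) * ?L1 = - exp (- of_real (- 1 * u * pi * (alpha P u a)\<^sup>2) * \<i>) * ?L3"
      using solution_across_cut[OF setting(1) ua solution_props(1)[OF ua], of "- 1 * u"] 3
      unfolding U_def by blast
    then show ?thesis by (simp add: \<phi>_def mult.assoc)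
  qed
qed

end

section \<open>Expansion of the connection coefficient\<close>

text \<open>Elimination of the normalising factors from the first three relations.  The minus sign of the jump
  relation accounts for the term \<open>\<pi>i\<close>, and with it for the summand \<open>1/2\<close> in \<open>\<lambda> + 1/2\<close>.\<close>

lemma exponent_equation_1:
  fixes \<mu> \<phi> S T :: complex
  assumes r1: "k4p * (1 + l1) = exp (- \<mu>) * k2 * (1 + l2)"
    and r2: "k4m * (1 + l3) = exp \<mu> * k2 * (1 + l4)"
    and r3: "k4p * exp S = - exp (- \<phi>) * k4m * exp T"
    and nz: "k2 \<noteq> 0"
    and l: "norm l1 \<le> \<delta>" "norm l2 \<le> \<delta>" "norm l3 \<le> \<delta>" "norm l4 \<le> \<delta>" "\<delta> < 1/2"
  obtains \<theta> where "exp (2 * \<mu> + of_real pi * \<i> - \<phi> - (S - T) + \<theta>) = 1" "norm \<theta> \<le> 8 * \<delta>"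
proof -
  obtain t1 where t1: "1 + l1 = exp t1" "norm t1 \<le> 2 * norm l1" using one_plus_eq_exp[of l1] l by force
  obtain t2 where t2: "1 + l2 = exp t2" "norm t2 \<le> 2 * norm l2" using one_plus_eq_exp[of l2] l by force
  obtain t3 where t3: "1 + l3 = exp t3" "norm t3 \<le> 2 * norm l3" using one_plus_eq_exp[of l3] l by force
  obtain t4 where t4: "1 + l4 = exp t4" "norm t4 \<le> 2 * norm l4" using one_plus_eq_exp[of l4] l by force
  have p: "k4p = k2 * exp (- \<mu> + t2 - t1)"
    using r1 unfolding t1 t2 by (simp add: exp_add exp_diff exp_minus field_simps)
  have m: "k4m = k2 * exp (\<mu> + t4 - t3)"
    using r2 unfolding t3 t4 by (simp add: exp_add exp_diff field_simps)
  have "k2 * (exp (- \<mu> + t2 - t1) * exp S)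
      = k2 * (exp (of_real pi * \<i>) * (exp (- \<phi>) * exp (\<mu> + t4 - t3) * exp T))"
    using r3 unfolding p m by (simp add: mult_ac)
  then have "exp (- \<mu> + t2 - t1) * exp S
      = exp (of_real pi * \<i>) * (exp (- \<phi>) * exp (\<mu> + t4 - t3) * exp T)"
    unfolding mult_left_cancel[OF nz] .
  then have "exp (- \<mu> + t2 - t1 + S) = exp (of_real pi * \<i> - \<phi> + \<mu> + t4 - t3 + T)"
    unfolding exp_add[symmetric] by (simp add: algebra_simps)
  then have "exp (of_real pi * \<i> - \<phi> + \<mu> + t4 - t3 + T - (- \<mu> + t2 - t1 + S)) = 1"
    by (simp only: exp_diff) simp
  then have "exp (2 * \<mu> + of_real pi * \<i> - \<phi> - (S - T) + (t4 - t3 - t2 + t1)) = 1"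
    by (simp add: algebra_simps)
  moreover have "norm (t4 - t3 - t2 + t1) \<le> norm t4 + norm t3 + norm t2 + norm t1"
    by (intro order_trans[OF norm_triangle_ineq] order_trans[OF norm_triangle_ineq4] add_mono order_refl)
  then have "norm (t4 - t3 - t2 + t1) \<le> 8 * \<delta>"
    using t1(2) t2(2) t3(2) t4(2) l by linarith
  ultimately show ?thesis by (rule that)
qed

text \<open>The same elimination for the last two relations; the coefficients now enter without alternating signs.\<close>

lemma exponent_equation_2:
  fixes \<mu> \<phi> S T :: complex
  assumes r4: "k1 * (1 + l1) + k3 * (1 + l2) = 0"
    and r5: "exp (2 * \<mu>) * k1 * exp S * (1 + l3) = exp \<phi> * k3 * exp T * (1 + l4)"
    and nz: "k3 \<noteq> 0"
    and l: "norm l1 \<le> \<delta>" "norm l2 \<le> \<delta>" "norm l3 \<le> \<delta>" "norm l4 \<le> \<delta>" "\<delta> < 1/2"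
  obtains \<theta> where "exp (2 * \<mu> + of_real pi * \<i> - \<phi> + (S - T) + \<theta>) = 1" "norm \<theta> \<le> 8 * \<delta>"
proof -
  obtain t1 where t1: "1 + l1 = exp t1" "norm t1 \<le> 2 * norm l1" using one_plus_eq_exp[of l1] l by force
  obtain t2 where t2: "1 + l2 = exp t2" "norm t2 \<le> 2 * norm l2" using one_plus_eq_exp[of l2] l by force
  obtain t3 where t3: "1 + l3 = exp t3" "norm t3 \<le> 2 * norm l3" using one_plus_eq_exp[of l3] l by force
  obtain t4 where t4: "1 + l4 = exp t4" "norm t4 \<le> 2 * norm l4" using one_plus_eq_exp[of l4] l by force
  have "k1 * exp t1 = - (k3 * exp t2)"
    using r4 unfolding t1 t2 by (simp add: eq_neg_iff_add_eq_0)
  then have k1: "k1 = k3 * (exp (of_real pi * \<i>) * exp (t2 - t1))"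
    by (simp add: exp_diff field_simps)
  have "k3 * exp (2 * \<mu> + of_real pi * \<i> + (t2 - t1) + S + t3) = k3 * exp (\<phi> + T + t4)"
    using r5 unfolding k1 t3 t4 by (simp add: exp_add mult_ac)
  then have "exp (2 * \<mu> + of_real pi * \<i> + (t2 - t1) + S + t3) = exp (\<phi> + T + t4)"
    using nz by simp
  then have "exp (2 * \<mu> + of_real pi * \<i> + (t2 - t1) + S + t3 - (\<phi> + T + t4)) = 1"
    by (simp only: exp_diff) simp
  then have "exp (2 * \<mu> + of_real pi * \<i> - \<phi> + (S - T) + (t2 - t1 + t3 - t4)) = 1"
    by (simp add: algebra_simps)
  moreover have "norm (t2 - t1 + t3 - t4) \<le> norm t2 + norm t1 + norm t3 + norm t4"
    by (intro order_trans[OF norm_triangle_ineq4] order_trans[OF norm_triangle_ineq] add_mono order_refl)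
  then have "norm (t2 - t1 + t3 - t4) \<le> 8 * \<delta>"
    using t1(2) t2(2) t3(2) t4(2) l by linarith
  ultimately show ?thesis by (rule that)
qed

lemma sum_odd_indices:
  fixes d :: "nat \<Rightarrow> 'a::field_char_0"
  shows "(\<Sum>s=1..2*N. d s) - (\<Sum>s=1..2*N. (-1) ^ s * d s) = 2 * (\<Sum>j<N. d (2 * j + 1))"
proof (induction N)
  case (Suc N)
  have "2 * Suc N = Suc (Suc (2 * N))" by simp
  then show ?case using Suc by (simp add: algebra_simps)
qed simp

text \<open>Both exponents are integer multiples of \<open>2\<pi>i\<close>, and they differ by less than \<open>2\<pi>\<close>, so they are equal.
  In their mean the terms with even index cancel.\<close>

lemma average_exponents:
  fixes X :: complex and d :: "nat \<Rightarrow> complex"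
  assumes 1: "exp (X - (\<Sum>s=1..2*N. (-1) ^ s * d s) + \<theta>) = 1"
    and 2: "exp (X + (\<Sum>s=1..2*N. d s) + \<theta>') = 1"
    and \<theta>: "norm \<theta> \<le> \<beta>" "norm \<theta>' \<le> \<beta>"
    and small: "2 * (\<Sum>s=1..2*N. norm (d s)) + 2 * \<beta> < 2 * pi"
  obtains p :: int where "norm (X + (\<Sum>j<N. d (2 * j + 1)) - of_int p * (2 * of_real pi * \<i>)) \<le> \<beta>"
proof -
  define S T where "S = (\<Sum>s=1..2*N. d s)" and "T = (\<Sum>s=1..2*N. (-1) ^ s * d s)"
  define \<Sigma> where "\<Sigma> = (\<Sum>j<N. d (2 * j + 1))"
  have ST: "S - T = 2 * \<Sigma>" unfolding S_def T_def \<Sigma>_def by (rule sum_odd_indices)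
  obtain p :: int where p: "X - T + \<theta> = of_int p * (2 * of_real pi * \<i>)"
    using 1 exp_eq[of "X - T + \<theta>" 0] unfolding T_def by (auto simp: algebra_simps)
  obtain q :: int where q: "X + S + \<theta>' = of_int q * (2 * of_real pi * \<i>)"
    using 2 exp_eq[of "X + S + \<theta>'" 0] unfolding S_def by (auto simp: algebra_simps)
  have "p = q"
  proof (rule ccontr)
    assume "p \<noteq> q"
    have "of_int (q - p) * (2 * of_real pi * \<i>) = (X + S + \<theta>') - (X - T + \<theta>)"
      unfolding p q by (simp add: algebra_simps)
    also have "\<dots> = S + T + (\<theta>' - \<theta>)" by simp
    finally have "of_int (q - p) * (2 * of_real pi * \<i>) = S + T + (\<theta>' - \<theta>)" .
    then have "norm (S + T + (\<theta>' - \<theta>)) = \<bar>of_int (q - p)\<bar> * (2 * pi)"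
      by (metis (no_types, lifting) abs_of_nonneg norm_ii norm_mult norm_numeral norm_of_int norm_of_real mult.right_neutral pi_ge_zero)
    moreover have "\<bar>of_int (q - p) :: real\<bar> \<ge> 1" using \<open>p \<noteq> q\<close> by linarith
    then have "\<bar>of_int (q - p)\<bar> * (2 * pi) \<ge> 1 * (2 * pi)" by (intro mult_right_mono) auto
    moreover have "norm (S + T + (\<theta>' - \<theta>)) \<le> norm S + norm T + (norm \<theta>' + norm \<theta>)"
      by (intro order_trans[OF norm_triangle_ineq] add_mono norm_triangle_ineq norm_triangle_ineq4)
    moreover have "norm S \<le> (\<Sum>s=1..2*N. norm (d s))" unfolding S_def by (rule norm_sum)
    moreover have "norm T \<le> (\<Sum>s=1..2*N. norm (d s))"
      unfolding T_def by (rule order_trans[OF norm_sum]) (simp add: norm_mult norm_power)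
    ultimately show False using small \<theta> by linarith
  qed
  have "2 * (X + \<Sigma> - of_int p * (2 * of_real pi * \<i>))
      = (X - T + \<theta>) + (X + S + \<theta>') - (\<theta> + \<theta>') - 2 * (of_int p * (2 * of_real pi * \<i>))"
    using ST by (simp add: algebra_simps)
  also have "\<dots> = - (\<theta> + \<theta>')" unfolding p q \<open>p = q\<close> by simp
  finally have "norm (2 * (X + \<Sigma> - of_int p * (2 * of_real pi * \<i>))) = norm (\<theta> + \<theta>')"
    by (simp only: norm_minus_cancel)
  then have "norm (X + \<Sigma> - of_int p * (2 * of_real pi * \<i>)) = norm (\<theta> + \<theta>') / 2"
    by (simp only: norm_mult) simp
  also have "\<dots> \<le> \<beta>" using norm_triangle_ineq[of \<theta> \<theta>'] \<theta> by linarith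
  finally show ?thesis unfolding \<Sigma>_def by (rule that)
qed

context connection_problem
begin

lemma connection_errors_small:
  assumes n: "n \<ge> 1"
  obtains C where "C \<ge> 0" "\<forall>\<^sub>F u in at_top. \<forall>a\<in>A. \<forall>l \<in> {Lim (to_x1 P u a) (\<eta>4p n u a), Lim (to_x1 P u a) (\<eta>2 n u a),
      Lim (to_x3 P u a) (\<eta>4m n u a), Lim (to_x3 P u a) (\<eta>2 n u a), Lim (to_x2 P u a) (\<eta>1 n u a),
      Lim (to_x2 P u a) (\<eta>3 n u a), Lim (to_x4 1 P u a) (\<eta>1 n u a), Lim (to_x4 (-1) P u a) (\<eta>3 n u a)}.
      norm l \<le> C / u ^ n"
proof -
  let ?B = "\<lambda>(G :: real \<Rightarrow> real \<Rightarrow> complex filter) \<eta>. \<exists>C. \<forall>\<^sub>F u in at_top. \<forall>a\<in>A. norm (Lim (G u a) (\<eta> n u a) :: complex) \<le> C / u ^ n"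
  define pts where "pts = {(to_x1 P, \<eta>4p), (to_x1 P, \<eta>2), (to_x3 P, \<eta>4m), (to_x3 P, \<eta>2), (to_x2 P, \<eta>1),
      (to_x2 P, \<eta>3), (to_x4 1 P, \<eta>1), (to_x4 (-1) P, \<eta>3)}"
  note Zdefs = Z1_def[abs_def] Z2_def[abs_def] Z3_def[abs_def] Z4_def[abs_def]
  note b1 = lg_error_value_bound[OF lg1[unfolded Zdefs] n _ A]
    and b2 = lg_error_value_bound[OF lg2[unfolded Zdefs] n _ A]
    and b3 = lg_error_value_bound[OF lg3[unfolded Zdefs] n _ A]
    and b4p = lg_error_value_bound[OF lg4p[unfolded Zdefs] n _ A]
    and b4m = lg_error_value_bound[OF lg4m[unfolded Zdefs] n _ A]
  have "?B (to_x1 P) \<eta>4p" by (rule b4p[OF _ back_links(2)]) auto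
  moreover have "?B (to_x1 P) \<eta>2" by (rule b2[OF _ back_links(1)]) auto
  moreover have "?B (to_x3 P) \<eta>4m" by (rule b4m[OF _ back_links(4)]) auto
  moreover have "?B (to_x3 P) \<eta>2" by (rule b2[OF _ back_links(3)]) auto
  moreover have "?B (to_x2 P) \<eta>1" by (rule b1[OF _ links(1)]) auto
  moreover have "?B (to_x2 P) \<eta>3" by (rule b3[OF _ links(3)]) auto
  moreover have "?B (to_x4 1 P) \<eta>1" by (rule b1[OF _ links(2)]) auto
  moreover have "?B (to_x4 (-1) P) \<eta>3" by (rule b3[OF _ links(4)]) auto
  ultimately have "\<forall>q\<in>pts. ?B (fst q) (snd q)" by (simp add: pts_def)
  from bchoice[OF this]
  obtain c where c: "\<forall>q\<in>pts. \<forall>\<^sub>F u in at_top. \<forall>a\<in>A. norm (Lim (fst q u a) (snd q n u a)) \<le> c q / u ^ n"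
    by blast
  have fin: "finite pts" by (simp add: pts_def)
  define C where "C = (\<Sum>q\<in>pts. \<bar>c q\<bar>)"
  have cC: "c q \<le> C" if "q \<in> pts" for q
    using member_le_sum[OF that _ fin, of "\<lambda>q. \<bar>c q\<bar>"] by (simp add: C_def)
  have "\<forall>\<^sub>F u in at_top. \<forall>q\<in>pts. \<forall>a\<in>A. norm (Lim (fst q u a) (snd q n u a)) \<le> c q / u ^ n"
    by (rule eventually_ball_finite[OF fin c])
  then have "\<forall>\<^sub>F u in at_top. \<forall>q\<in>pts. \<forall>a\<in>A. norm (Lim (fst q u a) (snd q n u a)) \<le> C / u ^ n"
    using eventually_gt_at_top[of 0]
  proof eventually_elim
    case (elim u)
    show ?case
    proof (intro ballI)
      fix q a assume q: "q \<in> pts" and a: "a \<in> A"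
      have "c q / u ^ n \<le> C / u ^ n" using cC[OF q] elim(2) by (intro divide_right_mono) auto
      then show "norm (Lim (fst q u a) (snd q n u a)) \<le> C / u ^ n" using elim(1) q a by (meson order_trans)
    qed
  qed
  then have "\<forall>\<^sub>F u in at_top. \<forall>a\<in>A. \<forall>l \<in> {Lim (to_x1 P u a) (\<eta>4p n u a), Lim (to_x1 P u a) (\<eta>2 n u a),
      Lim (to_x3 P u a) (\<eta>4m n u a), Lim (to_x3 P u a) (\<eta>2 n u a), Lim (to_x2 P u a) (\<eta>1 n u a),
      Lim (to_x2 P u a) (\<eta>3 n u a), Lim (to_x4 1 P u a) (\<eta>1 n u a), Lim (to_x4 (-1) P u a) (\<eta>3 n u a)}.
      norm l \<le> C / u ^ n"
    by eventually_elim (simp add: pts_def)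
  moreover have "C \<ge> 0" unfolding C_def by (rule sum_nonneg) simp
  ultimately show ?thesis using that by blast
qed

definition jump :: "nat \<Rightarrow> real \<Rightarrow> real \<Rightarrow> complex" where
  "jump s u a = Ehat_x4 1 P s u a - Ehat_x4 (-1) P s u a"

text \<open>The jump is the sum of the increments along four linking paths: from \<open>x\<^sub>4 - i0\<close> to \<open>x\<^sub>3\<close>, \<open>x\<^sub>2\<close>,
  \<open>x\<^sub>1\<close> and \<open>x\<^sub>4 + i0\<close>.\<close>

lemma jump_bounded:
  assumes s: "s \<ge> 1"
  shows "\<exists>C. \<forall>\<^sub>F u in at_top. \<forall>a\<in>A. norm (jump s u a) \<le> C"
proof -
  note Zdefs = Z1_def[abs_def] Z3_def[abs_def]
  have um: "umin P > 0" using setting(1) by (simp add: two_turning_point_equation_def)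
  let ?e = "\<lambda>G u a. Lim (G u a) (Ehat P s u a)"
  obtain C1 where C1: "\<forall>\<^sub>F u in at_top. \<forall>a\<in>A. norm (?e (to_x2 P) u a - ?e (to_x1 P) u a) \<le> C1"
  proof -
    have "\<exists>C. \<forall>\<^sub>F u in at_top. \<forall>a\<in>A. norm (?e (to_x2 P) u a - ?e (to_x1 P) u a) \<le> C"
      by (rule coefficient_change_bound[OF lg1[unfolded Zdefs] s _ um A links(1)]) (use s in \<open>auto simp: factors_nonzero root4_nonzero intro: coefficient_continuous coefficient_limits\<close>)
    then show ?thesis using that by blast
  qed
  obtain C2 where C2: "\<forall>\<^sub>F u in at_top. \<forall>a\<in>A. norm (?e (to_x4 1 P) u a - ?e (to_x1 P) u a) \<le> C2"
  proof -
    have "\<exists>C. \<forall>\<^sub>F u in at_top. \<forall>a\<in>A. norm (?e (to_x4 1 P) u a - ?e (to_x1 P) u a) \<le> C"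
      by (rule coefficient_change_bound[OF lg1[unfolded Zdefs] s _ um A links(2)]) (use s in \<open>auto simp: factors_nonzero root4_nonzero intro: coefficient_continuous coefficient_limits\<close>)
    then show ?thesis using that by blast
  qed
  obtain C3 where C3: "\<forall>\<^sub>F u in at_top. \<forall>a\<in>A. norm (?e (to_x2 P) u a - ?e (to_x3 P) u a) \<le> C3"
  proof -
    have "\<exists>C. \<forall>\<^sub>F u in at_top. \<forall>a\<in>A. norm (?e (to_x2 P) u a - ?e (to_x3 P) u a) \<le> C"
      by (rule coefficient_change_bound[OF lg3[unfolded Zdefs] s _ um A links(3)]) (use s in \<open>auto simp: factors_nonzero root4_nonzero intro: coefficient_continuous coefficient_limits\<close>)
    then show ?thesis using that by blast
  qed
  obtain C4 where C4: "\<forall>\<^sub>F u in at_top. \<forall>a\<in>A. norm (?e (to_x4 (-1) P) u a - ?e (to_x3 P) u a) \<le> C4"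
  proof -
    have "\<exists>C. \<forall>\<^sub>F u in at_top. \<forall>a\<in>A. norm (?e (to_x4 (-1) P) u a - ?e (to_x3 P) u a) \<le> C"
      by (rule coefficient_change_bound[OF lg3[unfolded Zdefs] s _ um A links(4)]) (use s in \<open>auto simp: factors_nonzero root4_nonzero intro: coefficient_continuous coefficient_limits\<close>)
    then show ?thesis using that by blast
  qed
  have "\<forall>\<^sub>F u in at_top. \<forall>a\<in>A. norm (jump s u a) \<le> C2 + C1 + C3 + C4"
    using C1 C2 C3 C4
  proof eventually_elim
    case (elim u)
    show ?case
    proof
      fix a assume a: "a \<in> A"
      let ?x = "?e (to_x4 1 P) u a - ?e (to_x1 P) u a" and ?y = "?e (to_x2 P) u a - ?e (to_x1 P) u a"
      let ?z = "?e (to_x2 P) u a - ?e (to_x3 P) u a" and ?w = "?e (to_x4 (-1) P) u a - ?e (to_x3 P) u a"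
      have "jump s u a = ?x - ?y + ?z - ?w" by (simp add: jump_def Ehat_x4_def)
      moreover have "norm (?x - ?y + ?z - ?w) \<le> norm ?x + norm ?y + norm ?z + norm ?w"
        by (intro order_trans[OF norm_triangle_ineq4] order_trans[OF norm_triangle_ineq] add_mono order_refl)
      ultimately have "norm (jump s u a) \<le> norm ?x + norm ?y + norm ?z + norm ?w" by simp
      also have "\<dots> \<le> C2 + C1 + C3 + C4" using elim a by (intro add_mono) blast+
      finally show "norm (jump s u a) \<le> C2 + C1 + C3 + C4" .
    qed
  qed
  then show ?thesis by blast
qed

lemma jumps_bounded:
  obtains C where "C \<ge> 0" "\<forall>\<^sub>F u in at_top. \<forall>a\<in>A. \<forall>s\<in>{1..M}. norm (jump s u a) \<le> C"
proof -
  have "\<forall>s\<in>{1..M}. \<exists>C. \<forall>\<^sub>F u in at_top. \<forall>a\<in>A. norm (jump s u a) \<le> C"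
    using jump_bounded by auto
  from bchoice[OF this]
  obtain c where c: "\<forall>s\<in>{1..M}. \<forall>\<^sub>F u in at_top. \<forall>a\<in>A. norm (jump s u a) \<le> c s" by blast
  have "\<forall>\<^sub>F u in at_top. \<forall>s\<in>{1..M}. \<forall>a\<in>A. norm (jump s u a) \<le> c s"
    by (intro eventually_ball_finite c) simp
  then have "\<forall>\<^sub>F u in at_top. \<forall>a\<in>A. \<forall>s\<in>{1..M}. norm (jump s u a) \<le> (\<Sum>s=1..M. \<bar>c s\<bar>)"
  proof eventually_elim
    case (elim u)
    have "c s \<le> (\<Sum>s=1..M. \<bar>c s\<bar>)" if "s \<in> {1..M}" for s
      using member_le_sum[OF that, of "\<lambda>s. \<bar>c s\<bar>"] by simp
    then show ?case using elim by (meson order_trans)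
  qed
  then show ?thesis by (intro that[of "\<Sum>s=1..M. \<bar>c s\<bar>"]) (auto intro: sum_nonneg)
qed

text \<open>The amount by which the claimed expansion, cut off after \<open>N\<close> terms, misses \<open>\<lambda> + 1/2\<close>.\<close>

definition deviation :: "nat \<Rightarrow> real \<Rightarrow> real \<Rightarrow> complex" where
  "deviation N u a = lam u a + 1/2 -
       (of_real (u * (alpha P u a)\<^sup>2 / 2) + 1 / (2 * of_real pi * \<i>) *
         (\<Sum>s<N. (Ehat_x4 (-1) P (2 * s + 1) u a - Ehat_x4 1 P (2 * s + 1) u a) / of_real (u ^ (2 * s + 1))))"

lemma jumps_small:
  obtains C where "C \<ge> 0" "\<forall>\<^sub>F u in at_top. \<forall>a\<in>A. (\<Sum>s=1..M. norm (jump s u a / of_real (u ^ s))) \<le> C / u"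
proof -
  obtain C where C: "C \<ge> 0" "\<forall>\<^sub>F u in at_top. \<forall>a\<in>A. \<forall>s\<in>{1..M}. norm (jump s u a) \<le> C"
    using jumps_bounded by blast
  have "\<forall>\<^sub>F u in at_top. \<forall>a\<in>A. (\<Sum>s=1..M. norm (jump s u a / of_real (u ^ s))) \<le> (real M * C) / u"
    using C(2) eventually_ge_at_top[of 1]
  proof eventually_elim
    case (elim u)
    show ?case
    proof
      fix a assume a: "a \<in> A"
      have "norm (jump s u a / of_real (u ^ s)) \<le> C / u" if s: "s \<in> {1..M}" for s
      proof -
        have "u \<le> u ^ s" using elim(2) s self_le_power[of u s] by auto
        moreover have "norm (jump s u a / of_real (u ^ s)) = norm (jump s u a) / u ^ s"
          using elim(2) by (simp add: norm_divide norm_power)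
        moreover have "norm (jump s u a) \<le> C" using elim(1) a s by blast
        ultimately show ?thesis using elim(2) C(1) by (auto intro!: frac_le)
      qed
      then have "(\<Sum>s=1..M. norm (jump s u a / of_real (u ^ s))) \<le> (\<Sum>s=1..M. C / u)"
        by (rule sum_mono)
      then show "(\<Sum>s=1..M. norm (jump s u a / of_real (u ^ s))) \<le> (real M * C) / u" by simp
    qed
  qed
  then show ?thesis using C(1) by (intro that[of "real M * C"]) auto
qed

text \<open>With \<open>n = 2 N + 1\<close>, the averaged exponent contains exactly the \<open>N\<close> odd terms of the expansion and the
  error terms have the order \<open>u\<^sup>-\<^sup>n\<close> of the first omitted one.\<close>

lemma deviation_near_integer:
  "\<exists>C\<ge>0. \<forall>\<^sub>F u in at_top. \<forall>a\<in>A. \<exists>p::int. norm (deviation N u a - of_int p) \<le> C / u ^ (2 * N + 1)"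
proof -
  define n where "n = 2 * N + 1"
  have n: "n \<ge> 1" by (simp add: n_def)
  obtain C where C: "C \<ge> 0" "\<forall>\<^sub>F u in at_top. \<forall>a\<in>A. \<forall>l \<in> {Lim (to_x1 P u a) (\<eta>4p n u a), Lim (to_x1 P u a) (\<eta>2 n u a),
      Lim (to_x3 P u a) (\<eta>4m n u a), Lim (to_x3 P u a) (\<eta>2 n u a), Lim (to_x2 P u a) (\<eta>1 n u a),
      Lim (to_x2 P u a) (\<eta>3 n u a), Lim (to_x4 1 P u a) (\<eta>1 n u a), Lim (to_x4 (-1) P u a) (\<eta>3 n u a)}.
      norm l \<le> C / u ^ n"
    using connection_errors_small[OF n] by blast
  obtain J where J: "J \<ge> 0" "\<forall>\<^sub>F u in at_top. \<forall>a\<in>A. (\<Sum>s=1..2*N. norm (jump s u a / of_real (u ^ s))) \<le> J / u"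
    using jumps_small by blast
  have "\<forall>\<^sub>F u in at_top. \<forall>a\<in>A. \<exists>p::int. norm (deviation N u a - of_int p) \<le> (8 * C) / u ^ n"
    using C(2) J(2) eventually_params[OF A] eventually_ge_at_top[of 1] eventually_ge_at_top[of "4 * C + 1"]
      eventually_ge_at_top[of "8 * C + J"]
  proof eventually_elim
    case (elim u)
    note err = elim(1) and jmp = elim(2) and par = elim(3) and u1 = elim(4) and u2 = elim(5) and u3 = elim(6)
    have u0: "u > 0" using u1 by linarith
    have un: "u \<le> u ^ n" using u1 n self_le_power[of u n] by auto
    have CuL: "C / u ^ n \<le> C / u" using un u0 C(1) by (intro divide_left_mono) auto
    have small: "C / u ^ n < 1/2"
    proof -
      have "C / u < 1/2" using u2 u0 C(1) by (simp add: field_simps)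
      then show ?thesis using CuL by linarith
    qed
    show ?case
    proof
      fix a assume a: "a \<in> A"
      then have ua: "(u, a) \<in> params P" using par by blast
      define \<mu> where "\<mu> = lam u a * of_real pi * \<i>"
      define \<phi> where "\<phi> = complex_of_real (u * pi * (alpha P u a)\<^sup>2) * \<i>"
      define X where "X = 2 * \<mu> + of_real pi * \<i> - \<phi>"
      define d where "d s = jump s u a / of_real (u ^ s)" for s
      note rel = connection_relations[OF ua n, folded \<mu>_def \<phi>_def]
      have S1: "lg_exponent (-1) n u (\<lambda>s. Ehat_x4 1 P s u a) - lg_exponent (-1) n u (\<lambda>s. Ehat_x4 (-1) P s u a)
        = (\<Sum>s=1..2*N. (-1) ^ s * d s)"
        by (simp add: lg_exponent_def n_def d_def jump_def sum_subtractf[symmetric] diff_divide_distrib[symmetric] right_diff_distrib[symmetric])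
      have S2: "lg_exponent 1 n u (\<lambda>s. Ehat_x4 1 P s u a) - lg_exponent 1 n u (\<lambda>s. Ehat_x4 (-1) P s u a)
        = (\<Sum>s=1..2*N. d s)"
        by (simp add: lg_exponent_def n_def d_def jump_def sum_subtractf[symmetric] diff_divide_distrib[symmetric])
      obtain \<theta> where \<theta>: "exp (X - (\<Sum>s=1..2*N. (-1) ^ s * d s) + \<theta>) = 1" "norm \<theta> \<le> 8 * (C / u ^ n)"
        using exponent_equation_1[OF rel(1-3) factors_nonzero(2)[OF ua n], of "C / u ^ n"] err a small
        unfolding S1 X_def by blast
      obtain \<theta>' where \<theta>': "exp (X + (\<Sum>s=1..2*N. d s) + \<theta>') = 1" "norm \<theta>' \<le> 8 * (C / u ^ n)"
        using exponent_equation_2[OF rel(4,5) factors_nonzero(3)[OF ua n], of "C / u ^ n"] err a small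
        unfolding S2 X_def by blast
      have "2 * (\<Sum>s=1..2*N. norm (d s)) + 2 * (8 * (C / u ^ n)) < 2 * pi"
      proof -
        have "(\<Sum>s=1..2*N. norm (d s)) \<le> J / u" using jmp a by (simp add: d_def)
        moreover have "J / u + 8 * (C / u) \<le> 1" using u3 u0 by (simp add: field_simps)
        ultimately show ?thesis using CuL pi_gt3 by linarith
      qed
      then obtain p :: int where p: "norm (X + (\<Sum>j<N. d (2 * j + 1)) - of_int p * (2 * of_real pi * \<i>)) \<le> 8 * (C / u ^ n)"
        using average_exponents[OF \<theta>(1) \<theta>'(1) \<theta>(2) \<theta>'(2)] by blast
      have dev: "X + (\<Sum>j<N. d (2 * j + 1)) - of_int p * (2 * of_real pi * \<i>) = (2 * of_real pi * \<i>) * (deviation N u a - of_int p)"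
      proof -
        have "(\<Sum>s<N. (Ehat_x4 (-1) P (2 * s + 1) u a - Ehat_x4 1 P (2 * s + 1) u a) / of_real (u ^ (2 * s + 1)))
          = - (\<Sum>j<N. d (2 * j + 1))"
          by (simp add: d_def jump_def sum_negf[symmetric] minus_divide_left)
        then show ?thesis
          unfolding deviation_def by (simp add: X_def \<mu>_def \<phi>_def field_simps)
      qed
      have "2 * pi * norm (deviation N u a - of_int p) \<le> 8 * (C / u ^ n)"
        using p unfolding dev by (simp add: norm_mult)
      moreover have "1 * norm (deviation N u a - of_int p) \<le> 2 * pi * norm (deviation N u a - of_int p)"
        using pi_gt3 by (intro mult_right_mono) auto
      ultimately have "norm (deviation N u a - of_int p) \<le> 8 * C / u ^ n" by simp
      then show "\<exists>p::int. norm (deviation N u a - of_int p) \<le> 8 * C / u ^ n" by blast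
    qed
  qed
  then show ?thesis using C(1) unfolding n_def by (intro exI[of _ "8 * C"]) auto
qed

lemma deviation_differences:
  "\<exists>C\<ge>0. \<forall>\<^sub>F u in at_top. \<forall>a\<in>A. norm (deviation N u a - deviation 0 u a) \<le> C / u"
proof -
  obtain J where J: "J \<ge> 0" "\<forall>\<^sub>F u in at_top. \<forall>a\<in>A. (\<Sum>s=1..2*N. norm (jump s u a / of_real (u ^ s))) \<le> J / u"
    using jumps_small by blast
  have "norm (deviation N u a - deviation 0 u a) \<le> (\<Sum>s=1..2*N. norm (jump s u a / of_real (u ^ s)))" for u a
  proof -
    let ?d = "\<lambda>s. jump s u a / of_real (u ^ s)"
    have "(\<Sum>s<N. (Ehat_x4 (-1) P (2 * s + 1) u a - Ehat_x4 1 P (2 * s + 1) u a) / of_real (u ^ (2 * s + 1)))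
          = - (\<Sum>j<N. ?d (2 * j + 1))"
      by (simp add: jump_def sum_negf[symmetric] minus_divide_left)
    then have "deviation N u a - deviation 0 u a = 1 / (2 * of_real pi * \<i>) * (\<Sum>j<N. ?d (2 * j + 1))"
      by (simp add: deviation_def)
    then have "norm (deviation N u a - deviation 0 u a) = 1 / (2 * pi) * norm (\<Sum>j<N. ?d (2 * j + 1))"
      by (simp add: norm_mult norm_divide)
    also have "\<dots> \<le> 1 * norm (\<Sum>j<N. ?d (2 * j + 1))"
      using pi_gt3 by (intro mult_right_mono) auto
    also have "\<dots> \<le> (\<Sum>j<N. norm (?d (2 * j + 1)))" using norm_sum by simp
    also have "\<dots> = (\<Sum>s\<in>(\<lambda>j. 2 * j + 1) ` {..<N}. norm (?d s))"
      by (simp add: sum.reindex inj_on_def)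
    also have "\<dots> \<le> (\<Sum>s=1..2*N. norm (?d s))"
      by (rule sum_mono2) auto
    finally show ?thesis .
  qed
  then have "\<forall>\<^sub>F u in at_top. \<forall>a\<in>A. norm (deviation N u a - deviation 0 u a) \<le> J / u"
    using J(2) by (auto elim!: eventually_mono intro: order_trans)
  then show ?thesis using J(1) by blast
qed

text \<open>The integer is the same for every \<open>N\<close>, because the terms of the expansion are \<open>O(1/u)\<close> and therefore
  the deviations for all \<open>N\<close> are close to the one for \<open>N = 0\<close>.\<close>

lemma deviation_expansion:
  "\<exists>C. \<forall>\<^sub>F u in at_top. \<forall>a\<in>A. norm (deviation N u a - of_int (round (Re (deviation 0 u a)))) \<le> C / u ^ (2 * N + 1)"
proof -
  obtain C where C: "C \<ge> 0" "\<forall>\<^sub>F u in at_top. \<forall>a\<in>A. \<exists>p::int. norm (deviation N u a - of_int p) \<le> C / u ^ (2 * N + 1)"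
    using deviation_near_integer by blast
  obtain B where B: "B \<ge> 0" "\<forall>\<^sub>F u in at_top. \<forall>a\<in>A. norm (deviation N u a - deviation 0 u a) \<le> B / u"
    using deviation_differences by blast
  have "\<forall>\<^sub>F u in at_top. \<forall>a\<in>A. norm (deviation N u a - of_int (round (Re (deviation 0 u a)))) \<le> C / u ^ (2 * N + 1)"
    using C(2) B(2) eventually_ge_at_top[of 1] eventually_gt_at_top[of "2 * (B + C)"]
  proof eventually_elim
    case (elim u)
    show ?case
    proof
      fix a assume a: "a \<in> A"
      then obtain p :: int where p: "norm (deviation N u a - of_int p) \<le> C / u ^ (2 * N + 1)"
        using elim(1) by blast
      have u0: "u > 0" using elim(3) by linarith
      have "u \<le> u ^ (2 * N + 1)" using elim(3) self_le_power[of u "2 * N + 1"] by auto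
      then have "C / u ^ (2 * N + 1) \<le> C / u" using u0 C(1) by (intro divide_left_mono) auto
      moreover have "norm (deviation N u a - deviation 0 u a) \<le> B / u" using elim(2) a by blast
      moreover have "norm (deviation 0 u a - of_int p) \<le> norm (deviation N u a - of_int p) + norm (deviation N u a - deviation 0 u a)"
        using norm_triangle_ineq4[of "deviation N u a - of_int p" "deviation N u a - deviation 0 u a"] by simp
      moreover have "B / u + C / u < 1/2" using elim(4) u0 by (simp add: field_simps)
      ultimately have "norm (deviation 0 u a - of_int p) < 1/2" using p by linarith
      then have "\<bar>Re (deviation 0 u a) - of_int p\<bar> < 1/2"
        using abs_Re_le_cmod[of "deviation 0 u a - of_int p"] by simp
      then have "round (Re (deviation 0 u a)) = p" by (rule round_unique')
      then show "norm (deviation N u a - of_int (round (Re (deviation 0 u a)))) \<le> C / u ^ (2 * N + 1)"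
        using p by simp
    qed
  qed
  then show ?thesis by blast
qed

lemma expansion_mod_integers:
  "connection_expansion P A (\<lambda>u a. lam u a + of_int (- round (Re (deviation 0 u a))))"
  unfolding connection_expansion_def
proof
  fix N
  obtain C where "\<forall>\<^sub>F u in at_top. \<forall>a\<in>A. norm (deviation N u a - of_int (round (Re (deviation 0 u a)))) \<le> C / u ^ (2 * N + 1)"
    using deviation_expansion by blast
  then show "\<exists>C. \<forall>\<^sub>F u in at_top. \<forall>a \<in> A.
     norm (lam u a + of_int (- round (Re (deviation 0 u a))) + 1/2 -
       (of_real (u * (alpha P u a)\<^sup>2 / 2) + 1 / (2 * of_real pi * \<i>) *
         (\<Sum>s<N. (Ehat_x4 (-1) P (2 * s + 1) u a - Ehat_x4 1 P (2 * s + 1) u a) / of_real (u ^ (2 * s + 1)))))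
     \<le> C / u ^ (2 * N + 1)"
    unfolding deviation_def[of N] by (intro exI[of _ C]) (simp add: algebra_simps)
qed

text \<open>A continuous function that stays near the integers cannot cross \<open>\<plusminus>1/2\<close>.\<close>

lemma round_constant_on_connected:
  fixes g :: "real \<Rightarrow> real"
  assumes A: "connected S" "x0 \<in> S" and g: "continuous_on S g"
    and near: "\<And>x. x \<in> S \<Longrightarrow> \<bar>g x - of_int (round (g x))\<bar> < 1/4" and x0: "\<bar>g x0\<bar> < 1/4" and x: "x \<in> S"
  shows "round (g x) = 0"
proof -
  have "connected (g ` S)" by (rule connected_continuous_image[OF g A(1)])
  then have iv: "y \<in> g ` S" if "min (g x0) (g x) \<le> y" "y \<le> max (g x0) (g x)" for y
    using that A(2) x by (auto simp: connected_iff_interval min_def max_def split: if_splits)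
  have half: "1/2 \<notin> g ` S" "- (1/2) \<notin> g ` S"
  proof -
    have *: "\<bar>y - of_int (round y)\<bar> < 1/4" if "y \<in> g ` S" for y using near that by auto
    show "1/2 \<notin> g ` S" using *[of "1/2"] by (auto simp: round_def)
    show "- (1/2) \<notin> g ` S" using *[of "-(1/2)"] by (auto simp: round_def)
  qed
  have "\<bar>g x\<bar> < 1/2"
  proof (rule ccontr)
    assume "\<not> ?thesis"
    then consider "g x \<ge> 1/2" | "g x \<le> - (1/2)" by linarith
    then show False
    proof cases
      case 1
      then have "1/2 \<in> g ` S" using x0 by (intro iv) (auto simp: min_def max_def)
      then show False using half by blast
    next
      case 2
      then have "- (1/2) \<in> g ` S" using x0 by (intro iv) (auto simp: min_def max_def)
      then show False using half by blast
    qed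
  qed
  then show ?thesis by (intro round_unique') simp
qed

text \<open>When the turning points coalesce, \<open>\<alpha> = 0\<close> and \<open>\<lambda> \<rightarrow> -1/2\<close>, so for large \<open>u\<close> the deviation starts near 0; by
  continuity in \<open>a\<close> the integer next to it is 0 throughout.\<close>

lemma expansion_continued_from_coalescence:
  assumes conn: "connected A" and a0: "a0 P \<in> A"
    and cont: "\<And>u. u \<ge> umin P \<Longrightarrow> continuous_on A (lam u)" "\<And>u. u \<ge> umin P \<Longrightarrow> continuous_on A (alpha P u)"
    and start: "((\<lambda>u. lam u (a0 P)) \<longlongrightarrow> -1/2) at_top"
  shows "connection_expansion P A lam"
proof -
  obtain C where C: "\<forall>\<^sub>F u in at_top. \<forall>a\<in>A. norm (deviation 0 u a - of_int (round (Re (deviation 0 u a)))) \<le> C / u ^ (2 * 0 + 1)"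
    using deviation_expansion by blast
  have "\<forall>\<^sub>F u in at_top. dist (lam u (a0 P)) (-1/2) < 1/4"
    by (rule tendstoD[OF start]) simp
  then have zero: "\<forall>\<^sub>F u in at_top. \<forall>a\<in>A. round (Re (deviation 0 u a)) = 0"
    using C eventually_gt_at_top[of "4 * C"] eventually_gt_at_top[of 0] eventually_ge_at_top[of "umin P"]
  proof eventually_elim
    case (elim u)
    have dev0: "deviation 0 u a = lam u a + 1/2 - of_real (u * (alpha P u a)\<^sup>2 / 2)" for a
      by (simp add: deviation_def)
    show ?case
    proof
      fix a assume a: "a \<in> A"
      show "round (Re (deviation 0 u a)) = 0"
      proof (rule round_constant_on_connected[OF conn a0 _ _ _ a])
        show "continuous_on A (\<lambda>a. Re (deviation 0 u a))"
          unfolding dev0 using elim(5) by (intro continuous_intros cont) auto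
      next
        fix a assume a: "a \<in> A"
        have "\<bar>Re (deviation 0 u a) - of_int (round (Re (deviation 0 u a)))\<bar>
          \<le> norm (deviation 0 u a - of_int (round (Re (deviation 0 u a))))"
          using abs_Re_le_cmod[of "deviation 0 u a - of_int (round (Re (deviation 0 u a)))"] by simp
        also have "\<dots> \<le> C / u" using elim(2) a by auto
        also have "\<dots> < 1/4" using elim(3,4) by (simp add: field_simps)
        finally show "\<bar>Re (deviation 0 u a) - of_int (round (Re (deviation 0 u a)))\<bar> < 1/4" .
      next
        have "coalesced_turning_points (ff P u (a0 P)) (tp1 P u (a0 P)) (tp2 P u (a0 P))"
          using setting(1) elim(5) by (auto simp: two_turning_point_equation_def)
        then have "alpha P u (a0 P) = 0"
          by (simp add: alpha_def coalesced_turning_points_def)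
        then have "deviation 0 u (a0 P) = lam u (a0 P) - (-1/2)" by (simp add: dev0)
        then show "\<bar>Re (deviation 0 u (a0 P))\<bar> < 1/4"
          using elim(1) abs_Re_le_cmod[of "deviation 0 u (a0 P)"] by (simp only: dist_norm) 
      qed
    qed
  qed
  show ?thesis
    unfolding connection_expansion_def
  proof
    fix N
    obtain C where "\<forall>\<^sub>F u in at_top. \<forall>a\<in>A. norm (deviation N u a - of_int (round (Re (deviation 0 u a)))) \<le> C / u ^ (2 * N + 1)"
      using deviation_expansion by blast
    then have "\<forall>\<^sub>F u in at_top. \<forall>a\<in>A. norm (deviation N u a) \<le> C / u ^ (2 * N + 1)"
      using zero by eventually_elim auto
    then show "\<exists>C. \<forall>\<^sub>F u in at_top. \<forall>a \<in> A.
     norm (lam u a + 1/2 -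
       (of_real (u * (alpha P u a)\<^sup>2 / 2) + 1 / (2 * of_real pi * \<i>) *
         (\<Sum>s<N. (Ehat_x4 (-1) P (2 * s + 1) u a - Ehat_x4 1 P (2 * s + 1) u a) / of_real (u ^ (2 * s + 1)))))
     \<le> C / u ^ (2 * N + 1)"
      unfolding deviation_def by blast
  qed
qed

end

theorem theorem2p1:
  fixes P :: tp_data
    and A :: "real set"
    and w1 w2 w3 w4 :: "real \<Rightarrow> real \<Rightarrow> complex \<Rightarrow> complex"
    and k1 k2 k3 k4p k4m :: "nat \<Rightarrow> real \<Rightarrow> real \<Rightarrow> complex"
    and \<eta>1 \<eta>2 \<eta>3 \<eta>4p \<eta>4m :: "nat \<Rightarrow> real \<Rightarrow> real \<Rightarrow> complex \<Rightarrow> complex"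
    and lam :: "real \<Rightarrow> real \<Rightarrow> complex"
  assumes setting: "two_turning_point_equation P" "singularities_linked P"
    and A: "A \<subseteq> {a0 P..a1 P}"
    and recessive: "\<And>u a. (u, a) \<in> params P \<Longrightarrow>
        recessive P u a (to_x1 P u a) (w1 u a) \<and>
        recessive P u a (to_x2 P u a) (w2 u a) \<and>
        recessive P u a (to_x3 P u a) (w3 u a) \<and>
        recessive P u a (sup (to_x4 1 P u a) (to_x4 (-1) P u a)) (w4 u a)"
    and lg1: "lg_solution P A 1 (Z1 P) (to_x1 P) {to_x2 P, to_x4 1 P} k1 \<eta>1 w1"
    and lg2: "lg_solution P A (-1) (Z2 P) (to_x2 P) {to_x1 P, to_x3 P} k2 \<eta>2 w2"
    and lg3: "lg_solution P A 1 (Z3 P) (to_x3 P) {to_x2 P, to_x4 (-1) P} k3 \<eta>3 w3"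
    and lg4p: "lg_solution P A (-1) (Z4 1 P) (to_x4 1 P) {to_x1 P} k4p \<eta>4p w4"
    and lg4m: "lg_solution P A (-1) (Z4 (-1) P) (to_x4 (-1) P) {to_x3 P} k4m \<eta>4m w4"
    and normalized: "\<And>u a z. (u, a) \<in> params P \<Longrightarrow> z \<in> Dom P \<Longrightarrow>
        w2 u a z = w1 u a z + w3 u a z"
    and connection: "\<And>u a z. (u, a) \<in> params P \<Longrightarrow> z \<in> Dom P \<Longrightarrow>
        w4 u a z = exp (lam u a * of_real pi * \<i>) * w1 u a z
          + exp (- lam u a * of_real pi * \<i>) * w3 u a z"
  shows
    \<comment> \<open>Given \<open>w1\<close>, \<open>w2\<close>, \<open>w3\<close>, the normalisation fixes \<open>w4\<close> up to sign and \<open>lam\<close> up to an integer.\<close>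
    "(\<exists>m :: real \<Rightarrow> real \<Rightarrow> int. connection_expansion P A (\<lambda>u a. lam u a + of_int (m u a))) \<and>
     \<comment> \<open>The integer is zero for the branch continued from the coalescence of the turning points.\<close>
     (connected A \<and> a0 P \<in> A \<and>
      (\<forall>u\<ge>umin P. continuous_on A (lam u) \<and> continuous_on A (alpha P u)) \<and>
      ((\<lambda>u. lam u (a0 P)) \<longlongrightarrow> -1/2) at_top
      \<longrightarrow> connection_expansion P A lam)"
proof -
  interpret connection_problem P A w1 w2 w3 w4 k1 k2 k3 k4p k4m \<eta>1 \<eta>2 \<eta>3 \<eta>4p \<eta>4m lam
    by unfold_locales (fact setting A recessive lg1 lg2 lg3 lg4p lg4m normalized connection)+
  show ?thesis
    by (intro conjI impI exI[of _ "\<lambda>u a. - round (Re (deviation 0 u a))"] expansion_mod_integers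
        expansion_continued_from_coalescence) auto
qed

end
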